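(* Let $\Gamma$ be a discrete group, let $k_1,k_2$ be positive integers, let $\Lambda_1$ be a finitely-aligned $k_1$-graph and $\Lambda_2$ a finitely-aligned $k_2$-graph, let $\eta_1:\Lambda_1\to\Gamma$ and $\eta_2:\Lambda_2\to\Gamma$ be functors, and let $h:\partial\Lambda_1\to\partial\Lambda_2$ be a homeomorphism. The following are equivalent. (1) There is an isomorphism of topological groupoids $\phi:\mathcal{G}_{\Lambda_1}\to\mathcal{G}_{\Lambda_2}$ such that $c_{\eta_2}\circ\phi=c_{\eta_1}$ and $\phi(x_1,0,x_1)=(h(x_1),0,h(x_1))$ for all $x_1\in\partial\Lambda_1$. (2) The homeomorphism $h$ is a $\Gamma$-graded, period-preserving continuous orbit equivalence. (3) The homeomorphism $h$ is a $\Gamma$-graded continuous orbit equivalence with a family of continuous cocycles $\{f_{m_1},g_{m_1},i_{m_2},j_{m_2}:m_1\in\mathbb{N}^{k_1},\ m_2\in\mathbb{N}^{k_2}\}$ satisfying, for every $x_1\in\partial\Lambda_1$, $$\{g_{m}(x_1)-f_{m}(x_1)-g_{n}(x_1)+f_{n}(x_1): (m,n)\in \mathcal{I}(x_1)\}=\mathrm{IP}(h(x_1)),$$ and, for every $x_2\in\partial\Lambda_2$, $$\{j_{m}(x_2)-i_{m}(x_2)-j_{n}(x_2)+i_{n}(x_2): (m,n)\in \mathcal{I}(x_2)\}=\mathrm{IP}(h^{-1}(x_2)),$$ where for $x\in\partial\Lambda$ with $\Lambda$ a finitely-aligned $k$-graph, $\mathcal{I}(x)$ is the set of pairs $(m,n)\in\mathbb{N}^k\times\mathbb{N}^k$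 for which there is an open neighbourhood $U$ of $x$ with $\sigma_\Lambda^m(y)=\sigma_\Lambda^n(y)$ for all $y\in U$.
   Context: Higher-rank graphs. $\mathbb{N}$ contains $0$; $\mathbb{N}^k$ has the coordinatewise partial order $\le$, and $m\vee n$ is the coordinatewise maximum. A $k$-graph is a countable small category $\Lambda$ (identified with its set of morphisms, with range and source maps $r,s$) with a functor $d:\Lambda\to\mathbb{N}^k$ satisfying the factorisation property: if $d(\lambda)=m+n$ there are unique $\mu,\nu\in\Lambda$ with $d(\mu)=m$, $d(\nu)=n$, $\lambda=\mu\nu$; then $\lambda(0,m):=\mu$ and $\lambda(m,m+n):=\nu$. $\Lambda^n:=d^{-1}(n)$; $\Lambda^0$ is identified with the set of objects (vertices). For $v\in\Lambda^0$, $v\Lambda:=\{\lambda: r(\lambda)=v\}$. $\mathrm{MCE}(\lambda,\mu)$ is the set of $\tau\in\Lambda$ with $d(\tau)=d(\lambda)\vee d(\mu)$, $\tau(0,d(\lambda))=\lambda$, $\tau(0,d(\mu))=\mu$, and $\Lambda^{\min}(\lambda,\mu):=\{(\rho,\tau):\lambda\rho=\mu\tau\in\mathrm{MCE}(\lambda,\mu)\}$. $\Lambda$ is finitely-aligned if every $\Lambda^{\min}(\lambda,\mu)$ is finite. $E\subseteq v\Lambda$ is exhaustive if for every $\lambda\in v\Lambda$ there is $\mu\in E$ with $\Lambda^{\min}(\lambda,\mu)\neq\emptyset$ (otherwise nonexhaustive). Boundary paths. For $m\in(\mathbb{N}\cup\{\infty\})^k$, $\Omega_{k,m}$ is the $k$-graph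 $\{(p,q)\in\mathbb{N}^k\times\mathbb{N}^k:p\le q\le m\}$ with $r(p,q)=p$, $s(p,q)=q$, $d(p,q)=q-p$, $(p,q)(q,t)=(p,t)$. A boundary path is a degree-preserving functor $x:\Omega_{k,m}\to\Lambda$ such that for every $n\in\mathbb{N}^k$ with $n\le m$ and every finite exhaustive $E\subseteq x(n,n)\Lambda$ there is $\lambda\in E$ with $x(n,n+d(\lambda))=\lambda$; put $r(x):=x(0,0)$, $d(x):=m$. $\partial\Lambda$ is the set of boundary paths, $\partial\Lambda^{\ge m}:=\{x:d(x)\ge m\}$, and $\sigma_\Lambda^m:\partial\Lambda^{\ge m}\to\partial\Lambda$ is $\sigma_\Lambda^m(x)(p,q)=x(p+m,q+m)$; writing $\sigma_\Lambda^m(x)$ implicitly assumes $x\in\partial\Lambda^{\ge m}$. For $\lambda\in\Lambda$ and $x\in\partial\Lambda$ with $r(x)=s(\lambda)$, $\lambda x$ is the boundary path with $(\lambda x)(0,d(\lambda))=\lambda$ and $\sigma_\Lambda^{d(\lambda)}(\lambda x)=x$. $Z_\Lambda(\lambda):=\{\lambda x:x\in\partial\Lambda,\ r(x)=s(\lambda)\}$, and for finite nonexhaustive $G\subseteq s(\lambda)\Lambda$, $Z_\Lambda(\lambda\setminus G):=Z_\Lambda(\lambda)\setminus\bigcup_{\nu\in G}Z_\Lambda(\lambda\nu)$; these sets are a basis of the topology of $\partial\Lambda$. Boundary path groupoid. $\mathcal{G}_\Lambda:=\{(x,m,y)\in\partial\Lambda\times\mathbb{Z}^k\times\partial\Lambda:\exists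 p\le d(x),\ q\le d(y)\text{ in }\mathbb{N}^k,\ p-q=m,\ \sigma_\Lambda^p(x)=\sigma_\Lambda^q(y)\}$, with product $(x,m,y)(y,n,z)=(x,m+n,z)$, inverse $(y,-m,x)$, range $x$, source $y$. For $s(\lambda)=s(\mu)$ and finite nonexhaustive $G\subseteq s(\lambda)\Lambda$, $Z_\Lambda(\lambda*_s\mu):=\{(x,d(\lambda)-d(\mu),y): x\in Z_\Lambda(\lambda),\ y\in Z_\Lambda(\mu),\ \sigma_\Lambda^{d(\lambda)}(x)=\sigma_\Lambda^{d(\mu)}(y)\}$ and $Z_\Lambda(\lambda*_s\mu\setminus G):=Z_\Lambda(\lambda*_s\mu)\setminus\bigcup_{\nu\in G}Z_\Lambda(\lambda\nu*_s\mu\nu)$; these are a basis of the topology of $\mathcal{G}_\Lambda$. The unit space is identified with $\partial\Lambda$ via $x\mapsto(x,0,x)$. For a functor $\eta:\Lambda\to\Gamma$, $c_\eta:\mathcal{G}_\Lambda\to\Gamma$ is the continuous cocycle $c_\eta(\mu x,d(\mu)-d(\nu),\nu x)=\eta(\mu)\eta(\nu)^{-1}$. Orbit equivalence. $\mathrm{orb}_\Lambda(x):=\bigcup_{n\in\mathbb{N}^k}\bigcup_{m\le d(x)}(\sigma_\Lambda^n)^{-1}(\{\sigma_\Lambda^m(x)\})$. A homeomorphism $h:\partial\Lambda_1\to\partial\Lambda_2$ is an orbit equivalence if $h(\mathrm{orb}_{\Lambda_1}(x))=\mathrm{orb}_{\Lambda_2}(h(x))$ for all $x\in\partial\Lambda_1$.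 A family of continuous cocycles for an orbit equivalence $h$ consists of continuous maps $f_{m_1},g_{m_1}:\partial\Lambda_1^{\ge m_1}\to\mathbb{N}^{k_2}$ ($m_1\in\mathbb{N}^{k_1}$) and $i_{m_2},j_{m_2}:\partial\Lambda_2^{\ge m_2}\to\mathbb{N}^{k_1}$ ($m_2\in\mathbb{N}^{k_2}$) with $\sigma_{\Lambda_2}^{f_{m_1}(x_1)}(h(\sigma_{\Lambda_1}^{m_1}(x_1)))=\sigma_{\Lambda_2}^{g_{m_1}(x_1)}(h(x_1))$ for $x_1\in\partial\Lambda_1^{\ge m_1}$; $\sigma_{\Lambda_1}^{i_{m_2}(x_2)}(h^{-1}(\sigma_{\Lambda_2}^{m_2}(x_2)))=\sigma_{\Lambda_1}^{j_{m_2}(x_2)}(h^{-1}(x_2))$ for $x_2\in\partial\Lambda_2^{\ge m_2}$; and the cocycle identities $(g-f)_{m_1+n_1}(x_1)=(g-f)_{m_1}(x_1)+(g-f)_{n_1}(\sigma_{\Lambda_1}^{m_1}(x_1))$ for $x_1\in\partial\Lambda_1^{\ge m_1+n_1}$ and $(j-i)_{m_2+n_2}(x_2)=(j-i)_{m_2}(x_2)+(j-i)_{n_2}(\sigma_{\Lambda_2}^{m_2}(x_2))$ for $x_2\in\partial\Lambda_2^{\ge m_2+n_2}$, where $(g-f)_m:=g_m-f_m$, $(j-i)_m:=j_m-i_m$. If such a family exists, $h$ is a continuous orbit equivalence. $\mathrm{Per}(x):=\{m-n:m,n\in\mathbb{N}^k,\ \sigma_\Lambda^m(x)=\sigma_\Lambda^n(x)\}$.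 $\mathrm{IP}(x):=\{m-n:m,n\in\mathbb{N}^k$ and there is an open neighbourhood $U$ of $x$ with $\sigma_\Lambda^m(y)=\sigma_\Lambda^n(y)$ for all $y\in U\}$. A continuous orbit equivalence $h$ is period-preserving if it has a family of continuous cocycles satisfying $\{g_{m}(x_1)-f_{m}(x_1)-g_{n}(x_1)+f_{n}(x_1):m,n\in\mathbb{N}^{k_1},\ \sigma_{\Lambda_1}^{m}(x_1)=\sigma_{\Lambda_1}^{n}(x_1)\}=\mathrm{Per}(h(x_1))$ for every $x_1\in\partial\Lambda_1$ and $\{j_{m}(x_2)-i_{m}(x_2)-j_{n}(x_2)+i_{n}(x_2):m,n\in\mathbb{N}^{k_2},\ \sigma_{\Lambda_2}^{m}(x_2)=\sigma_{\Lambda_2}^{n}(x_2)\}=\mathrm{Per}(h^{-1}(x_2))$ for every $x_2\in\partial\Lambda_2$. A continuous orbit equivalence $h$ is $\Gamma$-graded (with respect to $\eta_1,\eta_2$) if there is a family of continuous cocycles for $h$ such that $\eta_1(x_1(0,m_1))=\eta_2(h(x_1)(0,g_{m_1}(x_1)))\,\eta_2(h(\sigma_{\Lambda_1}^{m_1}(x_1))(0,f_{m_1}(x_1)))^{-1}$ for all $m_1\in\mathbb{N}^{k_1}$, $x_1\in\partial\Lambda_1^{\ge m_1}$, and $\eta_2(x_2(0,m_2))=\eta_1(h^{-1}(x_2)(0,j_{m_2}(x_2)))\,\eta_1(h^{-1}(\sigma_{\Lambda_2}^{m_2}(x_2))(0,i_{m_2}(x_2)))^{-1}$ for all $m_2\in\mathbb{N}^{k_2}$,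 $x_2\in\partial\Lambda_2^{\ge m_2}$.
   Formalization: In (2) and (3) one and the same family of continuous cocycles must be Γ-graded and also period-preserving (respectively satisfy the IP equations); with separate families the equivalence fails, e.g. for two single loops graded by Z/5 with generators sent to 1 and 2. *)

theory Defs
  imports
    "HOL-Analysis.Abstract_Topology"
    "HOL-Analysis.Finite_Cartesian_Product"
    "HOL-Library.Extended_Nat"
    "HOL-Library.Countable_Set"
    "HOL-Algebra.Group"
begin

section \<open>Degrees\<close>

text \<open>
  \<open>\<nat>\<^sup>k\<close>, \<open>\<int>\<^sup>k\<close> and \<open>(\<nat> \<union> {\<infinity>})\<^sup>k\<close> are vectors indexed by a finite
  type \<open>'k\<close> with \<open>k\<close> elements, with the library's coordinatewise order and arithmetic.
  Subtraction on \<open>\<nat>\<^sup>k\<close> truncates, so differences are formed in \<open>\<int>\<^sup>k\<close> unless the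
  subtrahend is known to be below.
\<close>

definition int_vec :: "nat ^ 'k \<Rightarrow> int ^ 'k" where
  "int_vec n = (\<chi> i. int (n $ i))"

definition enat_vec :: "nat ^ 'k \<Rightarrow> enat ^ 'k" where
  "enat_vec n = (\<chi> i. enat (n $ i))"

definition vec_max :: "nat ^ 'k \<Rightarrow> nat ^ 'k \<Rightarrow> nat ^ 'k" where
  "vec_max m n = (\<chi> i. max (m $ i) (n $ i))"


section \<open>Small categories and functors\<close>

text \<open>
  A category is identified with its set of morphisms, an object being identified with its
  identity morphism; \<open>Rng\<close> and \<open>Src\<close> therefore take values in the identity morphisms, and
  \<open>Comp a b\<close> (written \<open>ab\<close>) is meaningful when \<open>Src a = Rng b\<close>.
\<close>

record 'a category =
  Arr :: "'a set"
  Rng :: "'a \<Rightarrow> 'a"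
  Src :: "'a \<Rightarrow> 'a"
  Comp :: "'a \<Rightarrow> 'a \<Rightarrow> 'a"

definition small_category :: "('a, 'm) category_scheme \<Rightarrow> bool" where
  "small_category C \<longleftrightarrow>
     (\<forall>a\<in>Arr C. Rng C a \<in> Arr C \<and> Src C a \<in> Arr C) \<and>
     (\<forall>a\<in>Arr C. Rng C (Rng C a) = Rng C a \<and> Src C (Rng C a) = Rng C a \<and>
                Rng C (Src C a) = Src C a \<and> Src C (Src C a) = Src C a) \<and>
     (\<forall>a\<in>Arr C. Comp C (Rng C a) a = a \<and> Comp C a (Src C a) = a) \<and>
     (\<forall>a\<in>Arr C. \<forall>b\<in>Arr C. Src C a = Rng C b \<longrightarrow>
        Comp C a b \<in> Arr C \<and> Rng C (Comp C a b) = Rng C a \<and> Src C (Comp C a b) = Src C b) \<and>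
     (\<forall>a\<in>Arr C. \<forall>b\<in>Arr C. \<forall>c\<in>Arr C. Src C a = Rng C b \<longrightarrow> Src C b = Rng C c \<longrightarrow>
        Comp C (Comp C a b) c = Comp C a (Comp C b c))"

text \<open>Preservation of \<open>Rng\<close> and \<open>Src\<close> includes preservation of identity morphisms.\<close>

definition cat_functor ::
  "('a, 'm) category_scheme \<Rightarrow> ('b, 'n) category_scheme \<Rightarrow> ('a \<Rightarrow> 'b) \<Rightarrow> bool" where
  "cat_functor C D F \<longleftrightarrow>
     (\<forall>a\<in>Arr C. F a \<in> Arr D \<and> F (Rng C a) = Rng D (F a) \<and> F (Src C a) = Src D (F a)) \<and>
     (\<forall>a\<in>Arr C. \<forall>b\<in>Arr C. Src C a = Rng C b \<longrightarrow> F (Comp C a b) = Comp D (F a) (F b))"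

definition group_category :: "('g, 'm) monoid_scheme \<Rightarrow> 'g category" where
  "group_category G =
     \<lparr>Arr = carrier G, Rng = (\<lambda>_. \<one>\<^bsub>G\<^esub>), Src = (\<lambda>_. \<one>\<^bsub>G\<^esub>), Comp = (\<lambda>a b. a \<otimes>\<^bsub>G\<^esub> b)\<rparr>"


section \<open>Higher-rank graphs\<close>

record ('a, 'k::finite) kgraph = "'a category" +
  Deg :: "'a \<Rightarrow> nat ^ 'k"

definition is_factorisation ::
  "('a, 'k::finite) kgraph \<Rightarrow> 'a \<Rightarrow> nat ^ 'k \<Rightarrow> nat ^ 'k \<Rightarrow> 'a \<times> 'a \<Rightarrow> bool" where
  "is_factorisation L l m n = (\<lambda>(a, b).
     a \<in> Arr L \<and> b \<in> Arr L \<and> Src L a = Rng L b \<and>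
     Deg L a = m \<and> Deg L b = n \<and> l = Comp L a b)"

definition is_kgraph :: "('a, 'k::finite) kgraph \<Rightarrow> bool" where
  "is_kgraph L \<longleftrightarrow>
     small_category L \<and> countable (Arr L) \<and>
     (\<forall>a\<in>Arr L. Deg L (Rng L a) = 0 \<and> Deg L (Src L a) = 0) \<and>
     (\<forall>a\<in>Arr L. \<forall>b\<in>Arr L. Src L a = Rng L b \<longrightarrow> Deg L (Comp L a b) = Deg L a + Deg L b) \<and>
     (\<forall>l\<in>Arr L. \<forall>m n. Deg L l = m + n \<longrightarrow> (\<exists>!p. is_factorisation L l m n p))"

text \<open>\<open>\<lambda>(0,m)\<close>, for \<open>m \<le> d(\<lambda>)\<close>.\<close>

definition initial_seg :: "('a, 'k::finite) kgraph \<Rightarrow> 'a \<Rightarrow> nat ^ 'k \<Rightarrow> 'a" where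
  "initial_seg L l m = fst (THE p. is_factorisation L l m (Deg L l - m) p)"

definition arrows_into :: "('a, 'k::finite) kgraph \<Rightarrow> 'a \<Rightarrow> 'a set" where
  "arrows_into L v = {l \<in> Arr L. Rng L l = v}"

definition MCE :: "('a, 'k::finite) kgraph \<Rightarrow> 'a \<Rightarrow> 'a \<Rightarrow> 'a set" where
  "MCE L l u = {t \<in> Arr L. Deg L t = vec_max (Deg L l) (Deg L u) \<and>
     initial_seg L t (Deg L l) = l \<and> initial_seg L t (Deg L u) = u}"

definition Lambda_min :: "('a, 'k::finite) kgraph \<Rightarrow> 'a \<Rightarrow> 'a \<Rightarrow> ('a \<times> 'a) set" where
  "Lambda_min L l u = {(a, b). a \<in> Arr L \<and> b \<in> Arr L \<and> Src L l = Rng L a \<and> Src L u = Rng L b \<and>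
     Comp L l a = Comp L u b \<and> Comp L l a \<in> MCE L l u}"

definition finitely_aligned :: "('a, 'k::finite) kgraph \<Rightarrow> bool" where
  "finitely_aligned L \<longleftrightarrow> (\<forall>l\<in>Arr L. \<forall>u\<in>Arr L. finite (Lambda_min L l u))"

definition exhaustive :: "('a, 'k::finite) kgraph \<Rightarrow> 'a \<Rightarrow> 'a set \<Rightarrow> bool" where
  "exhaustive L v E \<longleftrightarrow> (\<forall>l\<in>arrows_into L v. \<exists>u\<in>E. Lambda_min L l u \<noteq> {})"


section \<open>Boundary paths\<close>

definition Omega :: "enat ^ 'k \<Rightarrow> ((nat ^ 'k) \<times> (nat ^ 'k), 'k) kgraph" where
  "Omega m =
     \<lparr>Arr = {(p, q). p \<le> q \<and> enat_vec q \<le> m},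
      Rng = (\<lambda>(p, q). (p, p)),
      Src = (\<lambda>(p, q). (q, q)),
      Comp = (\<lambda>(p, q) (q', t). (p, t)),
      Deg = (\<lambda>(p, q). q - p)\<rparr>"

text \<open>
  A path of degree \<open>m\<close> is a function on the morphisms of \<open>\<Omega>\<^bsub>k,m\<^esub>\<close>. It is recorded
  together with \<open>m\<close>, and made extensional so that equality of paths is equality of functors.
\<close>

record ('a, 'k::finite) path =
  path_deg :: "enat ^ 'k"
  path_map :: "(nat ^ 'k) \<times> (nat ^ 'k) \<Rightarrow> 'a"

definition boundary_paths :: "('a, 'k::finite) kgraph \<Rightarrow> ('a, 'k) path set" where
  "boundary_paths L = {x.
     path_map x \<in> extensional (Arr (Omega (path_deg x))) \<and>
     cat_functor (Omega (path_deg x)) L (path_map x) \<and>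
     (\<forall>a\<in>Arr (Omega (path_deg x)). Deg L (path_map x a) = Deg (Omega (path_deg x)) a) \<and>
     (\<forall>n E. enat_vec n \<le> path_deg x \<longrightarrow> finite E \<longrightarrow> E \<subseteq> arrows_into L (path_map x (n, n)) \<longrightarrow>
        exhaustive L (path_map x (n, n)) E \<longrightarrow>
        (\<exists>l\<in>E. enat_vec (n + Deg L l) \<le> path_deg x \<and> path_map x (n, n + Deg L l) = l))}"

definition path_range :: "('a, 'k::finite) path \<Rightarrow> 'a" where
  "path_range x = path_map x (0, 0)"

definition boundary_paths_ge :: "('a, 'k::finite) kgraph \<Rightarrow> nat ^ 'k \<Rightarrow> ('a, 'k) path set" where
  "boundary_paths_ge L m = {x \<in> boundary_paths L. enat_vec m \<le> path_deg x}"

definition shift :: "nat ^ 'k \<Rightarrow> ('a, 'k::finite) path \<Rightarrow> ('a, 'k) path" where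
  "shift m x =
     \<lparr>path_deg = path_deg x - enat_vec m,
      path_map = restrict (\<lambda>(p, q). path_map x (p + m, q + m))
                   (Arr (Omega (path_deg x - enat_vec m)))\<rparr>"

text \<open>
  The assertion \<open>\<sigma>\<^sup>m(x) = \<sigma>\<^sup>n(y)\<close>, including its implicit claim that both sides are defined.
\<close>

definition shifts_eq ::
  "('a, 'k::finite) kgraph \<Rightarrow> nat ^ 'k \<Rightarrow> ('a, 'k) path \<Rightarrow> nat ^ 'k \<Rightarrow> ('a, 'k) path \<Rightarrow> bool" where
  "shifts_eq L m x n y \<longleftrightarrow>
     x \<in> boundary_paths_ge L m \<and> y \<in> boundary_paths_ge L n \<and> shift m x = shift n y"

text \<open>\<open>\<lambda>x\<close>, for \<open>x \<in> \<partial>\<Lambda>\<close> with \<open>r(x) = s(\<lambda>)\<close>.\<close>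

definition prepend :: "('a, 'k::finite) kgraph \<Rightarrow> 'a \<Rightarrow> ('a, 'k) path \<Rightarrow> ('a, 'k) path" where
  "prepend L l x = (THE y. y \<in> boundary_paths_ge L (Deg L l) \<and>
     path_map y (0, Deg L l) = l \<and> shift (Deg L l) y = x)"

definition cylinder :: "('a, 'k::finite) kgraph \<Rightarrow> 'a \<Rightarrow> ('a, 'k) path set" where
  "cylinder L l = {prepend L l x | x. x \<in> boundary_paths L \<and> path_range x = Src L l}"

definition cylinder_diff :: "('a, 'k::finite) kgraph \<Rightarrow> 'a \<Rightarrow> 'a set \<Rightarrow> ('a, 'k) path set" where
  "cylinder_diff L l G = cylinder L l - (\<Union>u\<in>G. cylinder L (Comp L l u))"

text \<open>
  The generating sets below, and those of the groupoid topology, are bases, so the generated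
  topology consists exactly of their unions. As the empty set is nonexhaustive, the cylinder
  sets \<open>Z(\<lambda>)\<close> themselves are among them, and the underlying space is \<open>\<partial>\<Lambda>\<close>.
\<close>

definition boundary_topology :: "('a, 'k::finite) kgraph \<Rightarrow> ('a, 'k) path topology" where
  "boundary_topology L = topology_generated_by
     {cylinder_diff L l G | l G. l \<in> Arr L \<and> finite G \<and> G \<subseteq> arrows_into L (Src L l) \<and>
        \<not> exhaustive L (Src L l) G}"


section \<open>The boundary path groupoid\<close>

record 'a groupoid = "'a category" +
  Inv :: "'a \<Rightarrow> 'a"

type_synonym ('a, 'k) bp_triple = "('a, 'k) path \<times> (int, 'k) vec \<times> ('a, 'k) path"

text \<open>Units are the triples \<open>(x,0,x)\<close>; range and source are given as units.\<close>

definition bp_groupoid :: "('a, 'k::finite) kgraph \<Rightarrow> ('a, 'k) bp_triple groupoid" where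
  "bp_groupoid L =
     \<lparr>Arr = {(x, m, y). x \<in> boundary_paths L \<and> y \<in> boundary_paths L \<and>
              (\<exists>p q. int_vec p - int_vec q = m \<and> shifts_eq L p x q y)},
      Rng = (\<lambda>(x, m, y). (x, 0, x)),
      Src = (\<lambda>(x, m, y). (y, 0, y)),
      Comp = (\<lambda>(x, m, y) (y', n, z). (x, m + n, z)),
      Inv = (\<lambda>(x, m, y). (y, - m, x))\<rparr>"

definition bisection ::
  "('a, 'k::finite) kgraph \<Rightarrow> 'a \<Rightarrow> 'a \<Rightarrow> ('a, 'k) bp_triple set" where
  "bisection L l u = {(x, int_vec (Deg L l) - int_vec (Deg L u), y) | x y.
     x \<in> cylinder L l \<and> y \<in> cylinder L u \<and> shifts_eq L (Deg L l) x (Deg L u) y}"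

definition bisection_diff ::
  "('a, 'k::finite) kgraph \<Rightarrow> 'a \<Rightarrow> 'a \<Rightarrow> 'a set \<Rightarrow> ('a, 'k) bp_triple set" where
  "bisection_diff L l u G = bisection L l u - (\<Union>w\<in>G. bisection L (Comp L l w) (Comp L u w))"

definition bp_groupoid_topology ::
  "('a, 'k::finite) kgraph \<Rightarrow> ('a, 'k) bp_triple topology" where
  "bp_groupoid_topology L = topology_generated_by
     {bisection_diff L l u G | l u G. l \<in> Arr L \<and> u \<in> Arr L \<and> Src L l = Src L u \<and>
        finite G \<and> G \<subseteq> arrows_into L (Src L l) \<and> \<not> exhaustive L (Src L l) G}"

definition topological_groupoid_iso ::
  "('a, 'm) groupoid_scheme \<Rightarrow> 'a topology \<Rightarrow> ('b, 'n) groupoid_scheme \<Rightarrow> 'b topology \<Rightarrow>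
   ('a \<Rightarrow> 'b) \<Rightarrow> bool" where
  "topological_groupoid_iso G S H T \<phi> \<longleftrightarrow>
     bij_betw \<phi> (Arr G) (Arr H) \<and> cat_functor G H \<phi> \<and>
     (\<forall>a\<in>Arr G. \<phi> (Inv G a) = Inv H (\<phi> a)) \<and>
     homeomorphic_map S T \<phi>"

text \<open>\<open>c\<^sub>\<eta>(\<mu>x, d(\<mu>) - d(\<nu>), \<nu>x) = \<eta>(\<mu>) \<eta>(\<nu>)\<^sup>-\<^sup>1\<close>.\<close>

definition grading_cocycle ::
  "('g, 'm) monoid_scheme \<Rightarrow> ('a, 'k::finite) kgraph \<Rightarrow> ('a \<Rightarrow> 'g) \<Rightarrow> ('a, 'k) bp_triple \<Rightarrow> 'g" where
  "grading_cocycle \<Gamma> L \<eta> t = (THE c. \<exists>u\<in>Arr L. \<exists>w\<in>Arr L. \<exists>x\<in>boundary_paths L.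
     path_range x = Src L u \<and> path_range x = Src L w \<and>
     t = (prepend L u x, int_vec (Deg L u) - int_vec (Deg L w), prepend L w x) \<and>
     c = \<eta> u \<otimes>\<^bsub>\<Gamma>\<^esub> inv\<^bsub>\<Gamma>\<^esub> \<eta> w)"


section \<open>Orbit equivalence\<close>

definition orbit :: "('a, 'k::finite) kgraph \<Rightarrow> ('a, 'k) path \<Rightarrow> ('a, 'k) path set" where
  "orbit L x = (\<Union>n. \<Union>m\<in>{m. enat_vec m \<le> path_deg x}.
     {y \<in> boundary_paths_ge L n. shift n y = shift m x})"

definition orbit_equivalence ::
  "('a, 'k1::finite) kgraph \<Rightarrow> ('b, 'k2::finite) kgraph \<Rightarrow>
   (('a, 'k1) path \<Rightarrow> ('b, 'k2) path) \<Rightarrow> bool" where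
  "orbit_equivalence L1 L2 h \<longleftrightarrow>
     homeomorphic_map (boundary_topology L1) (boundary_topology L2) h \<and>
     (\<forall>x\<in>boundary_paths L1. h ` orbit L1 x = orbit L2 (h x))"

definition boundary_inverse ::
  "('a, 'k1::finite) kgraph \<Rightarrow> (('a, 'k1) path \<Rightarrow> ('b, 'k2::finite) path) \<Rightarrow>
   ('b, 'k2) path \<Rightarrow> ('a, 'k1) path" where
  "boundary_inverse L1 h = inv_into (boundary_paths L1) h"

text \<open>
  A family of continuous cocycles consists of maps \<open>f, g\<close> for \<open>h\<close> and maps \<open>i, j\<close> for the
  inverse of \<open>h\<close> with the two graphs exchanged. All conditions on the family come in pairs
  related by this exchange (with \<open>i\<close> in the role of \<open>f\<close> and \<open>j\<close> in that of \<open>g\<close>), so each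
  is first stated for one half of the family; \<open>\<nat>\<^sup>k\<close> is discrete.
\<close>

definition half_cocycle_family ::
  "('a, 'k1::finite) kgraph \<Rightarrow> ('b, 'k2::finite) kgraph \<Rightarrow> (('a, 'k1) path \<Rightarrow> ('b, 'k2) path) \<Rightarrow>
   (nat ^ 'k1 \<Rightarrow> ('a, 'k1) path \<Rightarrow> nat ^ 'k2) \<Rightarrow>
   (nat ^ 'k1 \<Rightarrow> ('a, 'k1) path \<Rightarrow> nat ^ 'k2) \<Rightarrow> bool" where
  "half_cocycle_family L1 L2 h f g \<longleftrightarrow>
     (\<forall>m. continuous_map (subtopology (boundary_topology L1) (boundary_paths_ge L1 m))
            (discrete_topology UNIV) (f m)) \<and>
     (\<forall>m. continuous_map (subtopology (boundary_topology L1) (boundary_paths_ge L1 m))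
            (discrete_topology UNIV) (g m)) \<and>
     (\<forall>m. \<forall>x\<in>boundary_paths_ge L1 m. shifts_eq L2 (f m x) (h (shift m x)) (g m x) (h x)) \<and>
     (\<forall>m n. \<forall>x\<in>boundary_paths_ge L1 (m + n).
        int_vec (g (m + n) x) - int_vec (f (m + n) x) =
        (int_vec (g m x) - int_vec (f m x)) +
        (int_vec (g n (shift m x)) - int_vec (f n (shift m x))))"

definition cocycle_family ::
  "('a, 'k1::finite) kgraph \<Rightarrow> ('b, 'k2::finite) kgraph \<Rightarrow> (('a, 'k1) path \<Rightarrow> ('b, 'k2) path) \<Rightarrow>
   (nat ^ 'k1 \<Rightarrow> ('a, 'k1) path \<Rightarrow> nat ^ 'k2) \<Rightarrow>
   (nat ^ 'k1 \<Rightarrow> ('a, 'k1) path \<Rightarrow> nat ^ 'k2) \<Rightarrow>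
   (nat ^ 'k2 \<Rightarrow> ('b, 'k2) path \<Rightarrow> nat ^ 'k1) \<Rightarrow>
   (nat ^ 'k2 \<Rightarrow> ('b, 'k2) path \<Rightarrow> nat ^ 'k1) \<Rightarrow> bool" where
  "cocycle_family L1 L2 h f g i j \<longleftrightarrow>
     half_cocycle_family L1 L2 h f g \<and>
     half_cocycle_family L2 L1 (boundary_inverse L1 h) i j"

definition Per :: "('a, 'k::finite) kgraph \<Rightarrow> ('a, 'k) path \<Rightarrow> (int ^ 'k) set" where
  "Per L x = {int_vec m - int_vec n | m n. shifts_eq L m x n x}"

definition IP_pairs ::
  "('a, 'k::finite) kgraph \<Rightarrow> ('a, 'k) path \<Rightarrow> ((nat ^ 'k) \<times> (nat ^ 'k)) set" where
  "IP_pairs L x = {(m, n). \<exists>U. openin (boundary_topology L) U \<and> x \<in> U \<and>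
     (\<forall>y\<in>U. shifts_eq L m y n y)}"

definition IP :: "('a, 'k::finite) kgraph \<Rightarrow> ('a, 'k) path \<Rightarrow> (int ^ 'k) set" where
  "IP L x = {int_vec m - int_vec n | m n. (m, n) \<in> IP_pairs L x}"

definition half_period_preserving ::
  "('a, 'k1::finite) kgraph \<Rightarrow> ('b, 'k2::finite) kgraph \<Rightarrow> (('a, 'k1) path \<Rightarrow> ('b, 'k2) path) \<Rightarrow>
   (nat ^ 'k1 \<Rightarrow> ('a, 'k1) path \<Rightarrow> nat ^ 'k2) \<Rightarrow>
   (nat ^ 'k1 \<Rightarrow> ('a, 'k1) path \<Rightarrow> nat ^ 'k2) \<Rightarrow> bool" where
  "half_period_preserving L1 L2 h f g \<longleftrightarrow> (\<forall>x\<in>boundary_paths L1.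
     {int_vec (g m x) - int_vec (f m x) - int_vec (g n x) + int_vec (f n x) | m n.
        shifts_eq L1 m x n x} = Per L2 (h x))"

definition half_IP_preserving ::
  "('a, 'k1::finite) kgraph \<Rightarrow> ('b, 'k2::finite) kgraph \<Rightarrow> (('a, 'k1) path \<Rightarrow> ('b, 'k2) path) \<Rightarrow>
   (nat ^ 'k1 \<Rightarrow> ('a, 'k1) path \<Rightarrow> nat ^ 'k2) \<Rightarrow>
   (nat ^ 'k1 \<Rightarrow> ('a, 'k1) path \<Rightarrow> nat ^ 'k2) \<Rightarrow> bool" where
  "half_IP_preserving L1 L2 h f g \<longleftrightarrow> (\<forall>x\<in>boundary_paths L1.
     {int_vec (g m x) - int_vec (f m x) - int_vec (g n x) + int_vec (f n x) | m n.
        (m, n) \<in> IP_pairs L1 x} = IP L2 (h x))"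

definition half_graded ::
  "('g, 'c) monoid_scheme \<Rightarrow>
   ('a, 'k1::finite) kgraph \<Rightarrow> ('b, 'k2::finite) kgraph \<Rightarrow> ('a \<Rightarrow> 'g) \<Rightarrow> ('b \<Rightarrow> 'g) \<Rightarrow>
   (('a, 'k1) path \<Rightarrow> ('b, 'k2) path) \<Rightarrow>
   (nat ^ 'k1 \<Rightarrow> ('a, 'k1) path \<Rightarrow> nat ^ 'k2) \<Rightarrow>
   (nat ^ 'k1 \<Rightarrow> ('a, 'k1) path \<Rightarrow> nat ^ 'k2) \<Rightarrow> bool" where
  "half_graded \<Gamma> L1 L2 \<eta>1 \<eta>2 h f g \<longleftrightarrow> (\<forall>m. \<forall>x\<in>boundary_paths_ge L1 m.
     \<eta>1 (path_map x (0, m)) =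
     \<eta>2 (path_map (h x) (0, g m x)) \<otimes>\<^bsub>\<Gamma>\<^esub>
     inv\<^bsub>\<Gamma>\<^esub> \<eta>2 (path_map (h (shift m x)) (0, f m x)))"

definition period_preserving_family ::
  "('a, 'k1::finite) kgraph \<Rightarrow> ('b, 'k2::finite) kgraph \<Rightarrow> (('a, 'k1) path \<Rightarrow> ('b, 'k2) path) \<Rightarrow>
   (nat ^ 'k1 \<Rightarrow> ('a, 'k1) path \<Rightarrow> nat ^ 'k2) \<Rightarrow>
   (nat ^ 'k1 \<Rightarrow> ('a, 'k1) path \<Rightarrow> nat ^ 'k2) \<Rightarrow>
   (nat ^ 'k2 \<Rightarrow> ('b, 'k2) path \<Rightarrow> nat ^ 'k1) \<Rightarrow>
   (nat ^ 'k2 \<Rightarrow> ('b, 'k2) path \<Rightarrow> nat ^ 'k1) \<Rightarrow> bool" where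
  "period_preserving_family L1 L2 h f g i j \<longleftrightarrow>
     half_period_preserving L1 L2 h f g \<and>
     half_period_preserving L2 L1 (boundary_inverse L1 h) i j"

definition IP_preserving_family ::
  "('a, 'k1::finite) kgraph \<Rightarrow> ('b, 'k2::finite) kgraph \<Rightarrow> (('a, 'k1) path \<Rightarrow> ('b, 'k2) path) \<Rightarrow>
   (nat ^ 'k1 \<Rightarrow> ('a, 'k1) path \<Rightarrow> nat ^ 'k2) \<Rightarrow>
   (nat ^ 'k1 \<Rightarrow> ('a, 'k1) path \<Rightarrow> nat ^ 'k2) \<Rightarrow>
   (nat ^ 'k2 \<Rightarrow> ('b, 'k2) path \<Rightarrow> nat ^ 'k1) \<Rightarrow>
   (nat ^ 'k2 \<Rightarrow> ('b, 'k2) path \<Rightarrow> nat ^ 'k1) \<Rightarrow> bool" where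
  "IP_preserving_family L1 L2 h f g i j \<longleftrightarrow>
     half_IP_preserving L1 L2 h f g \<and>
     half_IP_preserving L2 L1 (boundary_inverse L1 h) i j"

definition graded_family ::
  "('g, 'c) monoid_scheme \<Rightarrow>
   ('a, 'k1::finite) kgraph \<Rightarrow> ('b, 'k2::finite) kgraph \<Rightarrow> ('a \<Rightarrow> 'g) \<Rightarrow> ('b \<Rightarrow> 'g) \<Rightarrow>
   (('a, 'k1) path \<Rightarrow> ('b, 'k2) path) \<Rightarrow>
   (nat ^ 'k1 \<Rightarrow> ('a, 'k1) path \<Rightarrow> nat ^ 'k2) \<Rightarrow>
   (nat ^ 'k1 \<Rightarrow> ('a, 'k1) path \<Rightarrow> nat ^ 'k2) \<Rightarrow>
   (nat ^ 'k2 \<Rightarrow> ('b, 'k2) path \<Rightarrow> nat ^ 'k1) \<Rightarrow>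
   (nat ^ 'k2 \<Rightarrow> ('b, 'k2) path \<Rightarrow> nat ^ 'k1) \<Rightarrow> bool" where
  "graded_family \<Gamma> L1 L2 \<eta>1 \<eta>2 h f g i j \<longleftrightarrow>
     half_graded \<Gamma> L1 L2 \<eta>1 \<eta>2 h f g \<and>
     half_graded \<Gamma> L2 L1 \<eta>2 \<eta>1 (boundary_inverse L1 h) i j"

text \<open>
  One and the same family of cocycles witnesses that \<open>h\<close> is a continuous orbit equivalence,
  that it is graded and that it is period-preserving. Independent witnesses would be too weak:
  for two single loops graded by \<open>\<int>/5\<close> with generators sent to \<open>1\<close> and \<open>2\<close>, both
  properties hold separately, but no isomorphism of the groupoids \<open>\<int>\<close> respects the gradings.
\<close>

definition graded_period_preserving_coe ::
  "('g, 'c) monoid_scheme \<Rightarrow>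
   ('a, 'k1::finite) kgraph \<Rightarrow> ('b, 'k2::finite) kgraph \<Rightarrow> ('a \<Rightarrow> 'g) \<Rightarrow> ('b \<Rightarrow> 'g) \<Rightarrow>
   (('a, 'k1) path \<Rightarrow> ('b, 'k2) path) \<Rightarrow> bool" where
  "graded_period_preserving_coe \<Gamma> L1 L2 \<eta>1 \<eta>2 h \<longleftrightarrow>
     orbit_equivalence L1 L2 h \<and>
     (\<exists>f g i j. cocycle_family L1 L2 h f g i j \<and> graded_family \<Gamma> L1 L2 \<eta>1 \<eta>2 h f g i j \<and>
        period_preserving_family L1 L2 h f g i j)"

end

theory Submission
  imports Defs "HOL-Analysis.Cartesian_Space"
begin

text \<open>
  An arrow of the groupoid is a triple \<open>(x, p - q, y)\<close> with \<open>\<sigma>\<^sup>p(x) = \<sigma>\<^sup>q(y)\<close>; the pair \<open>(p, q)\<close> is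
  called a witness and \<open>p - q\<close> the lag of the arrow. Every arrow is a quotient of two arrows of the
  form \<open>(x, m, \<sigma>\<^sup>m(x))\<close>. So a homomorphism \<open>\<phi>\<close> that restricts to \<open>h\<close> on units is determined by the
  lags \<open>\<kappa> m x\<close> of the images of these special arrows, and \<open>\<kappa>\<close> satisfies
  \<open>\<kappa> (m + n) x = \<kappa> m x + \<kappa> n (\<sigma>\<^sup>m(x))\<close>. A family of cocycles is such a \<open>\<kappa> = g - f\<close> together with a
  continuous choice of witnesses \<open>(g, f)\<close>, and the gradings of arrows can be read off from any witness.

  From an isomorphism to a family. What has to be chosen is a continuous witness for the arrows of
  the second groupoid. This is \<open>continuous_lag\<close>: the groupoid is covered by countably many bisections,
  and these are clopen because cylinders of boundary paths are. Finite alignment enters earlier: it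
  ensures that prepending an arrow to a boundary path is possible and continuous, and that the range
  and source maps are continuous. As \<open>\<phi>\<close> and its inverse are bijective on isotropy, both the groups
  \<open>Per\<close> and the groups \<open>IP\<close> correspond to each other.

  From a family to an isomorphism. The formula \<open>(x, m - n, y) \<mapsto> (h x, \<kappa> m x - \<kappa> n y, h y)\<close> defines a
  continuous homomorphism \<open>\<Phi>\<close>, and likewise a homomorphism \<open>\<Psi>\<close> in the other direction. They need not be inverse to
  each other; what has to be shown is that \<open>\<Phi>\<close> is bijective. Local constancy of the cocycles gives two
  facts: the kernel of \<open>\<Phi>\<close> consists of isotropy arrows in \<open>IP\<close> (\<open>lag_kernel_subset_IP\<close>), and the composite
  \<open>\<Phi> \<circ> \<Psi>\<close> differs from the identity only by elements of \<open>IP\<close> (\<open>round_trip_IP\<close>). If \<open>\<Phi>\<close> and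
  \<open>\<Psi>\<close> are both surjective on \<open>IP\<close>, or both surjective on \<open>Per\<close>, then they are injective there, because a
  surjective endomorphism of a subgroup of \<open>\<int>\<^sup>k\<close> is injective
  (\<open>surjective_endomorphism_injective\<close>). Together with the two facts this makes \<open>\<Phi>\<close> bijective
  (\<open>\<Phi>_bijective\<close>), uniformly for period-preserving and for \<open>IP\<close>-preserving families. Finally \<open>\<Phi>\<close> is
  open because it covers a homeomorphism and the range maps are local homeomorphisms.
\<close>

abbreviation (input) open_paths :: "('a, 'k::finite) kgraph \<Rightarrow> ('a, 'k) path set \<Rightarrow> bool" where
  "open_paths L \<equiv> openin (boundary_topology L)"

abbreviation (input) open_arrows :: "('a, 'k::finite) kgraph \<Rightarrow> ('a, 'k) bp_triple set \<Rightarrow> bool" where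
  "open_arrows L \<equiv> openin (bp_groupoid_topology L)"

abbreviation (input) arrows :: "('a, 'k::finite) kgraph \<Rightarrow> ('a, 'k) bp_triple set" where
  "arrows L \<equiv> Arr (bp_groupoid L)"


section \<open>Degree vectors\<close>

lemma vec_plus_minus: "m + (n - m) = n" if "m \<le> n" for m n :: "nat ^ 'k::finite"
  using that by (simp add: vec_eq_iff less_eq_vec_def)

lemma vec_zero_le [simp]: "0 \<le> m" for m :: "nat ^ 'k::finite"
  by (simp add: less_eq_vec_def)

lemma vec_le_add [simp]: "m \<le> m + n" "n \<le> m + n" for m n :: "nat ^ 'k::finite"
  by (simp_all add: less_eq_vec_def)

lemma vec_max_le [simp]: "m \<le> vec_max m n" "n \<le> vec_max m n" for m n :: "nat ^ 'k::finite"
  by (simp_all add: less_eq_vec_def vec_max_def)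

lemma int_vec_add [simp]: "int_vec (m + n) = int_vec m + int_vec n"
  for m n :: "nat ^ 'k::finite"
  by (simp add: int_vec_def vec_eq_iff)

lemma int_vec_zero [simp]: "int_vec 0 = (0 :: int ^ 'k::finite)"
  by (simp add: int_vec_def vec_eq_iff)

lemma int_vec_inject [simp]: "int_vec m = int_vec n \<longleftrightarrow> m = n" for m n :: "nat ^ 'k::finite"
  by (simp add: int_vec_def vec_eq_iff)

lemma equal_lags_raise:
  fixes p p' a a' :: "nat ^ 'k::finite"
  assumes "p + a = p' + a'" "int_vec p - int_vec q = int_vec p' - int_vec q'"
  shows "q + a = q' + a'"
proof -
  have "int_vec p + int_vec a = int_vec p' + int_vec a'"
    using assms(1) by (metis int_vec_add)
  then have "int_vec p + int_vec a - (int_vec p - int_vec q) =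
      int_vec p' + int_vec a' - (int_vec p' - int_vec q')"
    using assms(2) by metis
  then have "int_vec (q + a) = int_vec (q' + a')" by (simp add: add.commute)
  then show ?thesis by (rule int_vec_inject[THEN iffD1])
qed

lemma vec_add_diff_left [simp]: "(m + n) - m = n" "(m + n) - n = m" for m n :: "nat ^ 'k::finite"
  by (simp_all add: vec_eq_iff)

lemma enat_vec_mono: "enat_vec m \<le> D" if "m \<le> n" "enat_vec n \<le> D"
  for m n :: "nat ^ 'k::finite"
  using that unfolding enat_vec_def less_eq_vec_def
  by (metis (no_types, lifting) enat_ord_simps(1) order_trans vec_lambda_beta)

lemma enat_vec_zero [simp]: "enat_vec 0 \<le> (D :: enat ^ 'k::finite)"
  by (simp add: enat_vec_def less_eq_vec_def flip: zero_enat_def)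

lemma enat_vec_le_diff:
  "enat_vec n \<le> D - enat_vec m \<longleftrightarrow> enat_vec (n + m) \<le> D" if "enat_vec m \<le> D"
  for m n :: "nat ^ 'k::finite"
proof -
  have "enat b \<le> d - enat a \<longleftrightarrow> enat (b + a) \<le> d" if "enat a \<le> d" for a b d
    using that by (cases d) auto
  with that show ?thesis
    by (simp add: enat_vec_def less_eq_vec_def)
qed

lemma enat_vec_le_add:
  "enat_vec (n + m) \<le> D + enat_vec m \<longleftrightarrow> enat_vec n \<le> D" for m n :: "nat ^ 'k::finite"
proof -
  have "enat (b + a) \<le> d + enat a \<longleftrightarrow> enat b \<le> d" for a b d
    by (cases d) auto
  then show ?thesis
    by (simp add: enat_vec_def less_eq_vec_def)
qed

lemma enat_vec_le_add_right [simp]: "enat_vec m \<le> D + enat_vec m" for m :: "nat ^ 'k::finite"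
  using enat_vec_le_add[of 0 m D] by simp

lemma enat_vec_add_diff [simp]: "D + enat_vec m - enat_vec m = D" for m :: "nat ^ 'k::finite"
proof -
  have "d + enat a - enat a = d" for a d
    by (cases d) auto
  then show ?thesis
    by (simp add: enat_vec_def vec_eq_iff)
qed

lemma enat_vec_diff_diff: "D - enat_vec m - enat_vec n = D - enat_vec (m + n)"
  for m n :: "nat ^ 'k::finite"
proof -
  have "d - enat a - enat b = d - enat (a + b)" for a b d
    by (cases d) auto
  then show ?thesis
    by (simp add: enat_vec_def vec_eq_iff)
qed

lemma enat_vec_diff_add: "D - enat_vec m + enat_vec m = D" if "enat_vec m \<le> D"
  for m :: "nat ^ 'k::finite"
proof -
  have "d - enat a + enat a = d" if "enat a \<le> d" for a d
    using that by (cases d) auto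
  with that show ?thesis
    by (simp add: enat_vec_def vec_eq_iff less_eq_vec_def)
qed

lemma enat_vec_diff_zero [simp]: "D - enat_vec 0 = (D :: enat ^ 'k::finite)"
  by (simp add: enat_vec_def vec_eq_iff flip: zero_enat_def)

lemma enat_vec_max: "enat_vec (vec_max m n) \<le> D \<longleftrightarrow> enat_vec m \<le> D \<and> enat_vec n \<le> D"
  for m n :: "nat ^ 'k::finite"
proof -
  have "enat (max a b) \<le> d \<longleftrightarrow> enat a \<le> d \<and> enat b \<le> d" for a b d
    by (cases d) auto
  then show ?thesis
    by (auto simp: enat_vec_def less_eq_vec_def vec_max_def)
qed


section \<open>Factorisation in higher-rank graphs\<close>

locale fa_kgraph =
  fixes L :: "('a, 'k::finite) kgraph"
  assumes kgraph: "is_kgraph L" and aligned: "finitely_aligned L"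
begin

abbreviation comp_L (infixl "\<cdot>" 70) where "a \<cdot> b \<equiv> Comp L a b"

definition composable :: "'a \<Rightarrow> 'a \<Rightarrow> bool" where
  "composable a b \<longleftrightarrow> a \<in> Arr L \<and> b \<in> Arr L \<and> Src L a = Rng L b"

lemma composableD: "composable a b \<Longrightarrow> a \<in> Arr L" "composable a b \<Longrightarrow> b \<in> Arr L"
  "composable a b \<Longrightarrow> Src L a = Rng L b"
  by (simp_all add: composable_def)

lemma category: "small_category L"
  using kgraph by (simp add: is_kgraph_def)

lemma rng_arr [simp]: "a \<in> Arr L \<Longrightarrow> Rng L a \<in> Arr L"
  and src_arr [simp]: "a \<in> Arr L \<Longrightarrow> Src L a \<in> Arr L"
  and rng_rng [simp]: "a \<in> Arr L \<Longrightarrow> Rng L (Rng L a) = Rng L a"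
  and src_rng [simp]: "a \<in> Arr L \<Longrightarrow> Src L (Rng L a) = Rng L a"
  and rng_src [simp]: "a \<in> Arr L \<Longrightarrow> Rng L (Src L a) = Src L a"
  and src_src [simp]: "a \<in> Arr L \<Longrightarrow> Src L (Src L a) = Src L a"
  and comp_rng [simp]: "a \<in> Arr L \<Longrightarrow> Rng L a \<cdot> a = a"
  and comp_src [simp]: "a \<in> Arr L \<Longrightarrow> a \<cdot> Src L a = a"
  using category by (simp_all add: small_category_def)

lemma comp_arr: "composable a b \<Longrightarrow> a \<cdot> b \<in> Arr L"
  and rng_comp: "composable a b \<Longrightarrow> Rng L (a \<cdot> b) = Rng L a"
  and src_comp: "composable a b \<Longrightarrow> Src L (a \<cdot> b) = Src L b"
  using category by (simp_all add: small_category_def composable_def)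

lemma comp_assoc: "composable a b \<Longrightarrow> composable b c \<Longrightarrow> a \<cdot> b \<cdot> c = a \<cdot> (b \<cdot> c)"
  using category by (simp add: small_category_def composable_def)

lemma composable_comp:
  "composable a b \<Longrightarrow> composable (a \<cdot> b) c \<longleftrightarrow> composable b c"
  "composable b c \<Longrightarrow> composable a (b \<cdot> c) \<longleftrightarrow> composable a b"
  by (auto simp: composable_def comp_arr src_comp rng_comp)

lemma deg_rng [simp]: "a \<in> Arr L \<Longrightarrow> Deg L (Rng L a) = 0"
  and deg_src [simp]: "a \<in> Arr L \<Longrightarrow> Deg L (Src L a) = 0"
  using kgraph by (simp_all add: is_kgraph_def)

lemma deg_comp: "composable a b \<Longrightarrow> Deg L (a \<cdot> b) = Deg L a + Deg L b"
  using kgraph by (simp add: is_kgraph_def composable_def)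

lemma countable_arr: "countable (Arr L)"
  using kgraph by (simp add: is_kgraph_def)

lemma factorisation:
  "l \<in> Arr L \<Longrightarrow> Deg L l = m + n \<Longrightarrow> \<exists>!p. is_factorisation L l m n p"
  using kgraph by (simp add: is_kgraph_def)

lemma factor_exists:
  assumes "l \<in> Arr L" "m \<le> Deg L l"
  obtains a b where "composable a b" "l = a \<cdot> b" "Deg L a = m" "Deg L b = Deg L l - m"
proof -
  have "\<exists>!p. is_factorisation L l m (Deg L l - m) p"
    using assms by (intro factorisation) (simp_all add: vec_plus_minus)
  then show ?thesis
    using that by (auto simp: is_factorisation_def composable_def)
qed

lemma factor_unique:
  assumes "composable a b" "composable a' b'" "a \<cdot> b = a' \<cdot> b'" "Deg L a = Deg L a'"
  shows "a = a'" "b = b'"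
proof -
  have "Deg L b = Deg L b'"
    using assms by (metis add_left_cancel deg_comp)
  then have "is_factorisation L (a \<cdot> b) (Deg L a) (Deg L b) (a, b)"
    "is_factorisation L (a \<cdot> b) (Deg L a) (Deg L b) (a', b')"
    using assms by (simp_all add: is_factorisation_def composable_def)
  then have "(a, b) = (a', b')"
    using factorisation[OF comp_arr[OF assms(1)] deg_comp[OF assms(1)]] by blast
  then show "a = a'" "b = b'" by simp_all
qed

lemma initial_seg_comp: "initial_seg L (a \<cdot> b) (Deg L a) = a" if "composable a b"
proof -
  have "is_factorisation L (a \<cdot> b) (Deg L a) (Deg L (a \<cdot> b) - Deg L a) (a, b)"
    using that by (simp add: is_factorisation_def composable_def deg_comp)
  then have "(THE p. is_factorisation L (a \<cdot> b) (Deg L a) (Deg L (a \<cdot> b) - Deg L a) p) = (a, b)"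
    using that by (intro the1_equality factorisation) (auto simp: comp_arr deg_comp)
  then show ?thesis
    by (simp add: initial_seg_def)
qed

lemma Lambda_min_composable:
  assumes "(a, b) \<in> Lambda_min L l u" "l \<in> Arr L" "u \<in> Arr L"
  shows "composable l a" "composable u b" "l \<cdot> a = u \<cdot> b"
    "Deg L (l \<cdot> a) = vec_max (Deg L l) (Deg L u)"
  using assms by (auto simp: Lambda_min_def composable_def MCE_def)

text \<open>
  Cutting a common extension at the maximum of the two degrees yields a minimal one, by unique
  factorisation.
\<close>

lemma common_extension_through_min:
  assumes "composable l a" "composable u b" "l \<cdot> a = u \<cdot> b"
  obtains \<alpha> \<beta> \<gamma> where "(\<alpha>, \<beta>) \<in> Lambda_min L l u" "composable \<alpha> \<gamma>" "a = \<alpha> \<cdot> \<gamma>"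
    "composable \<beta> \<gamma>" "b = \<beta> \<cdot> \<gamma>"
proof -
  let ?N = "vec_max (Deg L l) (Deg L u)"
  have "Deg L l \<le> Deg L (l \<cdot> a)" "Deg L u \<le> Deg L (l \<cdot> a)"
    using assms by (simp_all add: deg_comp, metis deg_comp vec_le_add(1))
  then have "?N \<le> Deg L (l \<cdot> a)"
    by (simp add: less_eq_vec_def vec_max_def)
  then obtain t \<gamma> where t: "composable t \<gamma>" "l \<cdot> a = t \<cdot> \<gamma>" "Deg L t = ?N"
    using comp_arr[OF assms(1)] factor_exists by metis
  have tA: "t \<in> Arr L" using t by (simp add: composable_def)
  obtain l' \<alpha> where l: "composable l' \<alpha>" "t = l' \<cdot> \<alpha>" "Deg L l' = Deg L l"
    using factor_exists[OF tA, of "Deg L l"] t(3) vec_max_le(1) by metis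
  obtain u' \<beta> where u: "composable u' \<beta>" "t = u' \<cdot> \<beta>" "Deg L u' = Deg L u"
    using factor_exists[OF tA, of "Deg L u"] t(3) vec_max_le(2) by metis
  have \<gamma>: "composable \<alpha> \<gamma>" "composable \<beta> \<gamma>"
    using t l u composable_comp by metis+
  have "l \<cdot> a = l' \<cdot> (\<alpha> \<cdot> \<gamma>)" "u \<cdot> b = u' \<cdot> (\<beta> \<cdot> \<gamma>)"
    using assms t l u \<gamma> by (metis comp_assoc)+
  moreover have "composable l' (\<alpha> \<cdot> \<gamma>)" "composable u' (\<beta> \<cdot> \<gamma>)"
    using l u \<gamma> composable_comp by metis+
  ultimately have e: "l' = l" "a = \<alpha> \<cdot> \<gamma>" "u' = u" "b = \<beta> \<cdot> \<gamma>"
    using factor_unique[OF _ assms(1), of l' "\<alpha> \<cdot> \<gamma>"] factor_unique[OF _ assms(2), of u' "\<beta> \<cdot> \<gamma>"]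
      l(3) u(3) by metis+
  have "initial_seg L t (Deg L l) = l" "initial_seg L t (Deg L u) = u"
    using initial_seg_comp[OF l(1)] initial_seg_comp[OF u(1)] l u e by simp_all
  then have "t \<in> MCE L l u"
    using t tA by (simp add: MCE_def)
  then have "(\<alpha>, \<beta>) \<in> Lambda_min L l u"
    using l u e by (auto simp: Lambda_min_def composable_def)
  with that e \<gamma> show ?thesis by blast
qed


text \<open>
  \<open>is_seg a p q b\<close> says that \<open>b\<close> is the segment \<open>a(p,q)\<close>. As a relation it avoids carrying
  the side conditions \<open>p \<le> q \<le> Deg L a\<close> through every manipulation.
\<close>

definition is_seg :: "'a \<Rightarrow> nat ^ 'k \<Rightarrow> nat ^ 'k \<Rightarrow> 'a \<Rightarrow> bool" where
  "is_seg a p q b \<longleftrightarrow> p \<le> q \<and> (\<exists>u v. composable u b \<and> composable b v \<and>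
     Deg L u = p \<and> Deg L b = q - p \<and> a = u \<cdot> (b \<cdot> v))"

lemma is_seg_exists:
  assumes "a \<in> Arr L" "p \<le> q" "q \<le> Deg L a"
  obtains b where "is_seg a p q b"
proof -
  have "p \<le> Deg L a" using assms by (rule_tac order_trans)
  then obtain u w where u: "composable u w" "a = u \<cdot> w" "Deg L u = p" "Deg L w = Deg L a - p"
    using factor_exists assms by metis
  have "q - p \<le> Deg L w"
    using u assms by (simp add: less_eq_vec_def diff_le_mono)
  then obtain b v where "composable b v" "w = b \<cdot> v" "Deg L b = q - p"
    using factor_exists composableD(2)[OF u(1)] by metis
  with u assms have "is_seg a p q b"
    unfolding is_seg_def using composable_comp(2) by blast
  then show ?thesis by (rule that)
qed

lemma is_seg_unique: "b = b'" if "is_seg a p q b" "is_seg a p q b'"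
proof -
  obtain u v u' v' where *: "composable u b" "composable b v" "Deg L u = p" "Deg L b = q - p"
    "a = u \<cdot> (b \<cdot> v)" "composable u' b'" "composable b' v'" "Deg L u' = p" "Deg L b' = q - p"
    "a = u' \<cdot> (b' \<cdot> v')"
    using \<open>is_seg a p q b\<close> \<open>is_seg a p q b'\<close> unfolding is_seg_def by blast
  have "b \<cdot> v = b' \<cdot> v'"
    by (rule factor_unique(2)[of u _ u']) (use * composable_comp in auto)
  then show "b = b'"
    by (rule factor_unique(1)[rotated 2]) (use * in auto)
qed

lemma is_seg_deg: "is_seg a p q b \<Longrightarrow> Deg L b = q - p"
  and is_seg_arr: "is_seg a p q b \<Longrightarrow> b \<in> Arr L"
  by (auto simp: is_seg_def composable_def)

lemma is_seg_extend: "is_seg (a \<cdot> c) p q b" if b: "is_seg a p q b" and c: "composable a c"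
proof -
  obtain u v where *: "p \<le> q" "composable u b" "composable b v" "Deg L u = p" "Deg L b = q - p"
    "a = u \<cdot> (b \<cdot> v)"
    using b by (auto simp: is_seg_def)
  then have uv: "composable u (b \<cdot> v)" using composable_comp by blast
  then have "composable (b \<cdot> v) c" using c * composable_comp by metis
  then have v: "composable v c" using * composable_comp by metis
  have "a \<cdot> c = u \<cdot> (b \<cdot> (v \<cdot> c))"
    using * uv \<open>composable (b \<cdot> v) c\<close> v by (simp add: comp_assoc)
  then show ?thesis
    unfolding is_seg_def using * v composable_comp(2)[OF v, of b] by blast
qed

lemma is_seg_shift:
  "is_seg (a \<cdot> b) (Deg L a + p) (Deg L a + q) c" if c: "is_seg b p q c" and a: "composable a b"
proof -
  obtain u v where *: "p \<le> q" "composable u c" "composable c v" "Deg L u = p" "Deg L c = q - p"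
    "b = u \<cdot> (c \<cdot> v)"
    using c by (auto simp: is_seg_def)
  then have uv: "composable u (c \<cdot> v)" using composable_comp by blast
  then have au: "composable a u" using a * composable_comp by metis
  have "a \<cdot> b = a \<cdot> u \<cdot> (c \<cdot> v)"
    using * au uv by (simp add: comp_assoc)
  moreover have "composable (a \<cdot> u) c" "Deg L (a \<cdot> u) = Deg L a + p"
    using * au composable_comp by (auto simp: deg_comp)
  moreover have "Deg L c = (Deg L a + q) - (Deg L a + p)"
    using * by (simp add: vec_eq_iff)
  moreover have "Deg L a + p \<le> Deg L a + q"
    using * by (simp add: less_eq_vec_def)
  ultimately show ?thesis
    unfolding is_seg_def using *(3) by blast
qed

lemma is_seg_self: "is_seg a 0 (Deg L a) a" if "a \<in> Arr L"
  unfolding is_seg_def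
  by (rule conjI, simp, rule exI[of _ "Rng L a"], rule exI[of _ "Src L a"])
     (use that in \<open>auto simp: composable_def vec_eq_iff\<close>)

lemma is_seg_ends: "is_seg a p p (Rng L b)" "is_seg a q q (Src L b)" if b: "is_seg a p q b"
proof -
  obtain u v where *: "p \<le> q" "composable u b" "composable b v" "Deg L u = p" "Deg L b = q - p"
    "a = u \<cdot> (b \<cdot> v)"
    using b unfolding is_seg_def by blast
  then have bv: "composable u (b \<cdot> v)" using composable_comp by blast
  then have "composable u (Rng L b)" "composable (Rng L b) (b \<cdot> v)" "a = u \<cdot> (Rng L b \<cdot> (b \<cdot> v))"
    using * comp_rng[OF comp_arr[OF *(3)]]
    by (auto simp: composable_def rng_comp comp_arr[unfolded composable_def])
  then show "is_seg a p p (Rng L b)"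
    unfolding is_seg_def using *
    by (intro conjI exI[of _ u] exI[of _ "b \<cdot> v"]) (auto simp: composable_def vec_eq_iff)
  have "composable (u \<cdot> b) (Src L b)" "composable (Src L b) v" "Deg L (u \<cdot> b) = q"
    using * by (auto simp: composable_def src_comp comp_arr[unfolded composable_def]
      deg_comp vec_plus_minus src_comp[unfolded composable_def])
  moreover have "a = u \<cdot> b \<cdot> (Src L b \<cdot> v)"
    using * by (metis comp_assoc comp_rng composable_def)
  ultimately show "is_seg a q q (Src L b)"
    unfolding is_seg_def using *
    by (intro conjI exI[of _ "u \<cdot> b"] exI[of _ v]) (auto simp: composable_def vec_eq_iff)
qed

lemma is_seg_comp:
  assumes b: "is_seg a p q b" and c: "is_seg a q t c"
  shows "composable b c" "is_seg a p t (b \<cdot> c)"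
proof -
  obtain u v where *: "p \<le> q" "composable u b" "composable b v" "Deg L u = p" "Deg L b = q - p"
    "a = u \<cdot> (b \<cdot> v)"
    using b unfolding is_seg_def by blast
  obtain u' v' where ee: "q \<le> t" "composable u' c" "composable c v'" "Deg L u' = q"
    "Deg L c = t - q" "a = u' \<cdot> (c \<cdot> v')"
    using c unfolding is_seg_def by blast
  have d: "Deg L (u \<cdot> b) = q"
    using * by (simp add: deg_comp vec_plus_minus)
  have "u \<cdot> b \<cdot> v = u' \<cdot> (c \<cdot> v')"
    using *(6) ee(6) comp_assoc[OF *(2,3)] by metis
  then have e: "u \<cdot> b = u'" "v = c \<cdot> v'"
    using factor_unique[of "u \<cdot> b" v u' "c \<cdot> v'"] d * ee(4) composable_comp(1)[OF *(2)]
      composable_comp(2)[OF ee(3)] ee(2) by simp_all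
  then show bc: "composable b c"
    using *(3) e(2) composable_comp(2)[OF ee(3)] by simp
  have "a = u \<cdot> (b \<cdot> c \<cdot> v')"
    using *(6) e(2) comp_assoc[OF bc ee(3)] by simp
  moreover have "Deg L (b \<cdot> c) = t - p"
    using *(1,5) ee(1,5) bc by (auto simp: deg_comp vec_eq_iff less_eq_vec_def)
  moreover have "composable u (b \<cdot> c)" "composable (b \<cdot> c) v'"
    using *(2) ee(3) bc by (simp_all add: composable_comp)
  ultimately show "is_seg a p t (b \<cdot> c)"
    unfolding is_seg_def using *(1,4) order_trans[OF *(1) ee(1)] by blast
qed

end

section \<open>Boundary paths, their shifts and their extensions\<close>

lemma Arr_Omega [simp]: "Arr (Omega D) = {(p, q). p \<le> q \<and> enat_vec q \<le> D}"
  by (simp add: Omega_def)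

lemma path_deg_shift [simp]: "path_deg (shift m x) = path_deg x - enat_vec m"
  by (simp add: shift_def)

lemma path_map_shift:
  "path_map (shift m x) (p, q) = path_map x (p + m, q + m)"
  if "p \<le> q" "enat_vec (q + m) \<le> path_deg x" for x :: "('a, 'k::finite) path"
proof -
  have "enat_vec m \<le> path_deg x"
    using that(2) by (rule enat_vec_mono[rotated]) simp
  then show ?thesis
    using that by (simp add: shift_def enat_vec_le_diff)
qed

context fa_kgraph
begin

definition functor_path :: "('a, 'k) path \<Rightarrow> bool" where
  "functor_path x \<longleftrightarrow>
     (\<forall>p q. p \<le> q \<longrightarrow> enat_vec q \<le> path_deg x \<longrightarrow>
        path_map x (p, q) \<in> Arr L \<and> Deg L (path_map x (p, q)) = q - p \<and>
        Rng L (path_map x (p, q)) = path_map x (p, p) \<and>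
        Src L (path_map x (p, q)) = path_map x (q, q)) \<and>
     (\<forall>p q t. p \<le> q \<longrightarrow> q \<le> t \<longrightarrow> enat_vec t \<le> path_deg x \<longrightarrow>
        path_map x (p, q) \<cdot> path_map x (q, t) = path_map x (p, t))"

definition meets_exhaustive :: "('a, 'k) path \<Rightarrow> bool" where
  "meets_exhaustive x \<longleftrightarrow>
     (\<forall>n E. enat_vec n \<le> path_deg x \<longrightarrow> finite E \<longrightarrow> E \<subseteq> arrows_into L (path_map x (n, n)) \<longrightarrow>
        exhaustive L (path_map x (n, n)) E \<longrightarrow>
        (\<exists>l\<in>E. enat_vec (n + Deg L l) \<le> path_deg x \<and> path_map x (n, n + Deg L l) = l))"

lemma boundary_path_iff:
  "x \<in> boundary_paths L \<longleftrightarrow>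
     path_map x \<in> extensional (Arr (Omega (path_deg x))) \<and> functor_path x \<and> meets_exhaustive x"
proof -
  have "functor_path x \<longleftrightarrow> cat_functor (Omega (path_deg x)) L (path_map x) \<and>
    (\<forall>a\<in>Arr (Omega (path_deg x)). Deg L (path_map x a) = Deg (Omega (path_deg x)) a)"
  proof
    assume x: "functor_path x"
    show "cat_functor (Omega (path_deg x)) L (path_map x) \<and>
      (\<forall>a\<in>Arr (Omega (path_deg x)). Deg L (path_map x a) = Deg (Omega (path_deg x)) a)"
      using x unfolding functor_path_def cat_functor_def by (auto simp: Omega_def)
  next
    assume x: "cat_functor (Omega (path_deg x)) L (path_map x) \<and>
      (\<forall>a\<in>Arr (Omega (path_deg x)). Deg L (path_map x a) = Deg (Omega (path_deg x)) a)"
    have arr: "path_map x (p, q) \<in> Arr L" "Deg L (path_map x (p, q)) = q - p"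
        "Rng L (path_map x (p, q)) = path_map x (p, p)"
        "Src L (path_map x (p, q)) = path_map x (q, q)"
      if "p \<le> q" "enat_vec q \<le> path_deg x" for p q
    proof -
      have a: "(p, q) \<in> Arr (Omega (path_deg x))"
        using that by simp
      have \<Omega>: "Rng (Omega (path_deg x)) (p, q) = (p, p)" "Src (Omega (path_deg x)) (p, q) = (q, q)"
        "Deg (Omega (path_deg x)) (p, q) = q - p"
        by (simp_all add: Omega_def)
      show "path_map x (p, q) \<in> Arr L" "Deg L (path_map x (p, q)) = q - p"
        "Rng L (path_map x (p, q)) = path_map x (p, p)"
        "Src L (path_map x (p, q)) = path_map x (q, q)"
        using x a \<Omega> unfolding cat_functor_def by metis+
    qed
    have comp: "path_map x (p, t) = path_map x (p, q) \<cdot> path_map x (q, t)"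
      if "p \<le> q" "enat_vec q \<le> path_deg x" "q \<le> t" "enat_vec t \<le> path_deg x" for p q t
    proof -
      have "(p, q) \<in> Arr (Omega (path_deg x))" "(q, t) \<in> Arr (Omega (path_deg x))"
        using that by simp_all
      moreover have "Src (Omega (path_deg x)) (p, q) = Rng (Omega (path_deg x)) (q, t)"
        "Comp (Omega (path_deg x)) (p, q) (q, t) = (p, t)"
        by (simp_all add: Omega_def)
      ultimately show ?thesis
        using x unfolding cat_functor_def by metis
    qed
    show "functor_path x"
      unfolding functor_path_def
      by (intro conjI allI impI) (blast intro: arr comp[symmetric] enat_vec_mono)+
  qed
  then show ?thesis
    by (auto simp: boundary_paths_def meets_exhaustive_def)
qed

lemma functor_pathI: "x \<in> boundary_paths L \<Longrightarrow> functor_path x"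
  by (simp add: boundary_path_iff)

lemma path_arr:
  assumes "functor_path x" "p \<le> q" "enat_vec q \<le> path_deg x"
  shows "path_map x (p, q) \<in> Arr L" "Deg L (path_map x (p, q)) = q - p"
    "Rng L (path_map x (p, q)) = path_map x (p, p)"
    "Src L (path_map x (p, q)) = path_map x (q, q)"
  using assms unfolding functor_path_def by blast+

lemma path_comp:
  assumes "functor_path x" "p \<le> q" "q \<le> t" "enat_vec t \<le> path_deg x"
  shows "composable (path_map x (p, q)) (path_map x (q, t))"
    "path_map x (p, q) \<cdot> path_map x (q, t) = path_map x (p, t)"
proof -
  have "enat_vec q \<le> path_deg x" using assms enat_vec_mono by blast
  then show "composable (path_map x (p, q)) (path_map x (q, t))"
    using assms by (simp add: composable_def path_arr)
  show "path_map x (p, q) \<cdot> path_map x (q, t) = path_map x (p, t)"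
    using assms unfolding functor_path_def by blast
qed

lemma path_factor:
  assumes x: "functor_path x" and p: "p \<le> t" "enat_vec t \<le> path_deg x"
    and ab: "path_map x (p, t) = a \<cdot> b" "composable a b"
  shows "p + Deg L a \<le> t" "path_map x (p, p + Deg L a) = a" "path_map x (p + Deg L a, t) = b"
proof -
  have "t - p = Deg L a + Deg L b"
    using path_arr(2)[OF x p] ab by (simp add: deg_comp)
  then show le: "p + Deg L a \<le> t"
    using p by (simp add: vec_eq_iff less_eq_vec_def) (metis add_le_imp_le_diff le_add1 le_diff_conv2 add.commute)
  have c: "composable (path_map x (p, p + Deg L a)) (path_map x (p + Deg L a, t))"
    and e: "path_map x (p, p + Deg L a) \<cdot> path_map x (p + Deg L a, t) = path_map x (p, t)"
    using path_comp[OF x _ le p(2)] by simp_all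
  have "Deg L (path_map x (p, p + Deg L a)) = Deg L a"
    using path_arr(2)[OF x _ enat_vec_mono[OF le p(2)], of p] by simp
  then show "path_map x (p, p + Deg L a) = a" "path_map x (p + Deg L a, t) = b"
    using factor_unique[OF c ab(2)] e ab(1) by simp_all
qed

lemma path_eqI:
  assumes "x \<in> boundary_paths L" "y \<in> boundary_paths L" "path_deg x = path_deg y"
    and "\<And>p q. p \<le> q \<Longrightarrow> enat_vec q \<le> path_deg x \<Longrightarrow> path_map x (p, q) = path_map y (p, q)"
  shows "x = y"
proof -
  have "path_map x = path_map y"
    using assms by (intro extensionalityI[of _ "Arr (Omega (path_deg x))"])
      (auto simp: boundary_path_iff)
  with assms show ?thesis by simp
qed

lemma boundary_paths_ge_iff:
  "x \<in> boundary_paths_ge L m \<longleftrightarrow> x \<in> boundary_paths L \<and> enat_vec m \<le> path_deg x"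
  by (simp add: boundary_paths_ge_def)

lemma shift_boundary:
  assumes "x \<in> boundary_paths_ge L m"
  shows "shift m x \<in> boundary_paths L"
proof -
  have x: "x \<in> boundary_paths L" "enat_vec m \<le> path_deg x"
    using assms by (simp_all add: boundary_paths_ge_iff)
  have fx: "functor_path x" and bx: "meets_exhaustive x"
    using x by (simp_all add: boundary_path_iff)
  have le: "enat_vec n \<le> path_deg (shift m x) \<longleftrightarrow> enat_vec (n + m) \<le> path_deg x" for n
    using x by (simp add: enat_vec_le_diff)
  have mono: "p + m \<le> q + m" "(q + m) - (p + m) = q - p" if "p \<le> q" for p q :: "nat ^ 'k"
    using that by (simp_all add: less_eq_vec_def vec_eq_iff)
  have map: "path_map (shift m x) (p, q) = path_map x (p + m, q + m)"
    if "p \<le> q" "enat_vec (q + m) \<le> path_deg x" for p q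
    using that by (rule path_map_shift)
  have "functor_path (shift m x)"
    unfolding functor_path_def le
  proof (intro conjI allI impI)
    fix p q :: "nat ^ 'k"
    assume pq: "p \<le> q" "enat_vec (q + m) \<le> path_deg x"
    moreover have "enat_vec (p + m) \<le> path_deg x"
      using enat_vec_mono[OF mono(1)] pq by blast
    ultimately show "path_map (shift m x) (p, q) \<in> Arr L"
      "Deg L (path_map (shift m x) (p, q)) = q - p"
      "Rng L (path_map (shift m x) (p, q)) = path_map (shift m x) (p, p)"
      "Src L (path_map (shift m x) (p, q)) = path_map (shift m x) (q, q)"
      using path_arr[OF fx mono(1)[OF pq(1)] pq(2)] mono(2) by (simp_all add: map)
  next
    fix p q t :: "nat ^ 'k"
    assume pq: "p \<le> q" "q \<le> t" "enat_vec (t + m) \<le> path_deg x"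
    then show "path_map (shift m x) (p, q) \<cdot> path_map (shift m x) (q, t) = path_map (shift m x) (p, t)"
      using path_comp(2)[OF fx mono(1)[OF pq(1)] mono(1)[OF pq(2)] pq(3)]
        enat_vec_mono[OF mono(1)[OF pq(2)] pq(3)] by (simp add: map)
  qed
  moreover have "meets_exhaustive (shift m x)"
    unfolding meets_exhaustive_def le
  proof (intro allI impI)
    fix n E
    assume n: "enat_vec (n + m) \<le> path_deg x"
      and E: "finite E" "E \<subseteq> arrows_into L (path_map (shift m x) (n, n))"
        "exhaustive L (path_map (shift m x) (n, n)) E"
    then obtain l where "l \<in> E" "enat_vec (n + m + Deg L l) \<le> path_deg x"
      "path_map x (n + m, n + m + Deg L l) = l"
      using bx unfolding meets_exhaustive_def map[OF order_refl n] by blast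
    then show "\<exists>l\<in>E. enat_vec (n + Deg L l + m) \<le> path_deg x \<and>
        path_map (shift m x) (n, n + Deg L l) = l"
      by (intro bexI[of _ l]) (simp_all add: map add.assoc add.commute[of m])
  qed
  moreover have "path_map (shift m x) \<in> extensional (Arr (Omega (path_deg (shift m x))))"
    by (simp add: shift_def del: Arr_Omega)
  ultimately show ?thesis
    by (simp add: boundary_path_iff)
qed

lemma shift_zero [simp]: "x \<in> boundary_paths L \<Longrightarrow> shift 0 x = x"
  by (rule path_eqI) (auto simp: path_map_shift boundary_paths_ge_iff intro!: shift_boundary)

lemma boundary_paths_ge_zero [simp]: "boundary_paths_ge L 0 = boundary_paths L"
  by (auto simp: boundary_paths_ge_iff)

lemma boundary_paths_ge_add:
  "x \<in> boundary_paths_ge L (m + n) \<longleftrightarrow>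
     x \<in> boundary_paths_ge L m \<and> shift m x \<in> boundary_paths_ge L n"
proof -
  have "enat_vec m \<le> path_deg x" if "enat_vec (m + n) \<le> path_deg x"
    using that by (rule enat_vec_mono[rotated]) simp
  then show ?thesis
    using shift_boundary[of x m]
    by (auto simp: boundary_paths_ge_iff enat_vec_le_diff add.commute)
qed

lemma boundary_paths_ge_max:
  "x \<in> boundary_paths_ge L (vec_max m n) \<longleftrightarrow>
     x \<in> boundary_paths_ge L m \<and> x \<in> boundary_paths_ge L n"
  by (auto simp: boundary_paths_ge_iff enat_vec_max)

lemma shift_shift:
  assumes "x \<in> boundary_paths_ge L (m + n)"
  shows "shift n (shift m x) = shift (m + n) x"
proof (rule path_eqI)
  show "shift n (shift m x) \<in> boundary_paths L" "shift (m + n) x \<in> boundary_paths L"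
    using assms by (simp_all add: boundary_paths_ge_add shift_boundary)
  show "path_deg (shift n (shift m x)) = path_deg (shift (m + n) x)"
    by (simp add: enat_vec_diff_diff)
  fix p q :: "nat ^ 'k"
  assume p: "p \<le> q" "enat_vec q \<le> path_deg (shift n (shift m x))"
  have le: "enat_vec (q + (m + n)) \<le> path_deg x"
    using p assms by (simp add: enat_vec_diff_diff enat_vec_le_diff boundary_paths_ge_iff)
  then have "enat_vec m \<le> path_deg x"
    by (rule enat_vec_mono[rotated]) (simp add: less_eq_vec_def)
  with le have le': "enat_vec (q + n) \<le> path_deg (shift m x)"
    by (simp add: enat_vec_le_diff add.assoc add.commute[of m])
  have "p + n \<le> q + n" using p by (simp add: less_eq_vec_def)
  then show "path_map (shift n (shift m x)) (p, q) = path_map (shift (m + n) x) (p, q)"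
    using p le le' path_map_shift[OF p(1) le'] path_map_shift[OF p(1) le]
    by (simp add: path_map_shift add.assoc add.commute[of m])
qed

lemma path_range_shift:
  "path_range (shift m x) = Src L (path_map x (0, m))" if "x \<in> boundary_paths_ge L m"
  using that path_arr(4)[OF functor_pathI, of x 0 m]
  by (simp add: path_range_def path_map_shift boundary_paths_ge_iff)


text \<open>
  This is the local injectivity of the shifts. The given data determine all long initial segments,
  and every segment is cut out of one of these.
\<close>

lemma path_eq_if_head_tail_eq:
  assumes x: "x \<in> boundary_paths_ge L m" and y: "y \<in> boundary_paths_ge L m"
    and head: "path_map x (0, m) = path_map y (0, m)" and tail: "shift m x = shift m y"
  shows "x = y"
proof -
  have X: "x \<in> boundary_paths L" "enat_vec m \<le> path_deg x"
    and Y: "y \<in> boundary_paths L" "enat_vec m \<le> path_deg y"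
    using x y by (simp_all add: boundary_paths_ge_iff)
  have fx: "functor_path x" and fy: "functor_path y"
    using X Y by (simp_all add: functor_pathI)
  have d: "path_deg x = path_deg y"
    using enat_vec_diff_add[OF X(2)] enat_vec_diff_add[OF Y(2)] tail path_deg_shift by metis
  have whole: "path_map x (0, t) = path_map y (0, t)" if t: "m \<le> t" "enat_vec t \<le> path_deg x" for t
  proof -
    have "path_map x (m, t) = path_map (shift m x) (0, t - m)"
      using t by (simp add: path_map_shift vec_plus_minus add.commute)
    also have "\<dots> = path_map y (m, t)"
      unfolding tail using t d by (simp add: path_map_shift vec_plus_minus add.commute)
    finally show ?thesis
      using path_comp(2)[OF fx _ t(1) t(2), of 0] path_comp(2)[OF fy _ t(1), of 0] head d t(2) by simp
  qed
  show ?thesis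
  proof (rule path_eqI[OF X(1) Y(1) d])
    fix p q :: "nat ^ 'k"
    assume p: "p \<le> q" "enat_vec q \<le> path_deg x"
    let ?t = "vec_max q m"
    have t: "m \<le> ?t" "q \<le> ?t" "enat_vec ?t \<le> path_deg x"
      using X p by (simp_all add: enat_vec_max)
    have q: "path_map x (0, q) = path_map y (0, q)"
    proof -
      have c: "composable (path_map y (0, q)) (path_map y (q, ?t))"
        "path_map y (0, q) \<cdot> path_map y (q, ?t) = path_map x (0, ?t)"
        using path_comp[OF fy _ t(2), of 0] t(3) d whole[OF t(1,3)] by simp_all
      have "Deg L (path_map y (0, q)) = q"
        using path_arr(2)[OF fy, of 0 q] p d by (simp add: vec_eq_iff)
      then show ?thesis
        using path_factor(2)[OF fx _ t(3) c(2)[symmetric] c(1)] by simp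
    qed
    have c: "composable (path_map y (0, p)) (path_map y (p, q))"
        "path_map y (0, p) \<cdot> path_map y (p, q) = path_map x (0, q)"
      using path_comp[OF fy _ p(1), of 0] p(2) d q by simp_all
    have "Deg L (path_map y (0, p)) = p"
      using path_arr(2)[OF fy, of 0 p] enat_vec_mono[OF p] d by (simp add: vec_eq_iff)
    then show "path_map x (p, q) = path_map y (p, q)"
      using path_factor(3)[OF fx _ p(2) c(2)[symmetric] c(1)] by simp
  qed
qed

text \<open>
  The set \<open>F\<close>, usually written \<open>Ext(\<mu>; E)\<close>, transports the exhaustive set \<open>E\<close> along \<open>\<mu>\<close>. Finite alignment enters
  here: it keeps the transported set finite, which is why extensions of boundary paths are
  again boundary paths.
\<close>

lemma exhaustive_transport:
  assumes mu: "\<mu> \<in> Arr L" and E: "finite E" "E \<subseteq> arrows_into L (Rng L \<mu>)" "exhaustive L (Rng L \<mu>) E"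
  defines "F \<equiv> \<Union>e\<in>E. fst ` Lambda_min L \<mu> e"
  shows "finite F" "F \<subseteq> arrows_into L (Src L \<mu>)" "exhaustive L (Src L \<mu>) F"
proof -
  have arr: "e \<in> Arr L" if "e \<in> E" for e
    using that E by (auto simp: arrows_into_def)
  show "finite F"
    unfolding F_def using E aligned mu arr by (auto simp: finitely_aligned_def)
  show "F \<subseteq> arrows_into L (Src L \<mu>)"
    unfolding F_def by (auto simp: Lambda_min_def arrows_into_def)
  show "exhaustive L (Src L \<mu>) F"
    unfolding exhaustive_def
  proof
    fix l assume "l \<in> arrows_into L (Src L \<mu>)"
    then have l: "composable \<mu> l"
      using mu by (simp add: composable_def arrows_into_def)
    then have "\<mu> \<cdot> l \<in> arrows_into L (Rng L \<mu>)"
      by (simp add: arrows_into_def comp_arr rng_comp)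
    then obtain e where e: "e \<in> E" "Lambda_min L (\<mu> \<cdot> l) e \<noteq> {}"
      using E(3) unfolding exhaustive_def by blast
    then obtain a b where "(a, b) \<in> Lambda_min L (\<mu> \<cdot> l) e" by auto
    then have ab: "composable (\<mu> \<cdot> l) a" "composable e b" "\<mu> \<cdot> l \<cdot> a = e \<cdot> b"
      using Lambda_min_composable comp_arr[OF l] arr[OF e(1)] by metis+
    have la: "composable l a" using ab(1) l composable_comp by metis
    have "composable \<mu> (l \<cdot> a)" "\<mu> \<cdot> (l \<cdot> a) = e \<cdot> b"
      using l la ab(3) by (simp_all add: composable_comp comp_assoc)
    then obtain \<alpha> \<beta> \<gamma> where g: "(\<alpha>, \<beta>) \<in> Lambda_min L \<mu> e" "composable \<alpha> \<gamma>" "l \<cdot> a = \<alpha> \<cdot> \<gamma>"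
      using common_extension_through_min ab(2) by metis
    then have "\<alpha> \<in> F" unfolding F_def using e by force
    moreover have "Lambda_min L l \<alpha> \<noteq> {}"
      using common_extension_through_min[OF la g(2,3)] by blast
    ultimately show "\<exists>u\<in>F. Lambda_min L l u \<noteq> {}" by blast
  qed
qed

text \<open>
  The initial segments of \<open>lx\<close> of large degree are the products \<open>l \<cdot> x(0, N - e)\<close>, and all other
  segments are cut out of these. An exhaustive set at a vertex of \<open>lx\<close> is transported to a vertex
  on \<open>x\<close>, where \<open>x\<close> meets it because \<open>x\<close> is a boundary path.
\<close>

lemma prepend_exists:
  assumes l: "l \<in> Arr L" and x: "x \<in> boundary_paths L" "path_range x = Src L l"
  obtains y where "y \<in> boundary_paths_ge L (Deg L l)" "path_map y (0, Deg L l) = l"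
    "shift (Deg L l) y = x"
proof -
  define e where "e = Deg L l"
  define D where "D = path_deg x + enat_vec e"
  have fx: "functor_path x" and bx: "meets_exhaustive x"
    using x by (simp_all add: boundary_path_iff)
  have le: "enat_vec (N - e) \<le> path_deg x" if "e \<le> N" "enat_vec N \<le> D" for N
  proof -
    have "enat_vec ((N - e) + e) \<le> D"
      using that by (simp add: vec_plus_minus add.commute)
    then show ?thesis
      unfolding D_def by (simp add: enat_vec_le_add)
  qed
  have eD: "enat_vec e \<le> D" by (simp add: D_def)
  \<comment> \<open>The extended path has the arrows \<open>l \<cdot> x(0, N - e)\<close> as its initial segments of degree \<open>N \<ge> e\<close>.\<close>
  define W where "W N = l \<cdot> path_map x (0, N - e)" for N
  have Wc: "composable l (path_map x (0, N - e))" if "e \<le> N" "enat_vec N \<le> D" for N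
    using l x path_arr[OF fx _ le[OF that], of 0]
    by (simp add: composable_def path_range_def)
  have W_arr: "W N \<in> Arr L" and W_deg: "Deg L (W N) = N" if "e \<le> N" "enat_vec N \<le> D" for N
    using Wc[OF that] path_arr(2)[OF fx _ le[OF that], of 0] that
    by (simp_all add: W_def comp_arr deg_comp e_def[symmetric] vec_eq_iff less_eq_vec_def)
  have W_ext: "\<exists>c. composable (W N) c \<and> W N' = W N \<cdot> c"
    if "e \<le> N" "N \<le> N'" "enat_vec N' \<le> D" for N N'
  proof -
    have N: "enat_vec N \<le> D" "e \<le> N'"
      using that enat_vec_mono by (blast, metis order_trans)
    have "N - e \<le> N' - e" using that by (simp add: less_eq_vec_def diff_le_mono)
    from path_comp[OF fx _ this le[OF N(2) that(3)], of 0]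
    have c: "composable (path_map x (0, N - e)) (path_map x (N - e, N' - e))"
      "path_map x (0, N' - e) = path_map x (0, N - e) \<cdot> path_map x (N - e, N' - e)" by simp_all
    then have "W N' = W N \<cdot> path_map x (N - e, N' - e)"
      unfolding W_def using comp_assoc[OF Wc[OF that(1) N(1)] c(1)] by simp
    moreover have "composable (W N) (path_map x (N - e, N' - e))"
      unfolding W_def using c(1) composable_comp(1)[OF Wc[OF that(1) N(1)]] by simp
    ultimately show ?thesis by blast
  qed
  define s where "s p q = (THE b. is_seg (W (vec_max q e)) p q b)" for p q
  have seg: "is_seg (W N) p q (s p q)" if pq: "p \<le> q" and N: "q \<le> N" "e \<le> N" "enat_vec N \<le> D" for p q N
  proof -
    let ?M = "vec_max q e"
    have M: "e \<le> ?M" "q \<le> ?M" "?M \<le> N" "enat_vec ?M \<le> D"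
      using N eD enat_vec_mono[OF N(1,3)]
      by (simp_all add: enat_vec_max) (simp add: less_eq_vec_def vec_max_def)
    have "q \<le> Deg L (W ?M)"
      using M W_deg[OF M(1,4)] by simp
    then obtain b where b: "is_seg (W ?M) p q b"
      by (rule is_seg_exists[OF W_arr[OF M(1,4)] pq])
    then have "s p q = b"
      unfolding s_def using is_seg_unique by blast
    then show ?thesis
      using W_ext[OF M(1,3) N(3)] b is_seg_extend by metis
  qed
  have seg': "is_seg (W (vec_max q e)) p q (s p q)" if "p \<le> q" "enat_vec q \<le> D" for p q
    using that eD by (intro seg) (simp_all add: enat_vec_max)
  define y where "y = \<lparr>path_deg = D,
      path_map = restrict (\<lambda>(p, q). s p q) {(p, q). p \<le> q \<and> enat_vec q \<le> D}\<rparr>"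
  have yD: "path_deg y = D" by (simp add: y_def)
  have y: "path_map y (p, q) = s p q" if "p \<le> q" "enat_vec q \<le> D" for p q
    using that by (simp add: y_def)
  have fy: "functor_path y"
    unfolding functor_path_def yD
  proof (intro conjI allI impI)
    fix p q :: "nat ^ 'k"
    assume pq: "p \<le> q" "enat_vec q \<le> D"
    have p: "enat_vec p \<le> D" using enat_vec_mono pq by blast
    note S = seg'[OF pq]
    show "path_map y (p, q) \<in> Arr L" "Deg L (path_map y (p, q)) = q - p"
      using S pq by (simp_all add: y is_seg_arr is_seg_deg)
    have N: "p \<le> vec_max q e" "q \<le> vec_max q e" "e \<le> vec_max q e" "enat_vec (vec_max q e) \<le> D"
      using pq eD order_trans[OF pq(1)] by (simp_all add: enat_vec_max)
    show "Rng L (path_map y (p, q)) = path_map y (p, p)" "Src L (path_map y (p, q)) = path_map y (q, q)"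
      using is_seg_unique[OF is_seg_ends(1)[OF S] seg[OF order_refl N(1,3,4)]]
        is_seg_unique[OF is_seg_ends(2)[OF S] seg[OF order_refl N(2,3,4)]] pq p
      by (simp_all add: y)
  next
    fix p q t :: "nat ^ 'k"
    assume pq: "p \<le> q" "q \<le> t" "enat_vec t \<le> D"
    have q: "enat_vec q \<le> D" "p \<le> t" using enat_vec_mono pq by (blast, metis order_trans)
    have N: "q \<le> vec_max t e" "e \<le> vec_max t e" "enat_vec (vec_max t e) \<le> D"
      using pq eD order_trans[OF pq(2)] by (simp_all add: enat_vec_max)
    show "path_map y (p, q) \<cdot> path_map y (q, t) = path_map y (p, t)"
      using is_seg_unique[OF is_seg_comp(2)[OF seg[OF pq(1) N] seg'[OF pq(2,3)]] seg'[OF q(2) pq(3)]]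
        pq q by (simp add: y)
  qed
  have tail: "path_map y (p + e, q + e) = path_map x (p, q)"
    if "p \<le> q" "enat_vec q \<le> path_deg x" for p q
  proof -
    have q: "p + e \<le> q + e" "enat_vec (q + e) \<le> D"
      using that by (simp add: less_eq_vec_def, simp add: D_def enat_vec_le_add)
    have "is_seg (path_map x (0, q)) p q (path_map x (p, q))"
    proof -
      have *: "composable (path_map x (0, p)) (path_map x (p, q))"
        "path_map x (0, p) \<cdot> path_map x (p, q) = path_map x (0, q)"
        using path_comp[OF fx _ that, of 0] by simp_all
      have "Deg L (path_map x (0, p)) = p" "Deg L (path_map x (p, q)) = q - p"
        using path_arr(2)[OF fx _ enat_vec_mono[OF that], of 0] path_arr(2)[OF fx that]
        by (simp_all add: vec_eq_iff)
      moreover have "path_map x (p, q) \<cdot> Src L (path_map x (p, q)) = path_map x (p, q)"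
        using path_arr(1)[OF fx that] by simp
      moreover have "composable (path_map x (p, q)) (Src L (path_map x (p, q)))"
        using path_arr(1)[OF fx that] by (simp add: composable_def)
      ultimately show ?thesis
        unfolding is_seg_def using * that(1) by metis
    qed
    from is_seg_shift[OF this, of l] have "is_seg (W (q + e)) (p + e) (q + e) (path_map x (p, q))"
      using Wc[OF _ q(2)] by (simp add: W_def e_def[symmetric] add.commute[of e])
    moreover have "is_seg (W (q + e)) (p + e) (q + e) (s (p + e) (q + e))"
      using q by (intro seg) simp_all
    ultimately show ?thesis
      using is_seg_unique y[OF q] by metis
  qed
  have ey: "meets_exhaustive y"
    unfolding meets_exhaustive_def yD
  proof (intro allI impI)
    fix n E
    assume n: "enat_vec n \<le> D" and E: "finite E" "E \<subseteq> arrows_into L (path_map y (n, n))"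
      "exhaustive L (path_map y (n, n)) E"
    \<comment> \<open>The vertex of degree \<open>m\<close> is the first one past both the given vertex and the end of \<open>l\<close>.\<close>
    define m where "m = vec_max n e"
    have m: "n \<le> m" "e \<le> m" "enat_vec m \<le> D"
      using n eD by (simp_all add: m_def enat_vec_max)
    define \<mu> where "\<mu> = path_map y (n, m)"
    have mu: "\<mu> \<in> Arr L" "Deg L \<mu> = m - n" "Rng L \<mu> = path_map y (n, n)" "Src L \<mu> = path_map y (m, m)"
      unfolding \<mu>_def using path_arr[OF fy m(1)] m(3) yD by simp_all
    define F where "F = (\<Union>e\<in>E. fst ` Lambda_min L \<mu> e)"
    have F: "finite F" "F \<subseteq> arrows_into L (Src L \<mu>)" "exhaustive L (Src L \<mu>) F"
      unfolding F_def using exhaustive_transport[OF mu(1), of E] E mu(3) by simp_all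
    have "Src L \<mu> = path_map x (m - e, m - e)"
      using mu(4) tail[OF order_refl le[OF m(2,3)]] m(2) by (simp add: vec_plus_minus add.commute)
    then obtain a where a: "a \<in> F" "enat_vec (m - e + Deg L a) \<le> path_deg x"
      "path_map x (m - e, m - e + Deg L a) = a"
      using bx F le[OF m(2,3)] unfolding meets_exhaustive_def by metis
    have me: "m - e + Deg L a + e = m + Deg L a" "m - e + e = m"
      using vec_plus_minus[OF m(2)] by (metis add.assoc add.commute)+
    have ya: "path_map y (m, m + Deg L a) = a" and ma: "enat_vec (m + Deg L a) \<le> D"
      using tail[of "m - e" "m - e + Deg L a"] a(2,3) enat_vec_le_add[of "m - e + Deg L a" e] me
      by (simp_all add: D_def)
    obtain \<epsilon> b where eb: "\<epsilon> \<in> E" "(a, b) \<in> Lambda_min L \<mu> \<epsilon>"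
      using a(1) by (auto simp: F_def)
    have "\<epsilon> \<in> Arr L" using eb(1) E(2) by (auto simp: arrows_into_def)
    then have c: "composable \<mu> a" "composable \<epsilon> b" "\<mu> \<cdot> a = \<epsilon> \<cdot> b"
      using Lambda_min_composable[OF eb(2) mu(1)] by auto
    have nm: "n \<le> m + Deg L a" using m(1) order_trans by fastforce
    have "path_map y (n, m + Deg L a) = \<epsilon> \<cdot> b"
      using path_comp(2)[OF fy m(1), of "m + Deg L a"] ma yD ya c(3) by (simp add: \<mu>_def)
    from path_factor[OF fy nm _ this c(2)] ma yD
    have "path_map y (n, n + Deg L \<epsilon>) = \<epsilon>" "enat_vec (n + Deg L \<epsilon>) \<le> D"
      using enat_vec_mono by auto
    then show "\<exists>l\<in>E. enat_vec (n + Deg L l) \<le> D \<and> path_map y (n, n + Deg L l) = l"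
      using eb(1) by blast
  qed
  have yX: "y \<in> boundary_paths L"
    unfolding boundary_path_iff using fy ey by (simp add: y_def)
  then have ye: "y \<in> boundary_paths_ge L e"
    using eD yD by (simp add: boundary_paths_ge_iff)
  show ?thesis
  proof (rule that)
    show "y \<in> boundary_paths_ge L (Deg L l)" using ye e_def by simp
    have "W e = l"
      using l x path_arr(3)[OF fx, of 0 0] by (simp add: W_def path_range_def)
    then have "is_seg l 0 e (s 0 e)"
      using seg[of 0 e e] eD by simp
    then show "path_map y (0, Deg L l) = l"
      using is_seg_unique is_seg_self[OF l] y[OF _ eD] by (metis e_def vec_zero_le)
    show "shift (Deg L l) y = x"
    proof (rule path_eqI[OF shift_boundary x(1)])
      show "y \<in> boundary_paths_ge L (Deg L l)" using ye e_def by simp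
      show d: "path_deg (shift (Deg L l) y) = path_deg x"
        using yD by (simp add: D_def e_def)
      fix p q :: "nat ^ 'k"
      assume p: "p \<le> q" "enat_vec q \<le> path_deg (shift (Deg L l) y)"
      then have "enat_vec (q + e) \<le> path_deg y"
        using d yD by (simp add: D_def enat_vec_le_add)
      then show "path_map (shift (Deg L l) y) (p, q) = path_map x (p, q)"
        using p d tail by (simp add: path_map_shift e_def)
    qed
  qed
qed

text \<open>Existence and uniqueness of the extension give the definite description its meaning.\<close>

lemma prepend:
  assumes "l \<in> Arr L" "x \<in> boundary_paths L" "path_range x = Src L l"
  shows "prepend L l x \<in> boundary_paths_ge L (Deg L l)" "path_map (prepend L l x) (0, Deg L l) = l"
    "shift (Deg L l) (prepend L l x) = x"
proof -
  obtain y where y: "y \<in> boundary_paths_ge L (Deg L l) \<and> path_map y (0, Deg L l) = l \<and>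
     shift (Deg L l) y = x"
    using prepend_exists[OF assms] by blast
  then have "prepend L l x = y"
    unfolding prepend_def by (rule the_equality) (use y path_eq_if_head_tail_eq in metis)
  with y show "prepend L l x \<in> boundary_paths_ge L (Deg L l)"
    "path_map (prepend L l x) (0, Deg L l) = l" "shift (Deg L l) (prepend L l x) = x"
    by simp_all
qed

lemma prepend_head_tail:
  assumes "y \<in> boundary_paths_ge L m"
  shows "prepend L (path_map y (0, m)) (shift m y) = y"
proof -
  have y: "path_map y (0, m) \<in> Arr L" "Deg L (path_map y (0, m)) = m"
    using assms path_arr[OF functor_pathI, of y 0 m]
    by (simp_all add: boundary_paths_ge_iff vec_eq_iff)
  show ?thesis
    using prepend[OF y(1) shift_boundary[OF assms] path_range_shift[OF assms]] y(2)
      path_eq_if_head_tail_eq[of _ m y] assms by simp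
qed


section \<open>The topology of the boundary-path space\<close>

lemma path_initial:
  assumes "x \<in> boundary_paths_ge L m"
  shows "path_map x (0, m) \<in> Arr L" "Deg L (path_map x (0, m)) = m"
  using assms path_arr[OF functor_pathI, of x 0 m]
  by (simp_all add: boundary_paths_ge_iff vec_eq_iff)

lemma cylinder_iff:
  assumes l: "l \<in> Arr L"
  shows "y \<in> cylinder L l \<longleftrightarrow>
    y \<in> boundary_paths_ge L (Deg L l) \<and> path_map y (0, Deg L l) = l"
proof
  assume "y \<in> cylinder L l"
  then show "y \<in> boundary_paths_ge L (Deg L l) \<and> path_map y (0, Deg L l) = l"
    using prepend[OF l] by (auto simp: cylinder_def)
next
  assume y: "y \<in> boundary_paths_ge L (Deg L l) \<and> path_map y (0, Deg L l) = l"
  then have "y = prepend L l (shift (Deg L l) y)"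
    using prepend_head_tail by metis
  then show "y \<in> cylinder L l"
    unfolding cylinder_def using shift_boundary path_range_shift y by (metis (mono_tags, lifting) mem_Collect_eq)
qed

lemma cylinder_initial: "x \<in> cylinder L (path_map x (0, m))" if "x \<in> boundary_paths_ge L m"
  using that path_initial[OF that] by (simp add: cylinder_iff)

lemma cylinder_boundary: "l \<in> Arr L \<Longrightarrow> y \<in> cylinder L l \<Longrightarrow> y \<in> boundary_paths L"
  by (simp add: cylinder_iff boundary_paths_ge_iff)

lemma cylinder_vertex:
  assumes "a \<in> Arr L"
  shows "y \<in> cylinder L (Src L a) \<longleftrightarrow> y \<in> boundary_paths L \<and> path_range y = Src L a"
  using assms by (simp add: cylinder_iff path_range_def)

lemma path_range_arr:
  assumes "x \<in> boundary_paths L"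
  shows "path_range x \<in> Arr L" "Rng L (path_range x) = path_range x" "Src L (path_range x) = path_range x"
  using assms path_arr[OF functor_pathI, of x 0 0] by (simp_all add: path_range_def)

lemma cylinder_comp:
  assumes ab: "composable a b"
  shows "y \<in> cylinder L (a \<cdot> b) \<longleftrightarrow> y \<in> cylinder L a \<and> shift (Deg L a) y \<in> cylinder L b"
proof -
  have arr: "a \<in> Arr L" "b \<in> Arr L" "a \<cdot> b \<in> Arr L" "Deg L (a \<cdot> b) = Deg L a + Deg L b"
    using ab by (simp_all add: composable_def comp_arr deg_comp)
  let ?d = "Deg L a" and ?e = "Deg L b"
  have "path_map y (0, ?d + ?e) = a \<cdot> b \<longleftrightarrow>
      path_map y (0, ?d) = a \<and> path_map (shift ?d y) (0, ?e) = b"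
    if "y \<in> boundary_paths_ge L (?d + ?e)"
  proof -
    have y: "functor_path y" "enat_vec (?d + ?e) \<le> path_deg y"
      using that by (simp_all add: boundary_paths_ge_iff functor_pathI)
    have s: "path_map (shift ?d y) (0, ?e) = path_map y (?d, ?d + ?e)"
      using y by (simp add: path_map_shift add.commute)
    have c: "path_map y (0, ?d) \<cdot> path_map y (?d, ?d + ?e) = path_map y (0, ?d + ?e)"
      using path_comp(2)[OF y(1) _ _ y(2), of 0 ?d] by simp
    show ?thesis
      using path_factor[OF y(1) _ y(2), of 0 a b] ab c s by auto
  qed
  then show ?thesis
    using arr boundary_paths_ge_add by (auto simp: cylinder_iff)
qed

lemma shift_in_cylinder:
  assumes a: "a \<in> Arr L" and l: "l \<in> Arr L" and y: "y \<in> cylinder L a"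
  shows "shift (Deg L a) y \<in> cylinder L l \<longleftrightarrow> composable a l \<and> y \<in> cylinder L (a \<cdot> l)"
proof -
  have "composable a l" if "shift (Deg L a) y \<in> cylinder L l"
  proof -
    have "path_range (shift (Deg L a) y) = Src L a"
      using y a by (simp add: cylinder_iff path_range_shift)
    moreover have "path_range (shift (Deg L a) y) = Rng L l"
      using that l path_arr(3)[OF functor_pathI, of "shift (Deg L a) y" 0 "Deg L l"]
      by (auto simp: cylinder_iff boundary_paths_ge_iff path_range_def)
    ultimately show ?thesis using a l by (simp add: composable_def)
  qed
  then show ?thesis using cylinder_comp y by blast
qed

lemma cylinder_segments:
  assumes x: "x \<in> boundary_paths_ge L r" and y: "y \<in> cylinder L (path_map x (0, r))"
    and pq: "p \<le> q" "q \<le> r"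
  shows "y \<in> boundary_paths_ge L r" "path_map y (p, q) = path_map x (p, q)"
proof -
  show yr: "y \<in> boundary_paths_ge L r"
    using x y path_initial[OF x] by (simp add: cylinder_iff)
  have e: "path_map y (0, r) = path_map x (0, r)"
    using x y path_initial[OF x] by (simp add: cylinder_iff)
  have X: "functor_path x" "enat_vec r \<le> path_deg x" "functor_path y" "enat_vec r \<le> path_deg y"
    using x yr by (simp_all add: boundary_paths_ge_iff functor_pathI)
  have q: "enat_vec q \<le> path_deg x" "enat_vec q \<le> path_deg y" "enat_vec p \<le> path_deg x"
    using X enat_vec_mono[OF pq(2)] enat_vec_mono[OF pq(1)] by blast+
  have c: "path_map y (0, q) = path_map x (0, q)"
    using path_factor(2)[OF X(3) _ X(4), of 0 "path_map x (0, q)" "path_map x (q, r)"]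
      path_comp[OF X(1) _ pq(2) X(2), of 0] e path_arr(2)[OF X(1) _ q(1), of 0]
    by (simp add: vec_eq_iff)
  show "path_map y (p, q) = path_map x (p, q)"
    using path_factor(3)[OF X(3) _ q(2), of 0 "path_map x (0, p)" "path_map x (p, q)"]
      path_comp[OF X(1) _ pq(1) q(1), of 0] c path_arr(2)[OF X(1) _ q(3), of 0]
    by (simp add: vec_eq_iff)
qed

lemma cylinder_Int:
  assumes l: "l \<in> Arr L" and u: "u \<in> Arr L"
  shows "y \<in> cylinder L l \<and> y \<in> cylinder L u \<longleftrightarrow>
    (\<exists>(a, b) \<in> Lambda_min L l u. y \<in> cylinder L (l \<cdot> a))"
proof
  assume y: "y \<in> cylinder L l \<and> y \<in> cylinder L u"
  define t where "t = vec_max (Deg L l) (Deg L u)"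
  have yt: "y \<in> boundary_paths_ge L t"
    using y l u by (simp add: t_def boundary_paths_ge_max cylinder_iff)
  then have Y: "functor_path y" "enat_vec t \<le> path_deg y"
    by (simp_all add: boundary_paths_ge_iff functor_pathI)
  define a where "a = path_map y (Deg L l, t)"
  define b where "b = path_map y (Deg L u, t)"
  have "composable l a" "composable u b" "l \<cdot> a = path_map y (0, t)" "u \<cdot> b = path_map y (0, t)"
    using path_comp[OF Y(1) _ _ Y(2), of 0 "Deg L l"] path_comp[OF Y(1) _ _ Y(2), of 0 "Deg L u"]
      y l u by (simp_all add: a_def b_def t_def cylinder_iff)
  then obtain \<alpha> \<beta> \<gamma> where g: "(\<alpha>, \<beta>) \<in> Lambda_min L l u" "composable \<alpha> \<gamma>" "a = \<alpha> \<cdot> \<gamma>"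
    and la: "composable l (\<alpha> \<cdot> \<gamma>)" "path_map y (0, t) = l \<cdot> (\<alpha> \<cdot> \<gamma>)"
    using common_extension_through_min by metis
  have c: "composable l \<alpha>" using la g composable_comp by blast
  have "y \<in> cylinder L (l \<cdot> \<alpha> \<cdot> \<gamma>)"
    using cylinder_initial[OF yt] la comp_assoc[OF c g(2)] by simp
  then have "y \<in> cylinder L (l \<cdot> \<alpha>)"
    using cylinder_comp composable_comp c g by blast
  with g show "\<exists>(a, b) \<in> Lambda_min L l u. y \<in> cylinder L (l \<cdot> a)" by blast
next
  assume "\<exists>(a, b) \<in> Lambda_min L l u. y \<in> cylinder L (l \<cdot> a)"
  then show "y \<in> cylinder L l \<and> y \<in> cylinder L u"
    using Lambda_min_composable[OF _ l u] cylinder_comp by (metis (no_types, lifting) case_prodE)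
qed

text \<open>
  This is the defining property of boundary paths at the vertex \<open>Src L l\<close>: a path through \<open>l\<close> must
  continue along some element of the exhaustive set. It makes \<open>cylinder_diff L l G\<close> open for every
  finite \<open>G\<close>.
\<close>

lemma cylinder_diff_exhaustive:
  assumes l: "l \<in> Arr L" and G: "finite G" "G \<subseteq> arrows_into L (Src L l)" "exhaustive L (Src L l) G"
  shows "cylinder_diff L l G = {}"
proof -
  have "\<exists>u\<in>G. y \<in> cylinder L (l \<cdot> u)" if y: "y \<in> cylinder L l" for y
  proof -
    let ?z = "shift (Deg L l) y"
    have z: "?z \<in> boundary_paths L" "path_map ?z (0, 0) = Src L l"
      using y l path_range_shift shift_boundary by (auto simp: cylinder_iff path_range_def)
    then obtain u where u: "u \<in> G" "enat_vec (0 + Deg L u) \<le> path_deg ?z" "path_map ?z (0, 0 + Deg L u) = u"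
      using G unfolding boundary_path_iff meets_exhaustive_def by (metis enat_vec_zero)
    have "u \<in> Arr L" "composable l u"
      using u(1) G(2) l by (auto simp: arrows_into_def composable_def)
    then have "y \<in> cylinder L (l \<cdot> u)"
      using u(2,3) y z(1) by (simp add: cylinder_comp cylinder_iff[of u] boundary_paths_ge_iff)
    with u(1) show ?thesis by blast
  qed
  then show ?thesis by (auto simp: cylinder_diff_def)
qed

lemma openin_cylinder_diff:
  assumes "l \<in> Arr L" "finite G" "G \<subseteq> arrows_into L (Src L l)"
  shows "open_paths L (cylinder_diff L l G)"
proof (cases "exhaustive L (Src L l) G")
  case True
  then show ?thesis using assms by (simp add: cylinder_diff_exhaustive)
next
  case False
  then show ?thesis
    unfolding boundary_topology_def
    by (intro topology_generated_by_Basis) (use assms in auto)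
qed

lemma openin_cylinder: "open_paths L (cylinder L l)" if "l \<in> Arr L"
  using openin_cylinder_diff[OF that, of "{}"] by (simp add: cylinder_diff_def)

lemma topspace_boundary [simp]: "topspace (boundary_topology L) = boundary_paths L"
proof
  show "topspace (boundary_topology L) \<subseteq> boundary_paths L"
    unfolding boundary_topology_def topology_generated_by_topspace
    by (auto simp: cylinder_diff_def dest: cylinder_boundary)
  show "boundary_paths L \<subseteq> topspace (boundary_topology L)"
  proof
    fix x assume x: "x \<in> boundary_paths L"
    then have "x \<in> cylinder L (path_range x)"
      using cylinder_initial[of x 0] by (simp add: path_range_def)
    then show "x \<in> topspace (boundary_topology L)"
      using openin_subset[OF openin_cylinder[OF path_range_arr(1)[OF x]]] by blast
  qed
qed

text \<open>
  A path \<open>x\<close> outside the cylinder of \<open>l\<close> is separated from it by the cylinder of its range,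
  with the extensions of \<open>l\<close> removed if \<open>l\<close> has the same range.
\<close>

lemma openin_Compl_cylinder:
  assumes l: "l \<in> Arr L"
  shows "open_paths L (boundary_paths L - cylinder L l)"
proof (subst openin_subopen, intro ballI)
  fix x assume x: "x \<in> boundary_paths L - cylinder L l"
  define v where "v = path_range x"
  have v: "v \<in> Arr L" "Rng L v = v" "Src L v = v" "x \<in> cylinder L v"
    using x path_range_arr[of x] cylinder_initial[of x 0] by (simp_all add: v_def path_range_def)
  let ?G = "if Rng L l = v then {l} else {}"
  have "x \<in> cylinder_diff L v ?G"
    using x v l comp_rng[OF l] by (auto simp: cylinder_diff_def)
  moreover have "open_paths L (cylinder_diff L v ?G)"
    using v l by (intro openin_cylinder_diff) (auto simp: arrows_into_def)
  moreover have "cylinder_diff L v ?G \<subseteq> boundary_paths L - cylinder L l"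
  proof
    fix y assume y: "y \<in> cylinder_diff L v ?G"
    then have yv: "y \<in> cylinder L v" by (simp add: cylinder_diff_def)
    have "y \<notin> cylinder L l"
    proof
      assume yl: "y \<in> cylinder L l"
      have "path_range y = v"
        using yv v cylinder_vertex[of v] by simp
      moreover have "path_range y = Rng L l"
        using yl l path_arr(3)[OF functor_pathI, of y 0 "Deg L l"]
        by (auto simp: cylinder_iff boundary_paths_ge_iff path_range_def)
      ultimately show False
        using y yl comp_rng[OF l] by (simp add: cylinder_diff_def)
    qed
    then show "y \<in> boundary_paths L - cylinder L l"
      using yv v cylinder_boundary by blast
  qed
  ultimately show "\<exists>T. open_paths L T \<and> x \<in> T \<and> T \<subseteq> boundary_paths L - cylinder L l"
    by blast
qed

text \<open>
  As cylinders are clopen, continuity of a map into the boundary-path space only requires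
  preimages of cylinders to be clopen.
\<close>

lemma continuous_map_into_boundary:
  assumes "f \<in> topspace Y \<rightarrow> boundary_paths L"
    and "\<And>l. l \<in> Arr L \<Longrightarrow> openin Y {y \<in> topspace Y. f y \<in> cylinder L l}"
    and "\<And>l. l \<in> Arr L \<Longrightarrow> openin Y {y \<in> topspace Y. f y \<notin> cylinder L l}"
  shows "continuous_map Y (boundary_topology L) f"
  unfolding boundary_topology_def
proof (rule continuous_on_generated_topo)
  fix U assume "U \<in> {cylinder_diff L l G | l G. l \<in> Arr L \<and> finite G \<and> G \<subseteq> arrows_into L (Src L l) \<and>
        \<not> exhaustive L (Src L l) G}"
  then obtain l G where U: "U = cylinder_diff L l G" "l \<in> Arr L" "finite G" "G \<subseteq> arrows_into L (Src L l)"
    by blast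
  have G: "l \<cdot> u \<in> Arr L" if "u \<in> G" for u
    using that U by (auto simp: arrows_into_def composable_def intro!: comp_arr)
  have "openin Y (\<Inter>(insert {y \<in> topspace Y. f y \<in> cylinder L l}
      ((\<lambda>u. {y \<in> topspace Y. f y \<notin> cylinder L (l \<cdot> u)}) ` G)))"
    using U assms G by (intro openin_Inter) auto
  moreover have "f -` U \<inter> topspace Y = \<Inter>(insert {y \<in> topspace Y. f y \<in> cylinder L l}
      ((\<lambda>u. {y \<in> topspace Y. f y \<notin> cylinder L (l \<cdot> u)}) ` G))"
    unfolding U cylinder_diff_def by auto
  ultimately show "openin Y (f -` U \<inter> topspace Y)" by simp
next
  show "f ` topspace Y \<subseteq> \<Union> {cylinder_diff L l G | l G. l \<in> Arr L \<and> finite G \<and> G \<subseteq> arrows_into L (Src L l) \<and>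
        \<not> exhaustive L (Src L l) G}"
    using assms(1) topspace_boundary unfolding boundary_topology_def topology_generated_by_topspace by blast
qed

lemma openin_boundary_paths_ge: "open_paths L (boundary_paths_ge L m)"
proof (subst openin_subopen, intro ballI)
  fix x assume x: "x \<in> boundary_paths_ge L m"
  then show "\<exists>T. open_paths L T \<and> x \<in> T \<and> T \<subseteq> boundary_paths_ge L m"
    using path_initial[OF x] cylinder_initial[OF x]
    by (intro exI[of _ "cylinder L (path_map x (0, m))"]) (auto simp: openin_cylinder cylinder_iff)
qed

lemma openin_preimage_shift:
  assumes "open_paths L U"
  shows "open_paths L {x \<in> boundary_paths_ge L m. shift m x \<in> U}"
proof -
  let ?Y = "subtopology (boundary_topology L) (boundary_paths_ge L m)"
  have Y: "topspace ?Y = boundary_paths_ge L m"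
    by (auto simp: boundary_paths_ge_iff)
  have local: "openin ?Y {y \<in> boundary_paths_ge L m. P (shift m y)}"
    if P: "\<And>a. a \<in> Arr L \<Longrightarrow> Deg L a = m \<Longrightarrow>
      open_paths L {y \<in> cylinder L a. P (shift m y)}" for P
  proof (subst openin_open_subtopology[OF openin_boundary_paths_ge], intro conjI)
    show "open_paths L {y \<in> boundary_paths_ge L m. P (shift m y)}"
    proof (subst openin_subopen, intro ballI)
      fix x assume x: "x \<in> {y \<in> boundary_paths_ge L m. P (shift m y)}"
      then have a: "path_map x (0, m) \<in> Arr L" "Deg L (path_map x (0, m)) = m"
        "x \<in> cylinder L (path_map x (0, m))"
        using path_initial cylinder_initial by auto
      show "\<exists>T. open_paths L T \<and> x \<in> T \<and> T \<subseteq> {y \<in> boundary_paths_ge L m. P (shift m y)}"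
        by (rule exI, intro conjI, rule P[OF a(1,2)]) (use a x in \<open>auto simp: cylinder_iff\<close>)
    qed
  qed auto
  have "continuous_map ?Y (boundary_topology L) (shift m)"
  proof (rule continuous_map_into_boundary)
    show "shift m \<in> topspace ?Y \<rightarrow> boundary_paths L"
      unfolding Y using shift_boundary by blast
  next
    fix l assume l: "l \<in> Arr L"
    have "{y \<in> cylinder L a. shift m y \<in> cylinder L l} =
        (if composable a l then cylinder L a \<inter> cylinder L (a \<cdot> l) else {})"
      "{y \<in> cylinder L a. shift m y \<notin> cylinder L l} =
        (if composable a l then cylinder L a \<inter> (boundary_paths L - cylinder L (a \<cdot> l)) else cylinder L a)"
      if "a \<in> Arr L" "Deg L a = m" for a
      using that shift_in_cylinder[OF that(1) l] cylinder_boundary[OF that(1)] by auto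
    then show "openin ?Y {y \<in> topspace ?Y. shift m y \<in> cylinder L l}"
      "openin ?Y {y \<in> topspace ?Y. shift m y \<notin> cylinder L l}"
      unfolding Y using l
      by (intro local; simp add: openin_cylinder openin_Compl_cylinder comp_arr openin_Int)+
  qed
  from openin_continuous_map_preimage[OF this assms]
  show ?thesis
    unfolding Y openin_open_subtopology[OF openin_boundary_paths_ge] by (rule conjunct1)
qed

text \<open>
  Shifts are open because prepending is continuous: a path \<open>az\<close> lies in the cylinder of \<open>l\<close> iff
  \<open>z\<close> lies in one of the finitely many cylinders of \<open>\<alpha>\<close> with \<open>(\<alpha>, \<beta>)\<close> minimal for \<open>(a, l)\<close>.
\<close>

lemma openin_preimage_prepend:
  assumes a: "a \<in> Arr L" and U: "open_paths L U"
  shows "open_paths L {z \<in> cylinder L (Src L a). prepend L a z \<in> U}"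
proof -
  let ?C = "cylinder L (Src L a)"
  let ?Y = "subtopology (boundary_topology L) ?C"
  have C: "open_paths L ?C"
    using a by (simp add: openin_cylinder)
  have Y: "topspace ?Y = ?C"
    using cylinder_boundary[of "Src L a"] a by auto
  have "continuous_map ?Y (boundary_topology L) (prepend L a)"
  proof (rule continuous_map_into_boundary)
    show "prepend L a \<in> topspace ?Y \<rightarrow> boundary_paths L"
      unfolding Y using prepend[OF a] cylinder_vertex[OF a] by (auto simp: boundary_paths_ge_iff)
  next
    fix l assume l: "l \<in> Arr L"
    define F where "F = fst ` Lambda_min L a l"
    have F: "finite F" "\<And>\<alpha>. \<alpha> \<in> F \<Longrightarrow> composable a \<alpha> \<and> \<alpha> \<in> Arr L"
      using aligned a l Lambda_min_composable[OF _ a l]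
      by (auto simp: F_def finitely_aligned_def composable_def)
    have iff: "prepend L a z \<in> cylinder L l \<longleftrightarrow> (\<exists>\<alpha>\<in>F. z \<in> cylinder L \<alpha>)" if z: "z \<in> ?C" for z
    proof -
      have az: "prepend L a z \<in> cylinder L a" "shift (Deg L a) (prepend L a z) = z"
        using z prepend[OF a] cylinder_vertex[OF a] by (auto simp: cylinder_iff[OF a])
      then have "prepend L a z \<in> cylinder L l \<longleftrightarrow> (\<exists>(\<alpha>, \<beta>) \<in> Lambda_min L a l. prepend L a z \<in> cylinder L (a \<cdot> \<alpha>))"
        using cylinder_Int[OF a l] by blast
      also have "\<dots> \<longleftrightarrow> (\<exists>\<alpha>\<in>F. prepend L a z \<in> cylinder L (a \<cdot> \<alpha>))"
        by (force simp: F_def)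
      also have "\<dots> \<longleftrightarrow> (\<exists>\<alpha>\<in>F. z \<in> cylinder L \<alpha>)"
        using F(2) az cylinder_comp by auto
      finally show ?thesis .
    qed
    have "openin ?Y (?C \<inter> (\<Union>\<alpha>\<in>F. cylinder L \<alpha>))"
      using F C by (intro openin_subtopology_Int2 openin_Union) (auto simp: openin_cylinder)
    moreover have "{z \<in> ?C. prepend L a z \<in> cylinder L l} = ?C \<inter> (\<Union>\<alpha>\<in>F. cylinder L \<alpha>)"
      using iff by blast
    ultimately show "openin ?Y {z \<in> topspace ?Y. prepend L a z \<in> cylinder L l}"
      unfolding Y by simp
    have "openin ?Y (?C \<inter> \<Inter>(insert ?C ((\<lambda>\<alpha>. boundary_paths L - cylinder L \<alpha>) ` F)))"
      using F C by (intro openin_subtopology_Int2 openin_Inter) (auto simp: openin_Compl_cylinder)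
    moreover have "{z \<in> ?C. prepend L a z \<notin> cylinder L l} =
        ?C \<inter> \<Inter>(insert ?C ((\<lambda>\<alpha>. boundary_paths L - cylinder L \<alpha>) ` F))"
      using iff cylinder_boundary[of "Src L a"] a by auto
    ultimately show "openin ?Y {z \<in> topspace ?Y. prepend L a z \<notin> cylinder L l}"
      unfolding Y by simp
  qed
  from openin_continuous_map_preimage[OF this U]
  show ?thesis
    unfolding Y openin_open_subtopology[OF C] by (rule conjunct1)
qed

lemma openin_image_shift:
  assumes U: "open_paths L U"
  shows "open_paths L (shift m ` (U \<inter> boundary_paths_ge L m))"
proof (subst openin_subopen, intro ballI)
  fix w assume "w \<in> shift m ` (U \<inter> boundary_paths_ge L m)"
  then obtain x where x: "x \<in> U" "x \<in> boundary_paths_ge L m" "w = shift m x" by blast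
  define a where "a = path_map x (0, m)"
  have a: "a \<in> Arr L" "Deg L a = m" unfolding a_def using path_initial[OF x(2)] .
  let ?T = "{z \<in> cylinder L (Src L a). prepend L a z \<in> U}"
  have "w \<in> ?T"
    using x prepend_head_tail[OF x(2)] shift_boundary[OF x(2)] path_range_shift[OF x(2)]
    by (simp add: cylinder_vertex[OF a(1), unfolded a_def] a_def)
  moreover have "?T \<subseteq> shift m ` (U \<inter> boundary_paths_ge L m)"
  proof
    fix z assume z: "z \<in> ?T"
    then have "prepend L a z \<in> boundary_paths_ge L m" "z = shift m (prepend L a z)"
      using prepend[OF a(1)] a(2) by (auto simp: cylinder_vertex[OF a(1)])
    with z show "z \<in> shift m ` (U \<inter> boundary_paths_ge L m)" by blast
  qed
  ultimately show "\<exists>T. open_paths L T \<and> w \<in> T \<and> T \<subseteq> shift m ` (U \<inter> boundary_paths_ge L m)"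
    using openin_preimage_prepend[OF a(1) U] by blast
qed


section \<open>Tail equivalence with lag\<close>

lemma shifts_eq_ge: "shifts_eq L p x q y \<Longrightarrow> x \<in> boundary_paths_ge L p"
  "shifts_eq L p x q y \<Longrightarrow> y \<in> boundary_paths_ge L q"
  "shifts_eq L p x q y \<Longrightarrow> shift p x = shift q y"
  by (simp_all add: shifts_eq_def)

lemma shifts_eq_boundary: "shifts_eq L p x q y \<Longrightarrow> x \<in> boundary_paths L"
  "shifts_eq L p x q y \<Longrightarrow> y \<in> boundary_paths L"
  by (simp_all add: shifts_eq_def boundary_paths_ge_iff)

lemma shifts_eq_refl: "x \<in> boundary_paths_ge L p \<Longrightarrow> shifts_eq L p x p x"
  by (simp add: shifts_eq_def)

lemma shifts_eq_sym: "shifts_eq L p x q y \<Longrightarrow> shifts_eq L q y p x"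
  by (simp add: shifts_eq_def)

lemma shifts_eq_trans: "shifts_eq L p x q y \<Longrightarrow> shifts_eq L q y t z \<Longrightarrow> shifts_eq L p x t z"
  by (simp add: shifts_eq_def)

lemma shifts_eq_add:
  assumes "shifts_eq L p x q y" "x \<in> boundary_paths_ge L (p + a)"
  shows "shifts_eq L (p + a) x (q + a) y"
  using assms shift_shift[of x p a] shift_shift[of y q a] boundary_paths_ge_add
  by (auto simp: shifts_eq_def)

lemma common_shift:
  assumes "x \<in> boundary_paths_ge L p" "x \<in> boundary_paths_ge L p'"
  obtains a a' where "p + a = p' + a'" "x \<in> boundary_paths_ge L (p + a)"
proof -
  have "p + (vec_max p p' - p) = vec_max p p'" "p' + (vec_max p p' - p') = vec_max p p'"
    by (simp_all add: vec_plus_minus)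
  then show ?thesis
    using that[of "vec_max p p' - p" "vec_max p p' - p'"] assms by (simp add: boundary_paths_ge_max)
qed

lemma shifts_eq_cancel:
  assumes e: "shifts_eq L (p + a) x (q + a) y" and seg: "path_map x (p, p + a) = path_map y (q, q + a)"
  shows "shifts_eq L p x q y"
proof -
  have x: "x \<in> boundary_paths_ge L p" "shift p x \<in> boundary_paths_ge L a"
    and y: "y \<in> boundary_paths_ge L q" "shift q y \<in> boundary_paths_ge L a"
    using shifts_eq_ge[OF e] by (simp_all add: boundary_paths_ge_add)
  have "shift p x = shift q y"
  proof (rule path_eq_if_head_tail_eq[OF x(2) y(2)])
    show "shift a (shift p x) = shift a (shift q y)"
      using shifts_eq_ge[OF e] by (simp add: shift_shift)
    show "path_map (shift p x) (0, a) = path_map (shift q y) (0, a)"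
      using shifts_eq_ge(1,2)[OF e] seg
      by (simp add: path_map_shift boundary_paths_ge_iff add.commute)
  qed
  with x y show ?thesis by (simp add: shifts_eq_def)
qed

text \<open>
  The witnesses \<open>(p, q)\<close> of a tail equivalence with given lag can be exchanged locally: the
  relations for two witness pairs differ only in finite segments, which are locally constant.
\<close>

lemma shifts_eq_locally_equivalent:
  assumes e: "shifts_eq L p x q y"
    and x0: "x \<in> boundary_paths_ge L p0" and y0: "y \<in> boundary_paths_ge L q0"
    and lag: "int_vec p0 - int_vec q0 = int_vec p - int_vec q"
  obtains U V where "open_paths L U" "x \<in> U" "open_paths L V" "y \<in> V"
    "\<And>x' y'. x' \<in> U \<Longrightarrow> y' \<in> V \<Longrightarrow> shifts_eq L p x' q y' \<Longrightarrow>
      shifts_eq L p0 x' q0 y' \<longleftrightarrow> shifts_eq L p0 x q0 y"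
proof -
  obtain a b where ab: "p + a = p0 + b" "x \<in> boundary_paths_ge L (p + a)"
    using common_shift[OF shifts_eq_ge(1)[OF e] x0] .
  have qb: "q + a = q0 + b"
    using ab(1) lag[symmetric] by (rule equal_lags_raise)
  have ea: "shifts_eq L (p + a) x (q + a) y"
    using shifts_eq_add e ab by blast
  then have ya: "y \<in> boundary_paths_ge L (q + a)" by (rule shifts_eq_ge)
  let ?U = "cylinder L (path_map x (0, p + a))" and ?V = "cylinder L (path_map y (0, q + a))"
  have le: "p0 \<le> p + a" "q0 \<le> q + a" using ab(1) qb by (metis vec_le_add(1))+
  have iff: "shifts_eq L p0 x' q0 y' \<longleftrightarrow> path_map x (p0, p + a) = path_map y (q0, q + a)"
    if "x' \<in> ?U" "y' \<in> ?V" "shifts_eq L p x' q y'" for x' y'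
  proof -
    have x': "x' \<in> boundary_paths_ge L (p + a)" "path_map x' (p0, p + a) = path_map x (p0, p + a)"
      using cylinder_segments[OF ab(2) that(1) le(1) order_refl] by auto
    have y': "y' \<in> boundary_paths_ge L (q + a)" "path_map y' (q0, q + a) = path_map y (q0, q + a)"
      using cylinder_segments[OF ya that(2) le(2) order_refl] by auto
    have "shifts_eq L (p0 + b) x' (q0 + b) y'"
      using shifts_eq_add[OF that(3) x'(1)] ab(1) qb by simp
    moreover have "path_map x' (p0, p + a) = path_map y' (q0, q + a)" if E: "shifts_eq L p0 x' q0 y'"
    proof -
      have "path_map x' (p0, p0 + b) = path_map (shift p0 x') (0, b)"
        "path_map y' (q0, q0 + b) = path_map (shift q0 y') (0, b)"
        using x'(1) y'(1) ab(1) qb by (simp_all add: path_map_shift boundary_paths_ge_iff add.commute)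
      then show ?thesis using shifts_eq_ge(3)[OF E] ab(1) qb by simp
    qed
    ultimately show ?thesis
      using shifts_eq_cancel[of p0 b x' q0 y'] x'(2) y'(2) ab(1) qb by auto
  qed
  have xU: "x \<in> ?U" "y \<in> ?V" using ab ya cylinder_initial by auto
  show ?thesis
  proof (rule that[OF _ xU(1) _ xU(2)])
    show "open_paths L ?U" "open_paths L ?V"
      using ab ya path_initial by (auto intro!: openin_cylinder)
    show "shifts_eq L p0 x' q0 y' \<longleftrightarrow> shifts_eq L p0 x q0 y"
      if "x' \<in> ?U" "y' \<in> ?V" "shifts_eq L p x' q y'" for x' y'
      using iff[OF that] iff[OF xU e] by simp
  qed
qed


section \<open>The topology of the boundary-path groupoid\<close>

text \<open>
  Unlike the generating sets of the topology, these sets restrict the range and the source of the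
  arrows independently of each other and keep the witness \<open>(p, q)\<close> fixed.
\<close>

definition tail_nbhd ::
  "nat ^ 'k \<Rightarrow> nat ^ 'k \<Rightarrow> ('a, 'k) path set \<Rightarrow> ('a, 'k) path set \<Rightarrow> ('a, 'k) bp_triple set" where
  "tail_nbhd p q U V = {(x, int_vec p - int_vec q, y) | x y. x \<in> U \<and> y \<in> V \<and> shifts_eq L p x q y}"

lemma tail_nbhd_iff:
  "(x, c, y) \<in> tail_nbhd p q U V \<longleftrightarrow>
    c = int_vec p - int_vec q \<and> x \<in> U \<and> y \<in> V \<and> shifts_eq L p x q y"
  by (auto simp: tail_nbhd_def)

lemma groupoid_arr_iff:
  "(x, c, y) \<in> arrows L \<longleftrightarrow> (\<exists>p q. c = int_vec p - int_vec q \<and> shifts_eq L p x q y)"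
  by (auto simp: bp_groupoid_def dest: shifts_eq_boundary)

lemma groupoid_arrE:
  assumes "t \<in> arrows L"
  obtains x y p q where "t = (x, int_vec p - int_vec q, y)" "shifts_eq L p x q y"
  using assms groupoid_arr_iff by (metis prod.exhaust)

lemma bisection_eq: "bisection L l u = tail_nbhd (Deg L l) (Deg L u) (cylinder L l) (cylinder L u)"
  by (auto simp: bisection_def tail_nbhd_def)

text \<open>
  Inside a bisection the range and the source of an arrow have the same tail, so one of them can
  be extended along \<open>w\<close> exactly when the other can.
\<close>

lemma bisection_comp_iff:
  assumes s: "Src L l = Src L u" "l \<in> Arr L" "u \<in> Arr L" and w: "composable l w"
    and t: "(x, c, y) \<in> bisection L l u"
  shows "(x, c, y) \<in> bisection L (l \<cdot> w) (u \<cdot> w) \<longleftrightarrow> x \<in> cylinder L (l \<cdot> w)"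
    "y \<in> cylinder L (u \<cdot> w) \<longleftrightarrow> x \<in> cylinder L (l \<cdot> w)"
proof -
  have uw: "composable u w" using s w by (simp add: composable_def)
  have t': "c = int_vec (Deg L l) - int_vec (Deg L u)" "x \<in> cylinder L l" "y \<in> cylinder L u"
    "shifts_eq L (Deg L l) x (Deg L u) y"
    using t by (simp_all add: bisection_eq tail_nbhd_iff)
  show *: "y \<in> cylinder L (u \<cdot> w) \<longleftrightarrow> x \<in> cylinder L (l \<cdot> w)"
    using t' cylinder_comp[OF w] cylinder_comp[OF uw] by (simp add: shifts_eq_def)
  have "shifts_eq L (Deg L l + Deg L w) x (Deg L u + Deg L w) y" if "x \<in> cylinder L (l \<cdot> w)"
    using that t'(4) comp_arr[OF w] deg_comp[OF w] by (intro shifts_eq_add) (simp_all add: cylinder_iff)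
  then show "(x, c, y) \<in> bisection L (l \<cdot> w) (u \<cdot> w) \<longleftrightarrow> x \<in> cylinder L (l \<cdot> w)"
    using * t' by (auto simp: bisection_eq tail_nbhd_iff deg_comp[OF w] deg_comp[OF uw])
qed

lemma bisection_diff_iff:
  assumes s: "Src L l = Src L u" "l \<in> Arr L" "u \<in> Arr L" and G: "G \<subseteq> arrows_into L (Src L l)"
  shows "(x, c, y) \<in> bisection_diff L l u G \<longleftrightarrow> (x, c, y) \<in> bisection L l u \<and> x \<in> cylinder_diff L l G"
proof -
  have "composable l w" if "w \<in> G" for w
    using that G s by (auto simp: arrows_into_def composable_def)
  then have "(x, c, y) \<in> bisection L (l \<cdot> w) (u \<cdot> w) \<longleftrightarrow> x \<in> cylinder L (l \<cdot> w)"
    if "w \<in> G" "(x, c, y) \<in> bisection L l u" for w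
    using bisection_comp_iff(1)[OF s] that by blast
  moreover have "x \<in> cylinder L l" if "(x, c, y) \<in> bisection L l u"
    using that by (simp add: bisection_eq tail_nbhd_iff)
  ultimately show ?thesis
    unfolding bisection_diff_def cylinder_diff_def by blast
qed

lemma openin_bisection_diff:
  assumes "Src L l = Src L u" "l \<in> Arr L" "u \<in> Arr L" "finite G" "G \<subseteq> arrows_into L (Src L l)"
  shows "open_arrows L (bisection_diff L l u G)"
proof (cases "exhaustive L (Src L l) G")
  case True
  then have "bisection_diff L l u G = {}"
    using bisection_diff_iff[OF assms(1-3,5)] cylinder_diff_exhaustive[OF assms(2,4,5)] by auto
  then show ?thesis by simp
next
  case False
  then show ?thesis
    unfolding bp_groupoid_topology_def
    by (intro topology_generated_by_Basis CollectI exI[of _ l] exI[of _ u] exI[of _ G])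
      (use assms in simp)
qed

lemma openin_bisection:
  "open_arrows L (bisection L l u)" if "Src L l = Src L u" "l \<in> Arr L" "u \<in> Arr L"
  using openin_bisection_diff[OF that, of "{}"] by (simp add: bisection_diff_def)

lemma bisection_of_witness:
  assumes e: "shifts_eq L p x q y"
  defines "l \<equiv> path_map x (0, p)" and "u \<equiv> path_map y (0, q)"
  shows "l \<in> Arr L" "u \<in> Arr L" "Src L l = Src L u" "Deg L l = p" "Deg L u = q"
    "(x, int_vec p - int_vec q, y) \<in> bisection L l u"
proof -
  show *: "l \<in> Arr L" "u \<in> Arr L" "Deg L l = p" "Deg L u = q"
    using path_initial shifts_eq_ge[OF e] by (simp_all add: l_def u_def)
  show "Src L l = Src L u"
    using path_range_shift[OF shifts_eq_ge(1)[OF e]] path_range_shift[OF shifts_eq_ge(2)[OF e]]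
      shifts_eq_ge(3)[OF e] by (simp add: l_def u_def)
  show "(x, int_vec p - int_vec q, y) \<in> bisection L l u"
    using * e cylinder_initial[OF shifts_eq_ge(1)[OF e]] cylinder_initial[OF shifts_eq_ge(2)[OF e]]
    by (simp add: bisection_eq tail_nbhd_iff l_def u_def)
qed

lemma topspace_groupoid [simp]: "topspace (bp_groupoid_topology L) = arrows L"
proof
  show "topspace (bp_groupoid_topology L) \<subseteq> arrows L"
    unfolding bp_groupoid_topology_def topology_generated_by_topspace
    by (force simp: bisection_diff_def bisection_eq tail_nbhd_def groupoid_arr_iff)
  show "arrows L \<subseteq> topspace (bp_groupoid_topology L)"
  proof
    fix t assume "t \<in> arrows L"
    then obtain x y p q where "t = (x, int_vec p - int_vec q, y)" and e: "shifts_eq L p x q y"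
      by (rule groupoid_arrE)
    then show "t \<in> topspace (bp_groupoid_topology L)"
      using bisection_of_witness[OF e] openin_subset[OF openin_bisection] by blast
  qed
qed

lemma openin_preimage_range_source_cylinder:
  assumes v: "v \<in> Arr L"
  shows "open_arrows L {t \<in> arrows L. fst t \<in> cylinder L v}"
    "open_arrows L {t \<in> arrows L. fst t \<notin> cylinder L v}"
    "open_arrows L {t \<in> arrows L. snd (snd t) \<in> cylinder L v}"
    "open_arrows L {t \<in> arrows L. snd (snd t) \<notin> cylinder L v}"
proof -
  let ?T = "bp_groupoid_topology L"
  \<comment> \<open>On one bisection, membership of an endpoint in a cylinder is decided by finitely many smaller
    bisections.\<close>
  have decide: "openin ?T {t \<in> bisection L l u. P t}" "openin ?T {t \<in> bisection L l u. \<not> P t}"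
    if s: "Src L l = Src L u" "l \<in> Arr L" "u \<in> Arr L"
      and F: "finite F" "F \<subseteq> arrows_into L (Src L l)"
      and P: "\<And>x c y. (x, c, y) \<in> bisection L l u \<Longrightarrow>
        P (x, c, y) \<longleftrightarrow> (\<exists>w\<in>F. (x, c, y) \<in> bisection L (l \<cdot> w) (u \<cdot> w))" for l u F P
  proof -
    have P': "P t \<longleftrightarrow> (\<exists>w\<in>F. t \<in> bisection L (l \<cdot> w) (u \<cdot> w))" if "t \<in> bisection L l u" for t
      using P that by (metis prod.exhaust)
    have w: "composable l w \<and> composable u w" if "w \<in> F" for w
      using F s that by (auto simp: arrows_into_def composable_def)
    have "openin ?T (bisection L l u \<inter> (\<Union>w\<in>F. bisection L (l \<cdot> w) (u \<cdot> w)))"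
      using s w by (intro openin_Int openin_Union) (auto intro!: openin_bisection simp: src_comp comp_arr)
    moreover have "{t \<in> bisection L l u. P t} = bisection L l u \<inter> (\<Union>w\<in>F. bisection L (l \<cdot> w) (u \<cdot> w))"
      using P' by auto
    ultimately show "openin ?T {t \<in> bisection L l u. P t}" by simp
    have "{t \<in> bisection L l u. \<not> P t} = bisection_diff L l u F"
      using P' by (auto simp: bisection_diff_def)
    then show "openin ?T {t \<in> bisection L l u. \<not> P t}"
      using openin_bisection_diff[OF s F] by simp
  qed
  have global: "openin ?T {t \<in> arrows L. P t}"
    if P: "\<And>l u. Src L l = Src L u \<Longrightarrow> l \<in> Arr L \<Longrightarrow> u \<in> Arr L \<Longrightarrow> openin ?T {t \<in> bisection L l u. P t}" for P
  proof (subst openin_subopen, intro ballI)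
    fix t assume t: "t \<in> {t \<in> arrows L. P t}"
    then obtain x y p q where pq: "t = (x, int_vec p - int_vec q, y)" and e: "shifts_eq L p x q y"
      by (blast elim: groupoid_arrE)
    let ?l = "path_map x (0, p)" and ?u = "path_map y (0, q)"
    note b = bisection_of_witness[OF e]
    have "{t \<in> bisection L ?l ?u. P t} \<subseteq> {t \<in> arrows L. P t}"
      using openin_subset[OF openin_bisection[OF b(3,1,2)]] by auto
    moreover have "t \<in> {t \<in> bisection L ?l ?u. P t}"
      using t b(6) pq by simp
    ultimately show "\<exists>T. openin ?T T \<and> t \<in> T \<and> T \<subseteq> {t \<in> arrows L. P t}"
      using P[OF b(3,1,2)] by blast
  qed
  have ends: "openin ?T {t \<in> bisection L l u. E t \<in> cylinder L v}"
    "openin ?T {t \<in> bisection L l u. E t \<notin> cylinder L v}"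
    if E: "E = fst \<and> a = l \<or> E = (\<lambda>t. snd (snd t)) \<and> a = u"
      and s: "Src L l = Src L u" "l \<in> Arr L" "u \<in> Arr L" for E a l u
  proof -
    have a: "a \<in> Arr L" "Src L l = Src L a" using E s by auto
    define F where "F = fst ` Lambda_min L a v"
    have F: "finite F" "\<And>w. w \<in> F \<Longrightarrow> composable a w"
      using aligned a v Lambda_min_composable[OF _ a(1) v] by (auto simp: F_def finitely_aligned_def)
    then have l: "\<And>w. w \<in> F \<Longrightarrow> composable l w" and FG: "F \<subseteq> arrows_into L (Src L l)"
      using s a by (auto simp: arrows_into_def composable_def)
    have iff: "E (x, c, y) \<in> cylinder L v \<longleftrightarrow> (\<exists>w\<in>F. (x, c, y) \<in> bisection L (l \<cdot> w) (u \<cdot> w))"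
      if t: "(x, c, y) \<in> bisection L l u" for x c y
    proof -
      have "E (x, c, y) \<in> cylinder L a" using t E by (auto simp: bisection_eq tail_nbhd_iff)
      then have "E (x, c, y) \<in> cylinder L v \<longleftrightarrow> (\<exists>w\<in>F. E (x, c, y) \<in> cylinder L (a \<cdot> w))"
        using cylinder_Int[OF a(1) v, of "E (x, c, y)"] by (force simp: F_def)
      then show ?thesis
        using bisection_comp_iff[OF s l t] E by auto
    qed
    show "openin ?T {t \<in> bisection L l u. E t \<in> cylinder L v}"
      "openin ?T {t \<in> bisection L l u. E t \<notin> cylinder L v}"
      using decide[OF s F(1) FG iff] by simp_all
  qed
  note rng = ends[OF disjI1, OF conjI, OF refl refl]
    and src = ends[OF disjI2, OF conjI, OF refl refl]
  show "openin ?T {t \<in> arrows L. fst t \<in> cylinder L v}"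
    "openin ?T {t \<in> arrows L. fst t \<notin> cylinder L v}"
    "openin ?T {t \<in> arrows L. snd (snd t) \<in> cylinder L v}"
    "openin ?T {t \<in> arrows L. snd (snd t) \<notin> cylinder L v}"
    by (intro global rng src; assumption)+
qed

lemma groupoid_ends: "t \<in> arrows L \<Longrightarrow> fst t \<in> boundary_paths L"
  "t \<in> arrows L \<Longrightarrow> snd (snd t) \<in> boundary_paths L"
  by (auto simp: bp_groupoid_def)

lemma continuous_range: "continuous_map (bp_groupoid_topology L) (boundary_topology L) fst"
  using openin_preimage_range_source_cylinder
  by (intro continuous_map_into_boundary) (auto dest: groupoid_ends)

lemma continuous_source: "continuous_map (bp_groupoid_topology L) (boundary_topology L) (\<lambda>t. snd (snd t))"
  using openin_preimage_range_source_cylinder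
  by (intro continuous_map_into_boundary) (auto dest: groupoid_ends)

lemma openin_tail_nbhd:
  assumes U: "open_paths L U" and V: "open_paths L V"
  shows "open_arrows L (tail_nbhd p q U V)"
proof (subst openin_subopen, intro ballI)
  fix t assume "t \<in> tail_nbhd p q U V"
  then obtain x y where t: "t = (x, int_vec p - int_vec q, y)" "x \<in> U" "y \<in> V"
    and e: "shifts_eq L p x q y"
    by (auto simp: tail_nbhd_def)
  note b = bisection_of_witness[OF e]
  let ?B = "bisection L (path_map x (0, p)) (path_map y (0, q))"
  let ?R = "{t \<in> topspace (bp_groupoid_topology L). fst t \<in> U}"
  let ?S = "{t \<in> topspace (bp_groupoid_topology L). snd (snd t) \<in> V}"
  have "open_arrows L (?B \<inter> (?R \<inter> ?S))"
    by (intro openin_Int openin_bisection b(1-3) openin_continuous_map_preimage[OF continuous_range U]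
      openin_continuous_map_preimage[OF continuous_source V])
  moreover have "t \<in> ?B \<inter> (?R \<inter> ?S)"
    using t b(6) e by (auto simp: groupoid_arr_iff)
  moreover have "?B \<inter> (?R \<inter> ?S) \<subseteq> tail_nbhd p q U V"
    using b(4,5) by (auto simp: bisection_eq tail_nbhd_iff)
  ultimately show "\<exists>T. open_arrows L T \<and> t \<in> T \<and> T \<subseteq> tail_nbhd p q U V"
    by blast
qed

text \<open>
  The sets \<open>tail_nbhd p q U V\<close> form a neighbourhood base at each arrow, even with the witness
  \<open>(p, q)\<close> of the arrow prescribed. This reduces continuity of the homomorphisms below to
  continuity of maps between path spaces.
\<close>

lemma tail_nbhd_base:
  assumes W: "open_arrows L W" and t: "(x, int_vec p - int_vec q, y) \<in> W"
    and e: "shifts_eq L p x q y"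
  obtains U V where "open_paths L U" "x \<in> U" "open_paths L V" "y \<in> V"
    "tail_nbhd p q U V \<subseteq> W"
proof -
  have "\<exists>U V. open_paths L U \<and> x \<in> U \<and> open_paths L V \<and> y \<in> V \<and>
      tail_nbhd p q U V \<subseteq> W"
    using openin_topology_generated_by[OF W[unfolded bp_groupoid_topology_def]] t
  proof (induction rule: generate_topology_on.induct)
    case Empty
    then show ?case by simp
  next
    case (Int A B)
    obtain U V where "open_paths L U" "x \<in> U"
      "open_paths L V" "y \<in> V" "tail_nbhd p q U V \<subseteq> A"
      using Int.IH(1) Int.prems by blast
    moreover obtain U' V' where "open_paths L U'" "x \<in> U'"
      "open_paths L V'" "y \<in> V'" "tail_nbhd p q U' V' \<subseteq> B"
      using Int.IH(2) Int.prems by blast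
    moreover have "tail_nbhd p q (U \<inter> U') (V \<inter> V') = tail_nbhd p q U V \<inter> tail_nbhd p q U' V'"
      by (auto simp: tail_nbhd_def)
    ultimately show ?case
      by (intro exI[of _ "U \<inter> U'"] exI[of _ "V \<inter> V'"]) auto
  next
    case (UN K)
    then obtain k where k: "k \<in> K" "(x, int_vec p - int_vec q, y) \<in> k" by blast
    with UN.IH[OF k] show ?case by (meson Union_upper order_trans)
  next
    case (Basis S)
    then obtain l u G where S: "S = bisection_diff L l u G" "l \<in> Arr L" "u \<in> Arr L" "Src L l = Src L u"
      "finite G" "G \<subseteq> arrows_into L (Src L l)" by blast
    have "(x, int_vec p - int_vec q, y) \<in> bisection L l u" and xG: "x \<in> cylinder_diff L l G"
      using Basis.prems S bisection_diff_iff[OF S(4,2,3,6)] by auto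
    then have lu: "int_vec p - int_vec q = int_vec (Deg L l) - int_vec (Deg L u)" "x \<in> cylinder L l" "y \<in> cylinder L u"
      "shifts_eq L (Deg L l) x (Deg L u) y"
      by (simp_all add: bisection_eq tail_nbhd_iff)
    obtain U V where UV: "open_paths L U" "x \<in> U" "open_paths L V" "y \<in> V"
      "\<And>x' y'. x' \<in> U \<Longrightarrow> y' \<in> V \<Longrightarrow> shifts_eq L p x' q y' \<Longrightarrow>
         shifts_eq L (Deg L l) x' (Deg L u) y' \<longleftrightarrow> shifts_eq L (Deg L l) x (Deg L u) y"
      using shifts_eq_locally_equivalent[OF e shifts_eq_ge(1,2)[OF lu(4)] lu(1)[symmetric]] by blast
    have "tail_nbhd p q (U \<inter> cylinder_diff L l G) (V \<inter> cylinder L u) \<subseteq> S"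
    proof
      fix t assume "t \<in> tail_nbhd p q (U \<inter> cylinder_diff L l G) (V \<inter> cylinder L u)"
      then obtain x' y' where t: "t = (x', int_vec p - int_vec q, y')" "x' \<in> U" "x' \<in> cylinder_diff L l G"
        "y' \<in> V" "y' \<in> cylinder L u" "shifts_eq L p x' q y'"
        by (auto simp: tail_nbhd_def)
      then have "(x', int_vec p - int_vec q, y') \<in> bisection L l u"
        using UV(5) lu(1,4) by (auto simp: bisection_eq tail_nbhd_iff cylinder_diff_def)
      then show "t \<in> S"
        using t S bisection_diff_iff[OF S(4,2,3,6)] by simp
    qed
    then show ?case
      using UV xG lu(3) openin_cylinder_diff[OF S(2,5,6)] openin_cylinder[OF S(3)]
      by (intro exI[of _ "U \<inter> cylinder_diff L l G"] exI[of _ "V \<inter> cylinder L u"]) auto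
  qed
  then show ?thesis using that by blast
qed

text \<open>
  An arrow can fail to lie in a bisection because its lag, its range or its source is wrong, which
  persists nearby (for range and source because cylinders are closed), or because the degrees of the bisection are not
  a witness for it, which persists by \<open>shifts_eq_locally_equivalent\<close>.
\<close>

lemma openin_Compl_bisection:
  assumes s: "Src L l = Src L u" "l \<in> Arr L" "u \<in> Arr L"
  shows "open_arrows L (arrows L - bisection L l u)"
proof (subst openin_subopen, intro ballI)
  let ?X = "boundary_paths L"
  fix t assume t: "t \<in> arrows L - bisection L l u"
  then obtain x y p q where pq: "t = (x, int_vec p - int_vec q, y)" and e: "shifts_eq L p x q y"
    by (blast elim: groupoid_arrE)
  have X: "open_paths L ?X" "x \<in> ?X" "y \<in> ?X"
    using openin_topspace[of "boundary_topology L"] shifts_eq_boundary[OF e] by simp_all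
  have "\<exists>U V. open_paths L U \<and> x \<in> U \<and> open_paths L V \<and> y \<in> V \<and>
      tail_nbhd p q U V \<inter> bisection L l u = {}"
  proof (cases "int_vec p - int_vec q = int_vec (Deg L l) - int_vec (Deg L u) \<and> x \<in> cylinder L l \<and> y \<in> cylinder L u")
    case True
    then have "\<not> shifts_eq L (Deg L l) x (Deg L u) y"
      using t pq by (simp add: bisection_eq tail_nbhd_iff)
    moreover have "x \<in> boundary_paths_ge L (Deg L l)" "y \<in> boundary_paths_ge L (Deg L u)"
      using True s by (simp_all add: cylinder_iff)
    ultimately obtain U V where "open_paths L U" "x \<in> U" "open_paths L V" "y \<in> V"
      "\<And>x' y'. x' \<in> U \<Longrightarrow> y' \<in> V \<Longrightarrow> shifts_eq L p x' q y' \<Longrightarrow> \<not> shifts_eq L (Deg L l) x' (Deg L u) y'"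
      using shifts_eq_locally_equivalent[OF e, of "Deg L l" "Deg L u"] True by (metis (no_types, lifting))
    then show ?thesis
      by (intro exI[of _ U] exI[of _ V]) (auto simp: bisection_eq tail_nbhd_iff)
  next
    case False
    then consider "int_vec p - int_vec q \<noteq> int_vec (Deg L l) - int_vec (Deg L u)"
      | "x \<notin> cylinder L l" | "y \<notin> cylinder L u" by blast
    then show ?thesis
    proof cases
      case 1
      with X show ?thesis
        by (intro exI[of _ ?X]) (auto simp: bisection_eq tail_nbhd_iff)
    next
      case 2
      with X openin_Compl_cylinder[OF s(2)] show ?thesis
        by (intro exI[of _ "?X - cylinder L l"] exI[of _ ?X]) (auto simp: bisection_eq tail_nbhd_iff)
    next
      case 3
      with X openin_Compl_cylinder[OF s(3)] show ?thesis
        by (intro exI[of _ ?X] exI[of _ "?X - cylinder L u"]) (auto simp: bisection_eq tail_nbhd_iff)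
    qed
  qed
  then obtain U V where UV: "open_paths L U" "x \<in> U" "open_paths L V" "y \<in> V"
    "tail_nbhd p q U V \<inter> bisection L l u = {}" by blast
  have "t \<in> tail_nbhd p q U V" using pq UV e by (simp add: tail_nbhd_iff)
  moreover have "tail_nbhd p q U V \<subseteq> arrows L - bisection L l u"
    using UV(5) openin_subset[OF openin_tail_nbhd[OF UV(1,3)]] by auto
  ultimately show "\<exists>T. open_arrows L T \<and> t \<in> T \<and> T \<subseteq> arrows L - bisection L l u"
    using openin_tail_nbhd[OF UV(1,3)] by blast
qed

text \<open>
  A witness \<open>(p, q)\<close> of tail equivalence can be chosen continuously on the whole groupoid. The sets
  of arrows admitting a fixed witness need not be closed, since a path of small degree can be a
  limit of paths of large degree. The groupoid is, however, covered by countably many clopen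
  bisections, and one takes the degrees of the first bisection containing the arrow.
\<close>

lemma continuous_lag:
  obtains P Q where
    "continuous_map (bp_groupoid_topology L) (discrete_topology UNIV) P"
    "continuous_map (bp_groupoid_topology L) (discrete_topology UNIV) Q"
    "\<And>x c y. (x, c, y) \<in> arrows L \<Longrightarrow>
      shifts_eq L (P (x, c, y)) x (Q (x, c, y)) y \<and> c = int_vec (P (x, c, y)) - int_vec (Q (x, c, y))"
proof -
  let ?T = "bp_groupoid_topology L"
  define I where "I = {(l, u). l \<in> Arr L \<and> u \<in> Arr L \<and> Src L l = Src L u}"
  have "countable I"
    by (rule countable_subset[of _ "Arr L \<times> Arr L"]) (auto simp: I_def countable_arr)
  define b where "b = from_nat_into I"
  define B where "B n = bisection L (fst (b n)) (snd (b n))" for n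
  define N where "N t = (LEAST n. t \<in> B n)" for t
  have cover: "\<exists>n. t \<in> B n" and I: "I \<noteq> {}" if t: "t \<in> arrows L" for t
  proof -
    obtain x y p q where pq: "t = (x, int_vec p - int_vec q, y)" and e: "shifts_eq L p x q y"
    using t by (blast elim: groupoid_arrE)
    have i: "(path_map x (0, p), path_map y (0, q)) \<in> I"
      using bisection_of_witness[OF e] by (simp add: I_def)
    then show "I \<noteq> {}" by blast
    obtain n where "b n = (path_map x (0, p), path_map y (0, q))"
      using from_nat_into_surj[OF \<open>countable I\<close> i] by (auto simp: b_def)
    then show "\<exists>n. t \<in> B n"
      using bisection_of_witness(6)[OF e] pq by (auto simp: B_def intro!: exI[of _ n])
  qed
  have NB: "t \<in> B (N t)" if "t \<in> arrows L" for t
    unfolding N_def by (rule LeastI_ex) (rule cover[OF that])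
  have continuous: "continuous_map ?T (discrete_topology UNIV) (\<lambda>t. F (N t))" for F :: "nat \<Rightarrow> nat ^ 'k"
  proof (cases "arrows L = {}")
    case True
    then show ?thesis by (simp add: continuous_map_def)
  next
    case False
    then have bI: "b n \<in> I" for n
      using I from_nat_into[of I n] by (auto simp: b_def)
    have s: "Src L (fst (b n)) = Src L (snd (b n))" "fst (b n) \<in> Arr L" "snd (b n) \<in> Arr L" for n
      using bI[of n] by (auto simp: I_def)
    have "openin ?T {t \<in> arrows L. F (N t) \<in> S}" for S
    proof (subst openin_subopen, intro ballI)
      fix t assume t: "t \<in> {t \<in> arrows L. F (N t) \<in> S}"
      let ?W = "\<Inter>(insert (B (N t)) ((\<lambda>i. arrows L - B i) ` {..<N t}))"
      have "openin ?T ?W"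
        by (intro openin_Inter)
          (auto simp: B_def intro!: openin_bisection openin_Compl_bisection s)
      moreover have "t \<in> ?W"
      proof -
        have "t \<notin> B i" if "i < N t" for i
          using that not_less_Least[of i "\<lambda>n. t \<in> B n"] unfolding N_def by blast
        then show ?thesis using t NB by blast
      qed
      moreover have "?W \<subseteq> {t \<in> arrows L. F (N t) \<in> S}"
      proof
        fix t' assume t': "t' \<in> ?W"
        have "N t' = N t"
          unfolding N_def[of t']
        proof (rule Least_equality)
          show "t' \<in> B (N t)" using t' by blast
          show "N t \<le> n" if "t' \<in> B n" for n
            using t' that by (intro leI) blast
        qed
        moreover have "t' \<in> arrows L"
          using t' openin_subset[OF \<open>openin ?T ?W\<close>] by auto
        ultimately show "t' \<in> {t \<in> arrows L. F (N t) \<in> S}" using t by simp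
      qed
      ultimately show "\<exists>T. openin ?T T \<and> t \<in> T \<and> T \<subseteq> {t \<in> arrows L. F (N t) \<in> S}"
        by blast
    qed
    then show ?thesis by (simp add: continuous_map_def)
  qed
  have lag: "shifts_eq L (Deg L (fst (b (N (x, c, y))))) x (Deg L (snd (b (N (x, c, y))))) y \<and>
     c = int_vec (Deg L (fst (b (N (x, c, y))))) - int_vec (Deg L (snd (b (N (x, c, y)))))"
    if "(x, c, y) \<in> arrows L" for x c y
    using NB[OF that] by (simp add: B_def bisection_eq tail_nbhd_iff)
  show ?thesis
    by (rule that[OF continuous[of "\<lambda>n. Deg L (fst (b n))"] continuous[of "\<lambda>n. Deg L (snd (b n))"] lag])
qed

end

section \<open>Surjective endomorphisms of subgroups of a lattice\<close>

definition lattice_subgroup :: "(int ^ 'k::finite) set \<Rightarrow> bool" where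
  "lattice_subgroup A \<longleftrightarrow> 0 \<in> A \<and> (\<forall>a\<in>A. \<forall>b\<in>A. a + b \<in> A) \<and> (\<forall>a\<in>A. - a \<in> A)"

definition rat_vec :: "int ^ 'k \<Rightarrow> rat ^ 'k" where
  "rat_vec a = (\<chi> i. rat_of_int (a $ i))"

lemma rat_vec_inject [simp]: "rat_vec a = rat_vec b \<longleftrightarrow> a = b"
  by (simp add: rat_vec_def vec_eq_iff)

lemma rat_vec_zero [simp]: "rat_vec 0 = 0" "rat_vec a = 0 \<longleftrightarrow> a = 0"
  by (simp_all add: rat_vec_def vec_eq_iff)

lemma rat_vec_scale: "rat_vec (n *s a) = rat_of_int n *s rat_vec a"
  by (simp add: rat_vec_def vec_eq_iff)

lemma rat_vec_sum: "rat_vec (\<Sum>b\<in>B. f b) = (\<Sum>b\<in>B. rat_vec (f b :: int ^ 'k::finite))"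
proof (cases "finite B")
  case True
  then show ?thesis
    by induction (simp_all add: rat_vec_def vec_eq_iff)
qed simp

lemma common_denominator:
  fixes u :: "'b \<Rightarrow> rat"
  assumes "finite B"
  obtains N :: int and n :: "'b \<Rightarrow> int" where "N > 0" "\<And>b. b \<in> B \<Longrightarrow> of_int N * u b = of_int (n b)"
proof -
  from assms have "\<exists>N::int. N > 0 \<and> (\<forall>b\<in>B. \<exists>n::int. of_int N * u b = of_int n)"
  proof induction
    case empty
    show ?case by (intro exI[of _ 1]) simp
  next
    case (insert c B)
    then obtain N :: int where N: "N > 0" "\<forall>b\<in>B. \<exists>n::int. of_int N * u b = of_int n" by blast
    obtain p q where pq: "quotient_of (u c) = (p, q)" by (metis prod.exhaust)
    then have q: "q > 0" "u c = of_int p / of_int q"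
      using quotient_of_denom_pos quotient_of_div by blast+
    have "\<exists>n::int. of_int (q * N) * u b = of_int n" if "b \<in> insert c B" for b
    proof (cases "b = c")
      case True
      then have "of_int (q * N) * u b = of_int (N * p)" using q by simp
      then show ?thesis ..
    next
      case False
      then have "b \<in> B" using that by simp
      then obtain n :: int where n: "of_int N * u b = of_int n" using N(2) by auto
      have "of_int (q * N) * u b = of_int q * (of_int N * u b)" by (simp add: mult.assoc)
      also have "\<dots> = of_int (q * n)" unfolding n by simp
      finally show ?thesis ..
    qed
    then show ?case using N q by (intro exI[of _ "q * N"]) simp
  qed
  then show ?thesis using that by metis
qed

text \<open>
  A subgroup of \<open>\<int>\<^sup>k\<close> has finite rank, and a surjective endomorphism preserves the rank. So
  preimages of a rational basis form again a rational basis, and expressing an element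
  of the kernel in it, after clearing denominators, shows that the element vanishes.
\<close>

lemma surjective_endomorphism_injective:
  fixes A :: "(int ^ 'k::finite) set"
  assumes A: "lattice_subgroup A"
    and add: "\<And>a b. a \<in> A \<Longrightarrow> b \<in> A \<Longrightarrow> T (a + b) = T a + T b"
    and surj: "A \<subseteq> T ` A"
    and a: "a \<in> A" "T a = 0"
  shows "a = 0"
proof -
  have A0: "0 \<in> A" and Ap: "\<And>a b. a \<in> A \<Longrightarrow> b \<in> A \<Longrightarrow> a + b \<in> A" and Am: "\<And>a. a \<in> A \<Longrightarrow> - a \<in> A"
    using A by (auto simp: lattice_subgroup_def)
  have T0: "T 0 = 0" using add[OF A0 A0] by simp
  have Tm: "T (- a) = - T a" if "a \<in> A" for a
    using add[OF that Am[OF that]] T0 by (simp add: minus_unique)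
  have nat: "int n *s a \<in> A \<and> T (int n *s a) = int n *s T a" if "a \<in> A" for n a
  proof (induction n)
    case 0
    then show ?case using A0 T0 by simp
  next
    case (Suc n)
    have "int (Suc n) *s b = b + int n *s b" for b :: "int ^ 'k"
      by (simp add: vec_eq_iff algebra_simps)
    then show ?case using Suc that Ap add by simp
  qed
  have scale: "n *s a \<in> A" "T (n *s a) = n *s T a" if "a \<in> A" for n a
  proof -
    have "n *s a \<in> A \<and> T (n *s a) = n *s T a"
    proof (cases "n \<ge> 0")
      case True
      then show ?thesis using nat[OF that, of "nat n"] by simp
    next
      case False
      have "n *s b = - (int (nat (- n)) *s b)" for b :: "int ^ 'k"
        using False by (simp add: vec_eq_iff)
      then show ?thesis using nat[OF that, of "nat (- n)"] Am Tm by simp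
    qed
    then show "n *s a \<in> A" "T (n *s a) = n *s T a" by simp_all
  qed
  have sum: "sum f B \<in> A \<and> T (sum f B) = (\<Sum>b\<in>B. T (f b))" if "finite B" "\<And>b. b \<in> B \<Longrightarrow> f b \<in> A"
    for f :: "rat ^ 'k \<Rightarrow> int ^ 'k" and B
    using that by induction (simp_all add: A0 T0 Ap add)
  obtain B where B: "B \<subseteq> rat_vec ` A" "vec.independent B" "rat_vec ` A \<subseteq> vec.span B"
    using vec.maximal_independent_subset by metis
  have fB: "finite B" using B(2) by (rule vec.finiteI_independent)
  have "\<forall>b\<in>B. \<exists>c\<in>A. rat_vec (T c) = b" using B(1) surj by blast
  then obtain s where s: "\<And>b. b \<in> B \<Longrightarrow> s b \<in> A" "\<And>b. b \<in> B \<Longrightarrow> rat_vec (T (s b)) = b"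
    by metis
  have kernel: "n b = 0"
    if c: "c \<in> A" "T c = 0" "N *s c = (\<Sum>b\<in>B. n b *s s b)" and b: "b \<in> B" for c N n b
  proof -
    have "0 = T (N *s c)" using scale(2)[OF c(1)] c(2) by simp
    also have "\<dots> = (\<Sum>b\<in>B. n b *s T (s b))"
      using sum[OF fB, of "\<lambda>b. n b *s s b"] scale s(1) c(3) by simp
    finally have "rat_vec 0 = rat_vec (\<Sum>b\<in>B. n b *s T (s b))" by simp
    also have "\<dots> = (\<Sum>b\<in>B. rat_of_int (n b) *s b)"
      unfolding rat_vec_sum rat_vec_scale using s(2) by (intro sum.cong) auto
    finally have "(\<Sum>b\<in>B. rat_of_int (n b) *s b) = 0" by simp
    from vec.independentD[OF B(2) fB subset_refl this b] show ?thesis by simp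
  qed
  let ?r = "\<lambda>b. rat_vec (s b)"
  have inj: "inj_on ?r B"
    by (rule inj_onI) (metis s(2) rat_vec_inject)
  have integral: "\<exists>N n. N > 0 \<and> N *s c = (\<Sum>b\<in>B. n b *s s b) \<and> (\<forall>b\<in>B. rat_of_int N * u b = rat_of_int (n b))"
    if c: "rat_vec c = (\<Sum>b\<in>B. u b *s ?r b)" for c u
  proof -
    obtain N n where N: "N > 0" "\<And>b. b \<in> B \<Longrightarrow> of_int N * u b = rat_of_int (n b)"
      using common_denominator[OF fB, of u] by metis
    have "rat_vec (N *s c) = (\<Sum>b\<in>B. (of_int N * u b) *s ?r b)"
      unfolding rat_vec_scale c by (simp add: vec.scale_sum_right)
    also have "\<dots> = (\<Sum>b\<in>B. rat_vec (n b *s s b))"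
      using N(2) by (intro sum.cong) (auto simp: rat_vec_scale)
    finally have "N *s c = (\<Sum>b\<in>B. n b *s s b)"
      by (simp only: rat_vec_inject flip: rat_vec_sum)
    with N show ?thesis by blast
  qed
  have "vec.independent (?r ` B)"
  proof (rule vec.independent_if_scalars_zero)
    show "finite (?r ` B)" using fB by simp
    fix f x assume f: "(\<Sum>x\<in>?r ` B. f x *s x) = 0" and x: "x \<in> ?r ` B"
    have "rat_vec 0 = (\<Sum>b\<in>B. f (?r b) *s ?r b)"
      using f by (simp add: sum.reindex[OF inj])
    then obtain N n where N: "N > 0" "N *s 0 = (\<Sum>b\<in>B. n b *s s b)"
      "\<forall>b\<in>B. rat_of_int N * f (?r b) = rat_of_int (n b)"
      using integral[of 0 "\<lambda>b. f (?r b)"] by blast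
    obtain b where b: "b \<in> B" "x = ?r b" using x by blast
    then have "n b = 0" using kernel[OF A0 T0 N(2)] by blast
    then show "f x = 0" using N b by force
  qed
  moreover have "?r ` B \<subseteq> vec.span B" using B(3) s(1) by blast
  moreover have "vec.dim (vec.span B) \<le> card (?r ` B)"
    using card_image[OF inj] by (simp add: vec.dim_eq_card_independent[OF B(2)])
  ultimately have "vec.span B \<subseteq> vec.span (?r ` B)"
    using vec.card_ge_dim_independent by blast
  then have "rat_vec a \<in> vec.span (?r ` B)" using a(1) B(3) by blast
  then obtain v where "rat_vec a = (\<Sum>x\<in>?r ` B. v x *s x)"
    using vec.span_finite[of "?r ` B"] fB by auto
  then have "rat_vec a = (\<Sum>b\<in>B. v (?r b) *s ?r b)"
    by (simp add: sum.reindex[OF inj])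
  then obtain N n where N: "N > 0" "N *s a = (\<Sum>b\<in>B. n b *s s b)"
    using integral[of a "\<lambda>b. v (?r b)"] by blast
  then have "N *s a = 0"
    using kernel[OF a N(2)] by simp
  with \<open>N > 0\<close> show "a = 0" by (simp add: vec_eq_iff)
qed


section \<open>Local structure of the groupoid and gradings\<close>

context fa_kgraph
begin

text \<open>
  The range map is a local homeomorphism: near an arrow with witness \<open>(p, q)\<close> its image is described
  by the continuous open maps \<open>\<sigma>\<^sup>p\<close> and \<open>\<sigma>\<^sup>q\<close>, and on a bisection the source is determined by the
  range.
\<close>

lemma openin_range_image:
  assumes W: "open_arrows L W"
  shows "open_paths L (fst ` W)"
proof (subst openin_subopen, intro ballI)
  fix x assume "x \<in> fst ` W"
  then obtain c y where t: "(x, c, y) \<in> W" by force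
  then have "(x, c, y) \<in> arrows L" using openin_subset[OF W] by auto
  then obtain p q where pq: "c = int_vec p - int_vec q" and e: "shifts_eq L p x q y"
    using groupoid_arr_iff by auto
  obtain U V where UV: "open_paths L U" "x \<in> U" "open_paths L V" "y \<in> V"
    "tail_nbhd p q U V \<subseteq> W"
    using tail_nbhd_base[OF W _ e] t pq by metis
  let ?O = "U \<inter> {x \<in> boundary_paths_ge L p. shift p x \<in> shift q ` (V \<inter> boundary_paths_ge L q)}"
  have "open_paths L ?O"
    by (intro openin_Int UV openin_preimage_shift openin_image_shift)
  moreover have "x \<in> ?O" using UV shifts_eq_ge[OF e] by auto
  moreover have "?O \<subseteq> fst ` W"
  proof
    fix x' assume "x' \<in> ?O"
    then obtain y' where "x' \<in> U" "y' \<in> V" "shifts_eq L p x' q y'" by (auto simp: shifts_eq_def)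
    then have "(x', int_vec p - int_vec q, y') \<in> W" using UV(5) by (auto simp: tail_nbhd_iff)
    then show "x' \<in> fst ` W" by force
  qed
  ultimately show "\<exists>T. open_paths L T \<and> x \<in> T \<and> T \<subseteq> fst ` W" by blast
qed

lemma range_locally_injective:
  assumes t: "t \<in> arrows L"
  obtains B where "open_arrows L B" "t \<in> B" "inj_on fst B"
proof -
  obtain x y p q where pq: "t = (x, int_vec p - int_vec q, y)" and e: "shifts_eq L p x q y"
  using t by (blast elim: groupoid_arrE)
  note b = bisection_of_witness[OF e]
  let ?B = "bisection L (path_map x (0, p)) (path_map y (0, q))"
  have "inj_on fst ?B"
  proof (rule inj_onI)
    fix t1 t2 assume t: "t1 \<in> ?B" "t2 \<in> ?B" "fst t1 = fst t2"
    then obtain x' y1 y2 where t12: "t1 = (x', int_vec p - int_vec q, y1)" "t2 = (x', int_vec p - int_vec q, y2)"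
      "y1 \<in> cylinder L (path_map y (0, q))" "y2 \<in> cylinder L (path_map y (0, q))"
      "shifts_eq L p x' q y1" "shifts_eq L p x' q y2"
      unfolding bisection_eq b(4,5) by (auto simp: tail_nbhd_def)
    have y: "y1 \<in> boundary_paths_ge L q" "y2 \<in> boundary_paths_ge L q"
      "path_map y1 (0, q) = path_map y2 (0, q)"
      using t12(3,4) unfolding cylinder_iff[OF b(2)] b(5) by simp_all
    have "shift q y1 = shift q y2"
      using shifts_eq_ge(3)[OF t12(5)] shifts_eq_ge(3)[OF t12(6)] by simp
    with y have "y1 = y2" by (rule path_eq_if_head_tail_eq)
    then show "t1 = t2" using t12 by simp
  qed
  then show ?thesis
    using that openin_bisection[OF b(3,1,2)] b(6) pq by blast
qed

lemma functor_group:
  assumes "cat_functor L (group_category \<Gamma>) \<eta>"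
  shows "a \<in> Arr L \<Longrightarrow> \<eta> a \<in> carrier \<Gamma>" "composable a b \<Longrightarrow> \<eta> (a \<cdot> b) = \<eta> a \<otimes>\<^bsub>\<Gamma>\<^esub> \<eta> b"
  using assms by (auto simp: cat_functor_def group_category_def composable_def)

lemma functor_initial_add:
  assumes \<eta>: "cat_functor L (group_category \<Gamma>) \<eta>" and x: "x \<in> boundary_paths_ge L (m + n)"
  shows "\<eta> (path_map x (0, m + n)) = \<eta> (path_map x (0, m)) \<otimes>\<^bsub>\<Gamma>\<^esub> \<eta> (path_map (shift m x) (0, n))"
proof -
  have X: "functor_path x" "enat_vec (m + n) \<le> path_deg x"
    using x by (simp_all add: boundary_paths_ge_iff functor_pathI)
  have "path_map (shift m x) (0, n) = path_map x (m, m + n)"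
    using X by (simp add: path_map_shift add.commute)
  then show ?thesis
    using functor_group(2)[OF \<eta>] path_comp[OF X(1) _ _ X(2), of 0 m] by (metis vec_le_add(1) vec_zero_le)
qed

text \<open>
  Two witnesses of the same arrow have a common enlargement, and enlarging a witness multiplies both
  group elements on the right by the same factor.
\<close>

lemma grading_witness_independent:
  assumes \<Gamma>: "group \<Gamma>" and \<eta>: "cat_functor L (group_category \<Gamma>) \<eta>"
    and e: "shifts_eq L p x q y" and e': "shifts_eq L p' x q' y"
    and lag: "int_vec p - int_vec q = int_vec p' - int_vec q'"
  shows "\<eta> (path_map x (0, p)) \<otimes>\<^bsub>\<Gamma>\<^esub> inv\<^bsub>\<Gamma>\<^esub> \<eta> (path_map y (0, q)) =
    \<eta> (path_map x (0, p')) \<otimes>\<^bsub>\<Gamma>\<^esub> inv\<^bsub>\<Gamma>\<^esub> \<eta> (path_map y (0, q'))"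
proof -
  interpret group \<Gamma> by fact
  have carrier: "\<eta> (path_map z (0, n)) \<in> carrier \<Gamma>" if "z \<in> boundary_paths_ge L n" for z n
    using functor_group(1)[OF \<eta>] path_initial[OF that] by blast
  have extend: "\<eta> (path_map x (0, p)) \<otimes>\<^bsub>\<Gamma>\<^esub> inv\<^bsub>\<Gamma>\<^esub> \<eta> (path_map y (0, q)) =
      \<eta> (path_map x (0, p + a)) \<otimes>\<^bsub>\<Gamma>\<^esub> inv\<^bsub>\<Gamma>\<^esub> \<eta> (path_map y (0, q + a))"
    if e: "shifts_eq L p x q y" and x: "x \<in> boundary_paths_ge L (p + a)" for p q a
  proof -
    have y: "y \<in> boundary_paths_ge L (q + a)" using shifts_eq_ge(2)[OF shifts_eq_add[OF e x]] .
    let ?w = "\<eta> (path_map (shift p x) (0, a))"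
    have "\<eta> (path_map x (0, p)) \<in> carrier \<Gamma>" "\<eta> (path_map y (0, q)) \<in> carrier \<Gamma>" "?w \<in> carrier \<Gamma>"
      using carrier shifts_eq_ge[OF e] x boundary_paths_ge_add by blast+
    moreover have "\<eta> (path_map x (0, p + a)) = \<eta> (path_map x (0, p)) \<otimes>\<^bsub>\<Gamma>\<^esub> ?w"
      "\<eta> (path_map y (0, q + a)) = \<eta> (path_map y (0, q)) \<otimes>\<^bsub>\<Gamma>\<^esub> ?w"
      using functor_initial_add[OF \<eta> x] functor_initial_add[OF \<eta> y] shifts_eq_ge(3)[OF e] by simp_all
    ultimately show ?thesis
      by (simp add: inv_mult_group m_assoc) (simp add: m_assoc[symmetric])
  qed
  obtain a a' where a: "p + a = p' + a'" "x \<in> boundary_paths_ge L (p + a)"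
    using common_shift[OF shifts_eq_ge(1)[OF e] shifts_eq_ge(1)[OF e']] .
  have "q + a = q' + a'" using a(1) lag by (rule equal_lags_raise)
  then show ?thesis using extend[OF e a(2)] extend[OF e', of a'] a by simp
qed

lemma grading_cocycle_eq:
  assumes \<Gamma>: "group \<Gamma>" and \<eta>: "cat_functor L (group_category \<Gamma>) \<eta>" and e: "shifts_eq L p x q y"
  shows "grading_cocycle \<Gamma> L \<eta> (x, int_vec p - int_vec q, y) =
    \<eta> (path_map x (0, p)) \<otimes>\<^bsub>\<Gamma>\<^esub> inv\<^bsub>\<Gamma>\<^esub> \<eta> (path_map y (0, q))"
  unfolding grading_cocycle_def
proof (rule the_equality)
  let ?P = "\<lambda>c. \<exists>u\<in>Arr L. \<exists>w\<in>Arr L. \<exists>z\<in>boundary_paths L.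
     path_range z = Src L u \<and> path_range z = Src L w \<and>
     (x, int_vec p - int_vec q, y) = (prepend L u z, int_vec (Deg L u) - int_vec (Deg L w), prepend L w z) \<and>
     c = \<eta> u \<otimes>\<^bsub>\<Gamma>\<^esub> inv\<^bsub>\<Gamma>\<^esub> \<eta> w"
  let ?l = "path_map x (0, p)" and ?u = "path_map y (0, q)"
  have xy: "x \<in> boundary_paths_ge L p" "y \<in> boundary_paths_ge L q" "shift p x = shift q y"
    using shifts_eq_ge[OF e] by simp_all
  have z: "shift p x \<in> boundary_paths L" "path_range (shift p x) = Src L ?l" "path_range (shift p x) = Src L ?u"
    using shift_boundary[OF xy(1)] path_range_shift[OF xy(1)] path_range_shift[OF xy(2)] xy(3) by simp_all
  have "(x, int_vec p - int_vec q, y) = (prepend L ?l (shift p x), int_vec (Deg L ?l) - int_vec (Deg L ?u),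
      prepend L ?u (shift p x))"
    using prepend_head_tail[OF xy(1)] prepend_head_tail[OF xy(2)] xy path_initial by simp
  then show "?P (\<eta> ?l \<otimes>\<^bsub>\<Gamma>\<^esub> inv\<^bsub>\<Gamma>\<^esub> \<eta> ?u)"
    using z path_initial[OF xy(1)] path_initial[OF xy(2)] by blast
  fix c assume "?P c"
  then obtain u w z where u: "u \<in> Arr L" "w \<in> Arr L" "z \<in> boundary_paths L" "path_range z = Src L u"
    "path_range z = Src L w" "x = prepend L u z" "y = prepend L w z"
    "int_vec p - int_vec q = int_vec (Deg L u) - int_vec (Deg L w)"
    "c = \<eta> u \<otimes>\<^bsub>\<Gamma>\<^esub> inv\<^bsub>\<Gamma>\<^esub> \<eta> w"
    by auto
  note pu = prepend[OF u(1,3,4)] and pw = prepend[OF u(2,3,5)]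
  have "shifts_eq L (Deg L u) x (Deg L w) y"
    using pu pw u(6,7) by (simp add: shifts_eq_def)
  from grading_witness_independent[OF \<Gamma> \<eta> this e] show "c = \<eta> (path_map x (0, p)) \<otimes>\<^bsub>\<Gamma>\<^esub> inv\<^bsub>\<Gamma>\<^esub> \<eta> (path_map y (0, q))"
    using u pu pw by simp
qed


section \<open>Orbits and periods\<close>

lemma orbit_eq: "orbit L x = {y. \<exists>m n. shifts_eq L m x n y}" if "x \<in> boundary_paths L"
  using that by (auto simp: orbit_def shifts_eq_def boundary_paths_ge_iff; metis)

lemma IP_pairs_shifts_eq: "(m, n) \<in> IP_pairs L x \<Longrightarrow> shifts_eq L m x n x"
  by (auto simp: IP_pairs_def)

lemma IP_subset_Per: "IP L x \<subseteq> Per L x"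
  unfolding IP_def Per_def using IP_pairs_shifts_eq by blast

lemma groupoid_isotropy_iff: "(x, c, x) \<in> arrows L \<longleftrightarrow> c \<in> Per L x"
  by (auto simp: groupoid_arr_iff Per_def)

text \<open>
  Composition of arrows in terms of witnesses: both middle witnesses are raised to their maximum.
  The resulting witnesses depend only on the given ones, so the construction is uniform in the
  paths.
\<close>

lemma shifts_eq_compose:
  fixes p q p' q' :: "nat ^ 'k"
  defines "a \<equiv> vec_max q p' - q" and "b \<equiv> vec_max q p' - p'"
  shows "shifts_eq L p x q y \<Longrightarrow> shifts_eq L p' y q' z \<Longrightarrow> shifts_eq L (p + a) x (q' + b) z"
    and "int_vec (p + a) - int_vec (q' + b) = (int_vec p - int_vec q) + (int_vec p' - int_vec q')"
proof -
  have ab: "q + a = vec_max q p'" "p' + b = vec_max q p'"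
    by (simp_all add: a_def b_def vec_plus_minus)
  then have "int_vec q + int_vec a = int_vec p' + int_vec b" by (metis int_vec_add)
  then show "int_vec (p + a) - int_vec (q' + b) = (int_vec p - int_vec q) + (int_vec p' - int_vec q')"
    by (simp add: algebra_simps)
  assume e: "shifts_eq L p x q y" "shifts_eq L p' y q' z"
  have "y \<in> boundary_paths_ge L (vec_max q p')"
    using shifts_eq_ge(2)[OF e(1)] shifts_eq_ge(1)[OF e(2)] by (simp add: boundary_paths_ge_max)
  then have "shifts_eq L (q + a) y (p + a) x" "shifts_eq L (p' + b) y (q' + b) z"
    using shifts_eq_add[OF shifts_eq_sym[OF e(1)], of a] shifts_eq_add[OF e(2), of b]
    unfolding ab by blast+
  then show "shifts_eq L (p + a) x (q' + b) z"
    using ab shifts_eq_sym shifts_eq_trans by metis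
qed

lemma Per_subgroup: "lattice_subgroup (Per L x)" if "x \<in> boundary_paths L"
  unfolding lattice_subgroup_def
proof (intro conjI ballI)
  show "0 \<in> Per L x"
    using that shifts_eq_refl[of x 0] by (force simp: Per_def)
  fix c assume "c \<in> Per L x"
  then obtain m n where c: "c = int_vec m - int_vec n" "shifts_eq L m x n x" by (auto simp: Per_def)
  then show "- c \<in> Per L x"
    using shifts_eq_sym[OF c(2)] by (force simp: Per_def)
  fix d assume "d \<in> Per L x"
  then obtain m' n' where d: "d = int_vec m' - int_vec n'" "shifts_eq L m' x n' x" by (auto simp: Per_def)
  show "c + d \<in> Per L x"
    unfolding Per_def c(1) d(1) shifts_eq_compose(2)[symmetric]
    using shifts_eq_compose(1)[OF c(2) d(2)] by blast
qed

lemma IP_subgroup: "lattice_subgroup (IP L x)" if "x \<in> boundary_paths L"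
  unfolding lattice_subgroup_def
proof (intro conjI ballI)
  have "(0, 0) \<in> IP_pairs L x"
    using that openin_topspace[of "boundary_topology L"] shifts_eq_refl[of _ 0]
    by (auto simp: IP_pairs_def)
  then show "0 \<in> IP L x"
    by (force simp: IP_def)
  fix c assume "c \<in> IP L x"
  then obtain m n U where c: "c = int_vec m - int_vec n" and
    U: "open_paths L U" "x \<in> U" "\<And>y. y \<in> U \<Longrightarrow> shifts_eq L m y n y"
    by (auto simp: IP_def IP_pairs_def)
  have "(n, m) \<in> IP_pairs L x"
    using U shifts_eq_sym by (auto simp: IP_pairs_def)
  then show "- c \<in> IP L x"
    using c by (force simp: IP_def)
  fix d assume "d \<in> IP L x"
  then obtain m' n' V where d: "d = int_vec m' - int_vec n'" and
    V: "open_paths L V" "x \<in> V" "\<And>y. y \<in> V \<Longrightarrow> shifts_eq L m' y n' y"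
    by (auto simp: IP_def IP_pairs_def)
  have "\<forall>y\<in>U \<inter> V. shifts_eq L (m + (vec_max n m' - n)) y (n' + (vec_max n m' - m')) y"
    using shifts_eq_compose(1) U(3) V(3) by blast
  then have "(m + (vec_max n m' - n), n' + (vec_max n m' - m')) \<in> IP_pairs L x"
    using U V by (auto simp: IP_pairs_def)
  then show "c + d \<in> IP L x"
    unfolding IP_def c d shifts_eq_compose(2)[symmetric] by blast
qed

end

section \<open>The groupoid homomorphism induced by a family of cocycles\<close>

context fa_kgraph
begin

lemma groupoid_unit: "x \<in> boundary_paths L \<Longrightarrow> (x, 0, x) \<in> arrows L"
  using shifts_eq_refl[of x 0] by (force simp: groupoid_arr_iff)

lemma groupoid_comp:
  assumes "(x, c, y) \<in> arrows L" "(y, d, z) \<in> arrows L"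
  shows "(x, c + d, z) \<in> arrows L"
proof -
  obtain p q where c: "c = int_vec p - int_vec q" and e: "shifts_eq L p x q y"
    using assms(1) groupoid_arr_iff by blast
  obtain p' q' where d: "d = int_vec p' - int_vec q'" and e': "shifts_eq L p' y q' z"
    using assms(2) groupoid_arr_iff by blast
  show ?thesis
    unfolding c d shifts_eq_compose(2)[symmetric] groupoid_arr_iff
    using shifts_eq_compose(1)[OF e e'] by blast
qed

lemma groupoid_inverse: "(y, - c, x) \<in> arrows L" if t: "(x, c, y) \<in> arrows L"
proof -
  obtain p q where c: "c = int_vec p - int_vec q" and e: "shifts_eq L p x q y"
    using t groupoid_arr_iff by blast
  then have "- c = int_vec q - int_vec p" by simp
  then show ?thesis using shifts_eq_sym[OF e] groupoid_arr_iff by blast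
qed

lemma groupoid_category: "small_category (bp_groupoid L)"
proof -
  have R: "Rng (bp_groupoid L) (x, c, y) = (x, 0, x)" "Src (bp_groupoid L) (x, c, y) = (y, 0, y)"
    "Comp (bp_groupoid L) (x, c, y) (y', d, z) = (x, c + d, z)" for x y y' z c d
    by (simp_all add: bp_groupoid_def)
  have "x \<in> boundary_paths L" "y \<in> boundary_paths L" if "(x, c, y) \<in> arrows L" for x y c
    using groupoid_ends[OF that] by simp_all
  then show ?thesis
    unfolding small_category_def
    by (auto simp: R groupoid_unit add.assoc intro: groupoid_comp)
qed

end

locale two_graphs = A: fa_kgraph L1 + B: fa_kgraph L2
  for L1 :: "('a, 'k1::finite) kgraph" and L2 :: "('b, 'k2::finite) kgraph" +
  fixes h :: "('a, 'k1) path \<Rightarrow> ('b, 'k2) path"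
  assumes homeo: "homeomorphic_map (boundary_topology L1) (boundary_topology L2) h"
begin

lemma h_image: "h ` boundary_paths L1 = boundary_paths L2"
  using homeomorphic_imp_surjective_map[OF homeo] by simp

lemma h_boundary: "x \<in> boundary_paths L1 \<Longrightarrow> h x \<in> boundary_paths L2"
  using h_image by blast

lemma h_inj: "inj_on h (boundary_paths L1)"
  using homeomorphic_imp_injective_map[OF homeo] by simp

lemma h_open: "open_paths L1 U \<Longrightarrow> open_paths L2 (h ` U)"
  using homeomorphic_imp_open_map[OF homeo] by (simp add: open_map_def)

lemma h_preimage: "open_paths L2 V \<Longrightarrow>
    open_paths L1 {x \<in> boundary_paths L1. h x \<in> V}"
  using openin_continuous_map_preimage[OF homeomorphic_imp_continuous_map[OF homeo]] by simp

abbreviation h_inv where "h_inv \<equiv> boundary_inverse L1 h"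

lemma h_inv_h [simp]: "x \<in> boundary_paths L1 \<Longrightarrow> h_inv (h x) = x"
  by (simp add: boundary_inverse_def inv_into_f_f[OF h_inj])

lemma h_h_inv [simp]: "y \<in> boundary_paths L2 \<Longrightarrow> h (h_inv y) = y"
  by (simp add: boundary_inverse_def f_inv_into_f h_image)

lemma h_inv_boundary: "y \<in> boundary_paths L2 \<Longrightarrow> h_inv y \<in> boundary_paths L1"
  by (simp add: boundary_inverse_def inv_into_into h_image)

lemma homeo_inv: "homeomorphic_map (boundary_topology L2) (boundary_topology L1) h_inv"
proof -
  obtain k where k: "homeomorphic_maps (boundary_topology L1) (boundary_topology L2) h k"
    using homeo homeomorphic_map_maps by blast
  then have inv: "k (h x) = x" if "x \<in> boundary_paths L1" for x
    using that by (simp add: homeomorphic_maps_def)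
  have "homeomorphic_map (boundary_topology L2) (boundary_topology L1) k"
    using k homeomorphic_maps_sym homeomorphic_map_maps by blast
  moreover have "k y = h_inv y" if "y \<in> topspace (boundary_topology L2)" for y
    using inv[of "h_inv y"] that h_inv_boundary by simp
  ultimately show ?thesis
    by (rule homeomorphic_map_eq)
qed

end

locale half_family = two_graphs L1 L2 h
  for L1 :: "('a, 'k1::finite) kgraph" and L2 :: "('b, 'k2::finite) kgraph"
    and h :: "('a, 'k1) path \<Rightarrow> ('b, 'k2) path" +
  fixes f g :: "nat ^ 'k1 \<Rightarrow> ('a, 'k1) path \<Rightarrow> nat ^ 'k2"
  assumes family: "half_cocycle_family L1 L2 h f g"
begin

text \<open>The lag of the image of the arrow \<open>(x, m, \<sigma>\<^sup>m(x))\<close>.\<close>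

definition \<kappa> :: "nat ^ 'k1 \<Rightarrow> ('a, 'k1) path \<Rightarrow> int ^ 'k2" where
  "\<kappa> m x = int_vec (g m x) - int_vec (f m x)"

lemma family_shifts_eq:
  "x \<in> boundary_paths_ge L1 m \<Longrightarrow> shifts_eq L2 (f m x) (h (shift m x)) (g m x) (h x)"
  using family by (simp add: half_cocycle_family_def)

lemma \<kappa>_add: "x \<in> boundary_paths_ge L1 (m + n) \<Longrightarrow> \<kappa> (m + n) x = \<kappa> m x + \<kappa> n (shift m x)"
  using family by (simp add: half_cocycle_family_def \<kappa>_def)

lemma family_locally_constant:
  assumes x: "x \<in> boundary_paths_ge L1 m"
  obtains U where "open_paths L1 U" "x \<in> U"
    "\<And>x'. x' \<in> U \<Longrightarrow> f m x' = f m x \<and> g m x' = g m x"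
proof -
  let ?Y = "subtopology (boundary_topology L1) (boundary_paths_ge L1 m)"
  have Y: "topspace ?Y = boundary_paths_ge L1 m"
    by (auto simp: A.boundary_paths_ge_iff)
  have cont: "continuous_map ?Y (discrete_topology UNIV) (f m)" "continuous_map ?Y (discrete_topology UNIV) (g m)"
    using family by (simp_all add: half_cocycle_family_def)
  have "openin ?Y ({x' \<in> topspace ?Y. f m x' \<in> {f m x}} \<inter> {x' \<in> topspace ?Y. g m x' \<in> {g m x}})"
    by (intro openin_Int openin_continuous_map_preimage[OF cont(1)] openin_continuous_map_preimage[OF cont(2)]) simp_all
  then have "open_paths L1 {x' \<in> boundary_paths_ge L1 m. f m x' = f m x \<and> g m x' = g m x}"
    unfolding Y openin_open_subtopology[OF A.openin_boundary_paths_ge]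
    by (auto simp: Int_def conj_ac elim!: back_subst[of "open_paths L1"])
  then show ?thesis
    by (rule that) (use x in auto)
qed

text \<open>
  If \<open>\<sigma>\<^sup>m(x) = \<sigma>\<^sup>n(y) = w\<close> then \<open>h x\<close> and \<open>h y\<close> are both tail equivalent to \<open>h w\<close>; these are the
  witnesses of the resulting tail equivalence of \<open>h x\<close> and \<open>h y\<close>.
\<close>

definition left_witness where
  "left_witness m x n y = g m x + (vec_max (f m x) (f n y) - f m x)"

definition right_witness where
  "right_witness m x n y = g n y + (vec_max (f m x) (f n y) - f n y)"

lemma transfer:
  assumes e: "shifts_eq L1 m x n y"
  shows "shifts_eq L2 (left_witness m x n y) (h x) (right_witness m x n y) (h y)"
    and "int_vec (left_witness m x n y) - int_vec (right_witness m x n y) = \<kappa> m x - \<kappa> n y"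
proof -
  note xy = A.shifts_eq_ge[OF e]
  have "shifts_eq L2 (g m x) (h x) (f m x) (h (shift m x))" "shifts_eq L2 (f n y) (h (shift m x)) (g n y) (h y)"
    using family_shifts_eq[OF xy(1)] family_shifts_eq[OF xy(2)] xy(3) B.shifts_eq_sym by simp_all
  then show "shifts_eq L2 (left_witness m x n y) (h x) (right_witness m x n y) (h y)"
    unfolding left_witness_def right_witness_def by (rule B.shifts_eq_compose(1))
  show "int_vec (left_witness m x n y) - int_vec (right_witness m x n y) = \<kappa> m x - \<kappa> n y"
    unfolding left_witness_def right_witness_def B.shifts_eq_compose(2) \<kappa>_def by simp
qed

lemma transfer_locally:
  assumes e: "shifts_eq L1 m x n y"
  obtains p q U V where "open_paths L1 U" "x \<in> U" "open_paths L1 V" "y \<in> V"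
    "int_vec p - int_vec q = \<kappa> m x - \<kappa> n y"
    "\<forall>x'\<in>U. \<forall>y'\<in>V. shifts_eq L1 m x' n y' \<longrightarrow>
        shifts_eq L2 p (h x') q (h y') \<and> \<kappa> m x' - \<kappa> n y' = int_vec p - int_vec q"
proof -
  obtain U where U: "open_paths L1 U" "x \<in> U"
    "\<And>x'. x' \<in> U \<Longrightarrow> f m x' = f m x \<and> g m x' = g m x"
    using family_locally_constant[OF A.shifts_eq_ge(1)[OF e]] by blast
  obtain V where V: "open_paths L1 V" "y \<in> V"
    "\<And>y'. y' \<in> V \<Longrightarrow> f n y' = f n y \<and> g n y' = g n y"
    using family_locally_constant[OF A.shifts_eq_ge(2)[OF e]] by blast
  let ?p = "left_witness m x n y" and ?q = "right_witness m x n y"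
  have "shifts_eq L2 ?p (h x') ?q (h y') \<and> \<kappa> m x' - \<kappa> n y' = int_vec ?p - int_vec ?q"
    if "x' \<in> U" "y' \<in> V" "shifts_eq L1 m x' n y'" for x' y'
    using transfer[OF that(3)] U(3)[OF that(1)] V(3)[OF that(2)]
    by (simp add: left_witness_def right_witness_def)
  then have "\<forall>x'\<in>U. \<forall>y'\<in>V. shifts_eq L1 m x' n y' \<longrightarrow>
      shifts_eq L2 ?p (h x') ?q (h y') \<and> \<kappa> m x' - \<kappa> n y' = int_vec ?p - int_vec ?q"
    by blast
  then show ?thesis by (rule that[OF U(1,2) V(1,2) transfer(2)[OF e]])
qed

text \<open>
  By additivity of \<open>\<kappa>\<close>, raising both components of a witness by \<open>a\<close> adds \<open>\<kappa> a\<close> of the common tail to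
  both terms of the difference.
\<close>

lemma \<kappa>_diff_well_defined:
  assumes e: "shifts_eq L1 m x n y" and e': "shifts_eq L1 m' x n' y"
    and lag: "int_vec m - int_vec n = int_vec m' - int_vec n'"
  shows "\<kappa> m x - \<kappa> n y = \<kappa> m' x - \<kappa> n' y"
proof -
  have raise: "\<kappa> m x - \<kappa> n y = \<kappa> (m + a) x - \<kappa> (n + a) y"
    if e: "shifts_eq L1 m x n y" and x: "x \<in> boundary_paths_ge L1 (m + a)" for m n a
    using \<kappa>_add[OF x] \<kappa>_add[OF A.shifts_eq_ge(2)[OF A.shifts_eq_add[OF e x]]] A.shifts_eq_ge(3)[OF e] by simp
  obtain a a' where a: "m + a = m' + a'" "x \<in> boundary_paths_ge L1 (m + a)"
    using A.common_shift[OF A.shifts_eq_ge(1)[OF e] A.shifts_eq_ge(1)[OF e']] .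
  have "n + a = n' + a'" using a(1) lag by (rule equal_lags_raise)
  then show ?thesis using raise[OF e a(2)] raise[OF e', of a'] a by simp
qed

definition lag :: "('a, 'k1) path \<Rightarrow> int ^ 'k1 \<Rightarrow> ('a, 'k1) path \<Rightarrow> int ^ 'k2" where
  "lag x c y = (THE d. \<exists>m n. c = int_vec m - int_vec n \<and> shifts_eq L1 m x n y \<and> d = \<kappa> m x - \<kappa> n y)"

lemma lag_eq: "lag x (int_vec m - int_vec n) y = \<kappa> m x - \<kappa> n y" if e: "shifts_eq L1 m x n y"
  unfolding lag_def
proof (rule the_equality)
  show "\<exists>m' n'. int_vec m - int_vec n = int_vec m' - int_vec n' \<and> shifts_eq L1 m' x n' y \<and>
      \<kappa> m x - \<kappa> n y = \<kappa> m' x - \<kappa> n' y"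
    using e by blast
  fix d assume "\<exists>m' n'. int_vec m - int_vec n = int_vec m' - int_vec n' \<and> shifts_eq L1 m' x n' y \<and>
      d = \<kappa> m' x - \<kappa> n' y"
  then show "d = \<kappa> m x - \<kappa> n y"
    using \<kappa>_diff_well_defined[OF e] by metis
qed

definition \<Phi> :: "('a, 'k1) bp_triple \<Rightarrow> ('b, 'k2) bp_triple" where
  "\<Phi> = (\<lambda>(x, c, y). (h x, lag x c y, h y))"

lemma \<Phi>_arr: "\<Phi> t \<in> arrows L2" if t: "t \<in> arrows L1"
proof -
  obtain x y p q where "t = (x, int_vec p - int_vec q, y)" and e: "shifts_eq L1 p x q y"
  using t by (blast elim: A.groupoid_arrE)
  then have "\<Phi> t = (h x, \<kappa> p x - \<kappa> q y, h y)" by (simp add: \<Phi>_def lag_eq)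
  then show ?thesis
    using transfer[OF e] B.groupoid_arr_iff by metis
qed

lemma lag_add:
  assumes "(x, c, y) \<in> arrows L1" "(y, d, z) \<in> arrows L1"
  shows "lag x (c + d) z = lag x c y + lag y d z"
proof -
  obtain p q where c: "c = int_vec p - int_vec q" and e: "shifts_eq L1 p x q y"
    using assms(1) A.groupoid_arr_iff by blast
  obtain p' q' where d: "d = int_vec p' - int_vec q'" and e': "shifts_eq L1 p' y q' z"
    using assms(2) A.groupoid_arr_iff by blast
  define a where "a = vec_max q p' - q"
  define b where "b = vec_max q p' - p'"
  have ab: "q + a = p' + b" by (simp add: a_def b_def vec_plus_minus)
  have E: "shifts_eq L1 (p + a) x (q' + b) z" "int_vec (p + a) - int_vec (q' + b) = c + d"
    using A.shifts_eq_compose(1)[OF e e'] A.shifts_eq_compose(2)[of p q p' q'] c d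
    by (simp_all only: a_def b_def)
  have y: "y \<in> boundary_paths_ge L1 (q + a)"
    using A.shifts_eq_ge(2)[OF e] A.shifts_eq_ge(1)[OF e']
    by (simp add: a_def vec_plus_minus A.boundary_paths_ge_max)
  have "\<kappa> q y + \<kappa> a (shift q y) = \<kappa> p' y + \<kappa> b (shift p' y)"
    using \<kappa>_add[OF y] \<kappa>_add[of y p' b] y ab by simp
  moreover have "\<kappa> (p + a) x = \<kappa> p x + \<kappa> a (shift q y)" "\<kappa> (q' + b) z = \<kappa> q' z + \<kappa> b (shift p' y)"
    using \<kappa>_add[OF A.shifts_eq_ge(1)[OF E(1)]] \<kappa>_add[OF A.shifts_eq_ge(2)[OF E(1)]]
      A.shifts_eq_ge(3)[OF e] A.shifts_eq_ge(3)[OF e'] by simp_all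
  ultimately have "\<kappa> (p + a) x - \<kappa> (q' + b) z = (\<kappa> p x - \<kappa> q y) + (\<kappa> p' y - \<kappa> q' z)"
    by (simp add: algebra_simps)
  then show "lag x (c + d) z = lag x c y + lag y d z"
    using lag_eq[OF E(1)] lag_eq[OF e] lag_eq[OF e'] unfolding E(2) c[symmetric] d[symmetric]
    by simp
qed

lemma lag_zero: "lag x 0 x = 0" if "x \<in> boundary_paths L1"
  using lag_eq[of 0 x 0 x] that A.shifts_eq_refl[of x 0] by simp

lemma lag_minus: "lag y (- c) x = - lag x c y" if t: "(x, c, y) \<in> arrows L1"
proof -
  have "x \<in> boundary_paths L1" using A.groupoid_ends[OF t] by simp
  then have "lag x c y + lag y (- c) x = 0"
    using lag_add[OF t A.groupoid_inverse[OF t]] lag_zero by simp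
  then show ?thesis by (simp add: minus_unique)
qed

lemma \<Phi>_functor: "cat_functor (bp_groupoid L1) (bp_groupoid L2) \<Phi>"
  unfolding cat_functor_def
proof (intro conjI ballI impI)
  fix t assume t: "t \<in> arrows L1"
  obtain x c y where xy: "t = (x, c, y)" by (metis prod.exhaust)
  have "lag x 0 x = 0" "lag y 0 y = 0"
    using A.groupoid_ends[OF t] lag_zero xy by simp_all
  then show "\<Phi> t \<in> arrows L2" "\<Phi> (Rng (bp_groupoid L1) t) = Rng (bp_groupoid L2) (\<Phi> t)"
    "\<Phi> (Src (bp_groupoid L1) t) = Src (bp_groupoid L2) (\<Phi> t)"
    using \<Phi>_arr[OF t] xy by (simp_all add: \<Phi>_def bp_groupoid_def)
  fix s assume s: "s \<in> arrows L1" "Src (bp_groupoid L1) t = Rng (bp_groupoid L1) s"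
  then obtain d z where yz: "s = (y, d, z)"
    using xy by (cases s) (auto simp: bp_groupoid_def)
  have "lag x (c + d) z = lag x c y + lag y d z"
    using lag_add[of x c y d z] t s xy yz by simp
  then show "\<Phi> (Comp (bp_groupoid L1) t s) = Comp (bp_groupoid L2) (\<Phi> t) (\<Phi> s)"
    by (simp add: xy yz \<Phi>_def bp_groupoid_def)
qed

text \<open>
  Near an arrow with witness \<open>(m, n)\<close> the images have a constant witness \<open>(p, q)\<close>. As basic
  neighbourhoods of the image may be taken with respect to \<open>(p, q)\<close>, only continuity of \<open>h\<close> at the two
  ends is left.
\<close>

lemma \<Phi>_continuous: "continuous_map (bp_groupoid_topology L1) (bp_groupoid_topology L2) \<Phi>"
  unfolding continuous_map_def A.topspace_groupoid B.topspace_groupoid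
proof (intro conjI allI impI)
  show "\<Phi> \<in> arrows L1 \<rightarrow> arrows L2" using \<Phi>_arr by blast
  fix W assume W: "open_arrows L2 W"
  show "open_arrows L1 {t \<in> arrows L1. \<Phi> t \<in> W}"
  proof (subst openin_subopen, intro ballI)
    fix t assume t: "t \<in> {t \<in> arrows L1. \<Phi> t \<in> W}"
    obtain x y m n where xy: "t = (x, int_vec m - int_vec n, y)" and e: "shifts_eq L1 m x n y"
    using t by (blast elim: A.groupoid_arrE)
    obtain p q U V where UV: "open_paths L1 U" "x \<in> U" "open_paths L1 V" "y \<in> V"
      "int_vec p - int_vec q = \<kappa> m x - \<kappa> n y"
      "\<forall>x'\<in>U. \<forall>y'\<in>V. shifts_eq L1 m x' n y' \<longrightarrow>
        shifts_eq L2 p (h x') q (h y') \<and> \<kappa> m x' - \<kappa> n y' = int_vec p - int_vec q"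
      by (rule transfer_locally[OF e])
    have \<Phi>: "\<Phi> (x', int_vec m - int_vec n, y') = (h x', int_vec p - int_vec q, h y')"
      "shifts_eq L2 p (h x') q (h y')"
      if "x' \<in> U" "y' \<in> V" "shifts_eq L1 m x' n y'" for x' y'
      using UV(6)[rule_format, OF that] lag_eq[OF that(3)] by (simp_all add: \<Phi>_def)
    then have "(h x, int_vec p - int_vec q, h y) \<in> W" "shifts_eq L2 p (h x) q (h y)"
      using t xy UV(2,4) e by auto
    then obtain U' V' where UV': "open_paths L2 U'" "h x \<in> U'" "open_paths L2 V'"
      "h y \<in> V'" "B.tail_nbhd p q U' V' \<subseteq> W"
      using B.tail_nbhd_base[OF W] by metis
    let ?U = "U \<inter> {x \<in> boundary_paths L1. h x \<in> U'}" and ?V = "V \<inter> {y \<in> boundary_paths L1. h y \<in> V'}"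
    have "open_arrows L1 (A.tail_nbhd m n ?U ?V)"
      by (intro A.openin_tail_nbhd openin_Int UV h_preimage UV')
    moreover have "t \<in> A.tail_nbhd m n ?U ?V"
      using xy UV UV' e A.shifts_eq_boundary[OF e] by (simp add: A.tail_nbhd_iff)
    moreover have "A.tail_nbhd m n ?U ?V \<subseteq> {t \<in> arrows L1. \<Phi> t \<in> W}"
    proof
      fix s assume "s \<in> A.tail_nbhd m n ?U ?V"
      then obtain x' y' where s: "s = (x', int_vec m - int_vec n, y')" "x' \<in> U" "h x' \<in> U'" "y' \<in> V" "h y' \<in> V'"
        "shifts_eq L1 m x' n y'"
        by (auto simp: A.tail_nbhd_def)
      then have "\<Phi> s \<in> B.tail_nbhd p q U' V'"
        using \<Phi>[OF s(2,4,6)] by (simp add: B.tail_nbhd_iff)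
      then show "s \<in> {t \<in> arrows L1. \<Phi> t \<in> W}"
        using UV'(5) s A.groupoid_arr_iff by auto
    qed
    ultimately show "\<exists>T. open_arrows L1 T \<and> t \<in> T \<and> T \<subseteq> {t \<in> arrows L1. \<Phi> t \<in> W}"
      by blast
  qed
qed

text \<open>
  A bijective \<open>\<Phi>\<close> is open, hence a homeomorphism: it covers the homeomorphism \<open>h\<close> of unit spaces,
  the range map of the first groupoid is open and that of the second is locally injective.
\<close>

lemma \<Phi>_isomorphism:
  assumes bij: "bij_betw \<Phi> (arrows L1) (arrows L2)"
  shows "topological_groupoid_iso (bp_groupoid L1) (bp_groupoid_topology L1)
    (bp_groupoid L2) (bp_groupoid_topology L2) \<Phi>"
proof -
  have fst: "fst (\<Phi> t) = h (fst t)" for t by (simp add: \<Phi>_def case_prod_beta)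
  have "open_map (bp_groupoid_topology L1) (bp_groupoid_topology L2) \<Phi>"
    unfolding open_map_def
  proof (intro allI impI, subst openin_subopen, intro ballI)
    fix W s assume W: "open_arrows L1 W" and "s \<in> \<Phi> ` W"
    then obtain t where t: "t \<in> W" "s = \<Phi> t" by blast
    have WA: "W \<subseteq> arrows L1" using openin_subset[OF W] by simp
    obtain C where C: "open_arrows L2 C" "\<Phi> t \<in> C" "inj_on fst C"
      using B.range_locally_injective[OF \<Phi>_arr] t WA by blast
    let ?W = "W \<inter> {t \<in> topspace (bp_groupoid_topology L1). \<Phi> t \<in> C}"
    \<comment> \<open>Inside \<open>C\<close> an arrow is determined by its range, so \<open>?S\<close> is contained in the image of \<open>W\<close>.\<close>
    let ?S = "C \<inter> {s \<in> topspace (bp_groupoid_topology L2). fst s \<in> h ` fst ` ?W}"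
    have oW: "open_arrows L1 ?W"
      by (intro openin_Int W openin_continuous_map_preimage[OF \<Phi>_continuous C(1)])
    have "open_arrows L2 ?S"
      by (intro openin_Int C(1) openin_continuous_map_preimage[OF B.continuous_range] h_open
        A.openin_range_image oW)
    moreover have "\<Phi> t \<in> ?S"
    proof -
      have "t \<in> ?W" using t C WA by auto
      then have "h (fst t) \<in> h ` fst ` ?W" by blast
      moreover have "\<Phi> t \<in> arrows L2" using t(1) WA \<Phi>_arr by blast
      ultimately show ?thesis using C(2) fst by simp
    qed
    moreover have "?S \<subseteq> \<Phi> ` W"
    proof
      fix u assume u: "u \<in> ?S"
      then obtain t' where t': "t' \<in> ?W" "fst u = h (fst t')" by blast
      then have "fst u = fst (\<Phi> t')" "\<Phi> t' \<in> C" "u \<in> C" using fst u by auto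
      then have "u = \<Phi> t'" using C(3) by (auto dest: inj_onD)
      then show "u \<in> \<Phi> ` W" using t' by blast
    qed
    ultimately show "\<exists>T. open_arrows L2 T \<and> s \<in> T \<and> T \<subseteq> \<Phi> ` W" using t by blast
  qed
  then have "homeomorphic_map (bp_groupoid_topology L1) (bp_groupoid_topology L2) \<Phi>"
    using \<Phi>_continuous bij
    by (intro bijective_open_imp_homeomorphic_map) (auto simp: bij_betw_def)
  moreover have "\<Phi> (Inv (bp_groupoid L1) t) = Inv (bp_groupoid L2) (\<Phi> t)" if "t \<in> arrows L1" for t
    using that lag_minus by (cases t) (simp add: \<Phi>_def bp_groupoid_def[of L1, THEN arg_cong[of _ _ Inv]]
      bp_groupoid_def[of L2, THEN arg_cong[of _ _ Inv]])
  ultimately show ?thesis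
    unfolding topological_groupoid_iso_def using bij \<Phi>_functor by blast
qed

lemma \<Phi>_graded:
  assumes \<Gamma>: "group \<Gamma>" and \<eta>1: "cat_functor L1 (group_category \<Gamma>) \<eta>1"
    and \<eta>2: "cat_functor L2 (group_category \<Gamma>) \<eta>2"
    and graded: "half_graded \<Gamma> L1 L2 \<eta>1 \<eta>2 h f g"
    and t: "t \<in> arrows L1"
  shows "grading_cocycle \<Gamma> L2 \<eta>2 (\<Phi> t) = grading_cocycle \<Gamma> L1 \<eta>1 t"
proof -
  interpret group \<Gamma> by fact
  obtain x y m n where xy: "t = (x, int_vec m - int_vec n, y)" and e: "shifts_eq L1 m x n y"
  using t by (blast elim: A.groupoid_arrE)
  note ge = A.shifts_eq_ge[OF e]
  define F where "F = vec_max (f m x) (f n y)"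
  define w where "w = h (shift m x)"
  have carrier2: "\<eta>2 (path_map z (0, k)) \<in> carrier \<Gamma>" if "z \<in> boundary_paths_ge L2 k" for z k
    using B.functor_group(1)[OF \<eta>2] B.path_initial[OF that] by blast
  have carrier1: "\<eta>1 (path_map z (0, k)) \<in> carrier \<Gamma>" if "z \<in> boundary_paths_ge L1 k" for z k
    using A.functor_group(1)[OF \<eta>1] A.path_initial[OF that] by blast
  have wF: "w \<in> boundary_paths_ge L2 F"
    using B.shifts_eq_ge(1)[OF family_shifts_eq[OF ge(1)]] B.shifts_eq_ge(1)[OF family_shifts_eq[OF ge(2)]] ge(3)
    by (simp add: F_def w_def B.boundary_paths_ge_max)
  \<comment> \<open>The factor from the initial segment of \<open>w\<close> of degree \<open>F\<close> is common to both ends and cancels.\<close>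
  have half: "\<eta>2 (path_map (h z) (0, g k z + (F - f k z))) = \<eta>1 (path_map z (0, k)) \<otimes>\<^bsub>\<Gamma>\<^esub> \<eta>2 (path_map w (0, F))"
    if z: "z \<in> boundary_paths_ge L1 k" and zw: "h (shift k z) = w" and le: "f k z \<le> F" for z k
  proof -
    have s: "shifts_eq L2 (f k z) w (g k z) (h z)" using family_shifts_eq[OF z] zw by simp
    have F: "f k z + (F - f k z) = F" using le by (rule vec_plus_minus)
    then have w': "w \<in> boundary_paths_ge L2 (f k z + (F - f k z))" using wF by simp
    have hz: "h z \<in> boundary_paths_ge L2 (g k z + (F - f k z))"
      using B.shifts_eq_ge(2)[OF B.shifts_eq_add[OF s w']] .
    let ?v = "\<eta>2 (path_map (shift (f k z) w) (0, F - f k z))"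
    let ?a = "\<eta>2 (path_map w (0, f k z))" and ?b = "\<eta>2 (path_map (h z) (0, g k z))"
    have c: "?v \<in> carrier \<Gamma>" "?a \<in> carrier \<Gamma>" "?b \<in> carrier \<Gamma>"
      using carrier2 B.shifts_eq_ge[OF s] w' B.boundary_paths_ge_add by blast+
    have "\<eta>2 (path_map (h z) (0, g k z + (F - f k z))) = ?b \<otimes>\<^bsub>\<Gamma>\<^esub> ?v"
      using B.functor_initial_add[OF \<eta>2 hz] B.shifts_eq_ge(3)[OF s] by simp
    moreover have "\<eta>2 (path_map w (0, F)) = ?a \<otimes>\<^bsub>\<Gamma>\<^esub> ?v"
      using B.functor_initial_add[OF \<eta>2 w'] F by simp
    moreover have "\<eta>1 (path_map z (0, k)) = ?b \<otimes>\<^bsub>\<Gamma>\<^esub> inv\<^bsub>\<Gamma>\<^esub> ?a"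
      using graded z zw by (simp add: half_graded_def)
    moreover have "?b \<otimes>\<^bsub>\<Gamma>\<^esub> inv\<^bsub>\<Gamma>\<^esub> ?a \<otimes>\<^bsub>\<Gamma>\<^esub> (?a \<otimes>\<^bsub>\<Gamma>\<^esub> ?v) = ?b \<otimes>\<^bsub>\<Gamma>\<^esub> ?v"
      using c by (simp add: m_assoc) (simp add: m_assoc[symmetric])
    ultimately show ?thesis by simp
  qed
  have "\<Phi> t = (h x, int_vec (left_witness m x n y) - int_vec (right_witness m x n y), h y)"
    using xy lag_eq[OF e] transfer(2)[OF e] by (simp add: \<Phi>_def)
  then have "grading_cocycle \<Gamma> L2 \<eta>2 (\<Phi> t) =
      \<eta>2 (path_map (h x) (0, left_witness m x n y)) \<otimes>\<^bsub>\<Gamma>\<^esub> inv\<^bsub>\<Gamma>\<^esub> \<eta>2 (path_map (h y) (0, right_witness m x n y))"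
    using B.grading_cocycle_eq[OF \<Gamma> \<eta>2 transfer(1)[OF e]] by simp
  also have "\<dots> = (\<eta>1 (path_map x (0, m)) \<otimes>\<^bsub>\<Gamma>\<^esub> \<eta>2 (path_map w (0, F))) \<otimes>\<^bsub>\<Gamma>\<^esub>
      inv\<^bsub>\<Gamma>\<^esub> (\<eta>1 (path_map y (0, n)) \<otimes>\<^bsub>\<Gamma>\<^esub> \<eta>2 (path_map w (0, F)))"
    using half[OF ge(1)] half[OF ge(2)] ge(3)
    by (simp add: left_witness_def right_witness_def F_def[symmetric] w_def) (simp add: F_def)
  also have "\<dots> = \<eta>1 (path_map x (0, m)) \<otimes>\<^bsub>\<Gamma>\<^esub> inv\<^bsub>\<Gamma>\<^esub> \<eta>1 (path_map y (0, n))"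
    using carrier1[OF ge(1)] carrier1[OF ge(2)] carrier2[OF wF]
    by (simp add: inv_mult_group m_assoc) (simp add: m_assoc[symmetric])
  also have "\<dots> = grading_cocycle \<Gamma> L1 \<eta>1 t"
    using A.grading_cocycle_eq[OF \<Gamma> \<eta>1 e] xy by simp
  finally show ?thesis .
qed

text \<open>
  If \<open>\<Phi>\<close> kills an isotropy arrow at \<open>x\<close> then it maps every nearby arrow to a unit. As \<open>h\<close> is
  injective, the nearby arrows are isotropy arrows themselves.
\<close>

lemma lag_kernel_subset_IP:
  assumes e: "shifts_eq L1 m x n x" and k: "\<kappa> m x = \<kappa> n x"
  shows "(m, n) \<in> IP_pairs L1 x"
proof -
  obtain p q U V where UV: "open_paths L1 U" "x \<in> U" "open_paths L1 V" "x \<in> V"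
    "int_vec p - int_vec q = \<kappa> m x - \<kappa> n x"
    "\<forall>x'\<in>U. \<forall>y'\<in>V. shifts_eq L1 m x' n y' \<longrightarrow>
        shifts_eq L2 p (h x') q (h y') \<and> \<kappa> m x' - \<kappa> n y' = int_vec p - int_vec q"
    by (rule transfer_locally[OF e])
  then have pq: "p = q" using k by simp
  have X: "x \<in> boundary_paths L1" using A.shifts_eq_boundary[OF e] by simp
  have hx: "h x \<in> boundary_paths_ge L2 p"
    using UV(6)[rule_format, OF UV(2,4) e] B.shifts_eq_ge by blast
  let ?l = "path_map (h x) (0, p)"
  note l = B.path_initial[OF hx]
  let ?W = "U \<inter> V \<inter> {y \<in> boundary_paths L1. h y \<in> cylinder L2 ?l}"
  \<comment> \<open>Every path in this set is the range of an arrow with witness \<open>(m, n)\<close> and source near \<open>x\<close>.\<close>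
  let ?O = "?W \<inter> {y \<in> boundary_paths_ge L1 m. shift m y \<in> shift n ` (?W \<inter> boundary_paths_ge L1 n)}"
  have W: "open_paths L1 ?W"
    by (intro openin_Int UV h_preimage B.openin_cylinder l)
  have xW: "x \<in> ?W" using UV X B.cylinder_initial[OF hx] by simp
  have "open_paths L1 ?O"
    by (intro openin_Int W A.openin_preimage_shift A.openin_image_shift)
  moreover have "x \<in> ?O" using xW A.shifts_eq_ge[OF e] by auto
  moreover have "shifts_eq L1 m y n y" if y: "y \<in> ?O" for y
  proof -
    obtain z where z: "y \<in> ?W" "z \<in> ?W" "shifts_eq L1 m y n z"
      using y by (auto simp: shifts_eq_def)
    then have "shifts_eq L2 p (h y) p (h z)" using UV(6)[rule_format, of y z] pq by simp
    moreover have "path_map (h y) (0, p) = path_map (h z) (0, p)"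
      using z l by (simp add: B.cylinder_iff)
    ultimately have "h y = h z"
      using B.path_eq_if_head_tail_eq[of "h y" p "h z"] by (simp add: shifts_eq_def)
    then have "y = z" using h_inj z by (auto dest: inj_onD)
    then show ?thesis using z by simp
  qed
  ultimately show ?thesis unfolding IP_pairs_def by blast
qed

text \<open>
  The witness of the image of an isotropy arrow is locally constant, so an isotropy arrow
  that persists nearby has an image that persists nearby.
\<close>

lemma lag_IP:
  assumes "(m, n) \<in> IP_pairs L1 x" and X: "x \<in> boundary_paths L1"
  shows "\<kappa> m x - \<kappa> n x \<in> IP L2 (h x)"
proof -
  obtain W where W: "open_paths L1 W" "x \<in> W" "\<And>y. y \<in> W \<Longrightarrow> shifts_eq L1 m y n y"
    using assms by (auto simp: IP_pairs_def)
  obtain p q U V where UV: "open_paths L1 U" "x \<in> U" "open_paths L1 V" "x \<in> V"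
    "int_vec p - int_vec q = \<kappa> m x - \<kappa> n x"
    "\<forall>x'\<in>U. \<forall>y'\<in>V. shifts_eq L1 m x' n y' \<longrightarrow>
        shifts_eq L2 p (h x') q (h y') \<and> \<kappa> m x' - \<kappa> n y' = int_vec p - int_vec q"
    by (rule transfer_locally[OF W(3)[OF W(2)]])
  have "open_paths L2 (h ` (U \<inter> V \<inter> W))"
    using UV W by (intro h_open openin_Int)
  then have "(p, q) \<in> IP_pairs L2 (h x)"
    unfolding IP_pairs_def using UV(2,4) W(2) UV(6) W(3)
    by (intro CollectI case_prodI exI[of _ "h ` (U \<inter> V \<inter> W)"]) auto
  then show ?thesis
    unfolding IP_def UV(5)[symmetric] by blast
qed

lemma lag_image:
  assumes R: "\<And>m n. R m n \<Longrightarrow> shifts_eq L1 m x n x"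
  shows "{int_vec (g m x) - int_vec (f m x) - int_vec (g n x) + int_vec (f n x) | m n. R m n} =
    (\<lambda>c. lag x c x) ` {int_vec m - int_vec n | m n. R m n}"
proof -
  have eq: "lag x (int_vec m - int_vec n) x = int_vec (g m x) - int_vec (f m x) - int_vec (g n x) + int_vec (f n x)"
    if "R m n" for m n
    using lag_eq[OF R[OF that]] by (simp add: \<kappa>_def)
  show ?thesis
  proof (intro subset_antisym subsetI)
    fix d assume "d \<in> {int_vec (g m x) - int_vec (f m x) - int_vec (g n x) + int_vec (f n x) | m n. R m n}"
    then obtain m n where "R m n" "d = lag x (int_vec m - int_vec n) x" using eq by auto
    then show "d \<in> (\<lambda>c. lag x c x) ` {int_vec m - int_vec n | m n. R m n}" by blast
  next
    fix d assume "d \<in> (\<lambda>c. lag x c x) ` {int_vec m - int_vec n | m n. R m n}"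
    then obtain m n where "R m n" "d = lag x (int_vec m - int_vec n) x" by blast
    with eq show "d \<in> {int_vec (g m x) - int_vec (f m x) - int_vec (g n x) + int_vec (f n x) | m n. R m n}"
      by blast
  qed
qed

lemma half_period_preserving_iff:
  "half_period_preserving L1 L2 h f g \<longleftrightarrow>
    (\<forall>x\<in>boundary_paths L1. (\<lambda>c. lag x c x) ` Per L1 x = Per L2 (h x))"
  unfolding half_period_preserving_def Per_def[of L1] by (simp only: lag_image)

lemma half_IP_preserving_iff:
  "half_IP_preserving L1 L2 h f g \<longleftrightarrow>
    (\<forall>x\<in>boundary_paths L1. (\<lambda>c. lag x c x) ` IP L1 x = IP L2 (h x))"
  unfolding half_IP_preserving_def IP_def[of L1] by (simp only: lag_image A.IP_pairs_shifts_eq)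

lemma lag_Per_subset: "(\<lambda>c. lag x c x) ` Per L1 x \<subseteq> Per L2 (h x)"
  using \<Phi>_arr[of "(x, _, x)"] A.groupoid_isotropy_iff B.groupoid_isotropy_iff by (auto simp: \<Phi>_def)

lemma lag_IP_subset: "x \<in> boundary_paths L1 \<Longrightarrow> (\<lambda>c. lag x c x) ` IP L1 x \<subseteq> IP L2 (h x)"
  using lag_IP lag_eq A.IP_pairs_shifts_eq by (auto simp: IP_def[of L1])

end

section \<open>Bijectivity from a pair of families of cocycles\<close>

locale family_pair =
  F: half_family L1 L2 h f g + R: half_family L2 L1 k i j
  for L1 :: "('a, 'k1::finite) kgraph" and L2 :: "('b, 'k2::finite) kgraph"
    and h :: "('a, 'k1) path \<Rightarrow> ('b, 'k2) path" and k :: "('b, 'k2) path \<Rightarrow> ('a, 'k1) path"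
    and f g :: "nat ^ 'k1 \<Rightarrow> ('a, 'k1) path \<Rightarrow> nat ^ 'k2"
    and i j :: "nat ^ 'k2 \<Rightarrow> ('b, 'k2) path \<Rightarrow> nat ^ 'k1" +
  assumes kh: "x \<in> boundary_paths L1 \<Longrightarrow> k (h x) = x"
    and hk: "y \<in> boundary_paths L2 \<Longrightarrow> h (k y) = y"
begin

lemma swap: "family_pair L2 L1 k h i j f g"
  by unfold_locales (simp_all add: hk kh)

text \<open>
  Orbits are the classes of tail equivalence, which \<open>h\<close> and \<open>k\<close> transfer by means of their cocycles.
\<close>

lemma orbit_equivalence: "orbit_equivalence L1 L2 h"
proof -
  have "h ` orbit L1 x = orbit L2 (h x)" if x: "x \<in> boundary_paths L1" for x
  proof (intro subset_antisym subsetI)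
    fix z assume "z \<in> h ` orbit L1 x"
    then obtain y m n where "z = h y" "shifts_eq L1 m x n y" using F.A.orbit_eq[OF x] by blast
    then show "z \<in> orbit L2 (h x)"
      using F.transfer(1) F.B.orbit_eq[OF F.h_boundary[OF x]] by blast
  next
    fix z assume "z \<in> orbit L2 (h x)"
    then obtain m n where e: "shifts_eq L2 m (h x) n z" using F.B.orbit_eq[OF F.h_boundary[OF x]] by blast
    then have "k z \<in> orbit L1 x" using R.transfer(1)[OF e] F.A.orbit_eq[OF x] kh[OF x] by auto
    moreover have "z = h (k z)" using hk F.B.shifts_eq_boundary[OF e] by simp
    ultimately show "z \<in> h ` orbit L1 x" by blast
  qed
  then show ?thesis using F.homeo by (simp add: orbit_equivalence_def)
qed

text \<open>
  The composite of the two homomorphisms need not be the identity, but it moves the lag of an arrow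
  only by an element of \<open>IP\<close> of its source. Indeed the composite fixes the range and source of every
  arrow and changes the lag by a locally constant amount, so the correction is an isotropy
  arrow that persists on a neighbourhood of the source.
\<close>

lemma round_trip_IP:
  assumes e: "shifts_eq L2 m x n y"
  shows "F.lag (k x) (R.lag x (int_vec m - int_vec n) y) (k y) - (int_vec m - int_vec n) \<in> IP L2 y"
proof -
  obtain a b U V where UV: "open_paths L2 U" "x \<in> U" "open_paths L2 V" "y \<in> V"
    "int_vec a - int_vec b = R.\<kappa> m x - R.\<kappa> n y"
    "\<forall>x'\<in>U. \<forall>y'\<in>V. shifts_eq L2 m x' n y' \<longrightarrow>
        shifts_eq L1 a (k x') b (k y') \<and> R.\<kappa> m x' - R.\<kappa> n y' = int_vec a - int_vec b"
    by (rule R.transfer_locally[OF e])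
  have e1: "shifts_eq L1 a (k x) b (k y)" using UV(2,4,6) e by blast
  obtain p q U' V' where UV': "open_paths L1 U'" "k x \<in> U'" "open_paths L1 V'" "k y \<in> V'"
    "int_vec p - int_vec q = F.\<kappa> a (k x) - F.\<kappa> b (k y)"
    "\<forall>x'\<in>U'. \<forall>y'\<in>V'. shifts_eq L1 a x' b y' \<longrightarrow>
        shifts_eq L2 p (h x') q (h y') \<and> F.\<kappa> a x' - F.\<kappa> b y' = int_vec p - int_vec q"
    by (rule F.transfer_locally[OF e1])
  let ?U = "U \<inter> {x \<in> boundary_paths L2. k x \<in> U'}" and ?V = "V \<inter> {y \<in> boundary_paths L2. k y \<in> V'}"
  have XY: "x \<in> boundary_paths L2" "y \<in> boundary_paths L2"
    using F.B.shifts_eq_boundary[OF e] by simp_all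
  \<comment> \<open>On \<open>?U\<close> and \<open>?V\<close> the round trip sends the witness \<open>(m, n)\<close> to the constant witness \<open>(p, q)\<close>.\<close>
  have persist: "shifts_eq L2 p x' q y'" if "x' \<in> ?U" "y' \<in> ?V" "shifts_eq L2 m x' n y'" for x' y'
  proof -
    have "shifts_eq L1 a (k x') b (k y')" using that UV(6) by blast
    then have "shifts_eq L2 p (h (k x')) q (h (k y'))" using that UV'(6) by blast
    then show ?thesis using that hk by simp
  qed
  \<comment> \<open>Near \<open>y\<close> every path is the source of an arrow with witness \<open>(m, n)\<close> and range near \<open>x\<close>; dividing its
    round trip by the arrow itself gives an isotropy arrow at the path.\<close>
  let ?O = "?V \<inter> {y' \<in> boundary_paths_ge L2 n. shift n y' \<in> shift m ` (?U \<inter> boundary_paths_ge L2 m)}"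
  have O: "open_paths L2 ?O"
    by (intro openin_Int F.B.openin_preimage_shift F.B.openin_image_shift UV UV' R.h_preimage)
  have xU: "x \<in> ?U" "y \<in> ?V" using UV UV' XY by auto
  have "shift n y \<in> shift m ` (?U \<inter> boundary_paths_ge L2 m)"
    using xU(1) F.B.shifts_eq_ge[OF e] by (intro image_eqI[of _ _ x]) simp_all
  then have yO: "y \<in> ?O" using xU(2) F.B.shifts_eq_ge(2)[OF e] by blast
  let ?a = "vec_max m p - m" and ?b = "vec_max m p - p"
  have "shifts_eq L2 (n + ?a) y' (q + ?b) y'" if y': "y' \<in> ?O" for y'
  proof -
    obtain x' where "x' \<in> ?U" "y' \<in> ?V" "shifts_eq L2 m x' n y'"
      using y' by (auto simp: shifts_eq_def)
    then show ?thesis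
      using F.B.shifts_eq_compose(1)[OF F.B.shifts_eq_sym persist] by blast
  qed
  then have "(n + ?a, q + ?b) \<in> IP_pairs L2 y"
    unfolding IP_pairs_def using O yO by blast
  then have "int_vec (n + ?a) - int_vec (q + ?b) \<in> IP L2 y"
    unfolding IP_def by blast
  moreover have "F.lag (k x) (R.lag x (int_vec m - int_vec n) y) (k y) = int_vec p - int_vec q"
    using R.lag_eq[OF e] UV(5) F.lag_eq[OF e1] UV'(5) by simp
  moreover have "int_vec n - int_vec m + (int_vec p - int_vec q) =
      int_vec p - int_vec q - (int_vec m - int_vec n)"
    by (simp add: algebra_simps)
  ultimately show ?thesis
    unfolding F.B.shifts_eq_compose(2) by metis
qed

text \<open>
  Let \<open>S\<close> be a family of subgroups between \<open>IP\<close> and \<open>Per\<close> (in the applications one of the two).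
  Surjectivity of both homomorphisms on \<open>S\<close> makes them injective on \<open>S\<close>, since the groups are
  subgroups of lattices. The kernel of \<open>\<Phi>\<close> lies in \<open>IP\<close>, hence in \<open>S\<close>, so \<open>\<Phi>\<close> is injective; and the
  deviation of the round trip from the identity lies in \<open>IP\<close>, hence in the image of \<open>\<Phi>\<close>.
\<close>

lemma \<Phi>_bijective:
  assumes S1: "\<And>x. x \<in> boundary_paths L1 \<Longrightarrow> lattice_subgroup (S1 x) \<and> IP L1 x \<subseteq> S1 x \<and> S1 x \<subseteq> Per L1 x"
    and S2: "\<And>y. y \<in> boundary_paths L2 \<Longrightarrow> IP L2 y \<subseteq> S2 y \<and> S2 y \<subseteq> Per L2 y"
    and F: "\<And>x. x \<in> boundary_paths L1 \<Longrightarrow> (\<lambda>c. F.lag x c x) ` S1 x = S2 (h x)"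
    and R: "\<And>y. y \<in> boundary_paths L2 \<Longrightarrow> (\<lambda>c. R.lag y c y) ` S2 y = S1 (k y)"
  shows "bij_betw F.\<Phi> (arrows L1) (arrows L2)"
  unfolding bij_betw_def
proof (intro conjI subset_antisym subsetI)
  have arr1: "(x, c, x) \<in> arrows L1" if "x \<in> boundary_paths L1" "c \<in> S1 x" for x c
    using that S1 F.A.groupoid_isotropy_iff by blast
  have kernel: "c = 0" if x: "x \<in> boundary_paths L1" and c: "c \<in> Per L1 x" "F.lag x c x = 0" for x c
  proof -
    obtain m n where c': "c = int_vec m - int_vec n" and e: "shifts_eq L1 m x n x"
      using c(1) by (auto simp: Per_def)
    then have "(m, n) \<in> IP_pairs L1 x"
      using F.lag_kernel_subset_IP[OF e] F.lag_eq[OF e] c(2) by simp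
    then have cS: "c \<in> S1 x" using S1[OF x] c' by (auto simp: IP_def)
    \<comment> \<open>The endomorphism of \<open>S1 x\<close> given by the round trip is onto, and \<open>F.lag\<close> is its first half.\<close>
    let ?T = "\<lambda>c. R.lag (h x) (F.lag x c x) (h x)"
    have hx: "h x \<in> boundary_paths L2" using x by (rule F.h_boundary)
    show "c = 0"
    proof (rule surjective_endomorphism_injective[where A = "S1 x" and T = ?T])
      show "lattice_subgroup (S1 x)" using S1[OF x] by blast
      show "c \<in> S1 x" by fact
      show "?T c = 0" using c(2) R.lag_zero[OF hx] by simp
      have "S1 x = (\<lambda>c. R.lag (h x) c (h x)) ` (\<lambda>c. F.lag x c x) ` S1 x"
        using F[OF x] R[OF hx] kh[OF x] by simp
      then show "S1 x \<subseteq> ?T ` S1 x" unfolding image_image by (rule equalityD1)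
      fix a b assume ab: "a \<in> S1 x" "b \<in> S1 x"
      have "F.lag x (a + b) x = F.lag x a x + F.lag x b x"
        using F.lag_add[OF arr1 arr1] x ab by blast
      moreover have "(h x, F.lag x d x, h x) \<in> arrows L2" if "d \<in> S1 x" for d
        using F.\<Phi>_arr[OF arr1[OF x that]] by (simp add: F.\<Phi>_def)
      ultimately show "?T (a + b) = ?T a + ?T b"
        using R.lag_add ab by simp
    qed
  qed
  show "inj_on F.\<Phi> (arrows L1)"
  proof (rule inj_onI)
    fix s t assume st: "s \<in> arrows L1" "t \<in> arrows L1" "F.\<Phi> s = F.\<Phi> t"
    obtain x c y where s: "s = (x, c, y)" by (metis prod.exhaust)
    obtain x' d y' where t: "t = (x', d, y')" by (metis prod.exhaust)
    have X: "x \<in> boundary_paths L1" "x' \<in> boundary_paths L1" "y \<in> boundary_paths L1" "y' \<in> boundary_paths L1"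
      using F.A.groupoid_ends[OF st(1)] F.A.groupoid_ends[OF st(2)] s t by simp_all
    have eq: "h x = h x'" "F.lag x c y = F.lag x' d y'" "h y = h y'"
      using st(3) s t by (simp_all add: F.\<Phi>_def)
    have xy: "x' = x" "y' = y" using eq X kh by metis+
    have sA: "(x, c, y) \<in> arrows L1" and tA: "(x, d, y) \<in> arrows L1"
      using st s t xy by simp_all
    have "(x, c + - d, x) \<in> arrows L1" "F.lag x (c + - d) x = 0"
      using F.A.groupoid_comp[OF sA F.A.groupoid_inverse[OF tA]]
        F.lag_add[OF sA F.A.groupoid_inverse[OF tA]] F.lag_minus[OF tA] eq(2) xy by simp_all
    then have "c + - d = 0" using kernel X(1) F.A.groupoid_isotropy_iff by blast
    then show "s = t" using s t xy by simp
  qed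
  show "t \<in> arrows L2" if "t \<in> F.\<Phi> ` arrows L1" for t
    using that F.\<Phi>_arr by blast
  fix t assume tA: "t \<in> arrows L2"
  obtain x y m n where t: "t = (x, int_vec m - int_vec n, y)" and e: "shifts_eq L2 m x n y"
  using tA by (blast elim: F.B.groupoid_arrE)
  have XY: "x \<in> boundary_paths L2" "y \<in> boundary_paths L2"
    using F.B.shifts_eq_boundary[OF e] by simp_all
  let ?c = "int_vec m - int_vec n"
  let ?l = "R.lag x ?c y"
  have "F.lag (k x) ?l (k y) - ?c \<in> S2 y"
    using round_trip_IP[OF e] S2[OF XY(2)] by blast
  then obtain d where d: "d \<in> S1 (k y)" "F.lag (k x) ?l (k y) - ?c = F.lag (k y) d (k y)"
    using F[OF R.h_boundary[OF XY(2)]] hk[OF XY(2)] by force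
  have l: "(k x, ?l, k y) \<in> arrows L1"
    using R.\<Phi>_arr[OF tA] t by (simp add: R.\<Phi>_def)
  note dA = arr1[OF R.h_boundary[OF XY(2)] d(1)]
  have "F.lag (k x) (?l + - d) (k y) = F.lag (k x) ?l (k y) - F.lag (k y) d (k y)"
    unfolding F.lag_add[OF l F.A.groupoid_inverse[OF dA]] F.lag_minus[OF dA] by simp
  also have "\<dots> = ?c"
    unfolding d(2)[symmetric] by simp
  finally have "F.\<Phi> (k x, ?l + - d, k y) = t"
    using t hk XY by (simp add: F.\<Phi>_def)
  then show "t \<in> F.\<Phi> ` arrows L1"
    using F.A.groupoid_comp[OF l F.A.groupoid_inverse[OF dA]] by blast
qed

text \<open>
  Each of the homomorphisms maps \<open>Per\<close> into \<open>Per\<close> and \<open>IP\<close> into \<open>IP\<close>; one whose right inverse does so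
  too is onto.
\<close>

lemma lag_surjective_if_inverse:
  assumes inv: "\<And>t. t \<in> arrows L2 \<Longrightarrow> F.\<Phi> (R.\<Phi> t) = t" and x: "x \<in> boundary_paths L1"
  shows "(\<lambda>c. F.lag x c x) ` Per L1 x = Per L2 (h x)" "(\<lambda>c. F.lag x c x) ` IP L1 x = IP L2 (h x)"
proof -
  have hx: "h x \<in> boundary_paths L2" using x by (rule F.h_boundary)
  have round: "F.lag x (R.lag (h x) d (h x)) x = d" if "d \<in> Per L2 (h x)" for d
    using inv[of "(h x, d, h x)"] that F.B.groupoid_isotropy_iff kh[OF x] by (simp add: F.\<Phi>_def R.\<Phi>_def)
  have Per: "R.lag (h x) d (h x) \<in> Per L1 x" if "d \<in> Per L2 (h x)" for d
    using R.lag_Per_subset[of "h x"] that kh[OF x] by auto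
  have IP: "R.lag (h x) d (h x) \<in> IP L1 x" if "d \<in> IP L2 (h x)" for d
    using R.lag_IP_subset[OF hx] that kh[OF x] by auto
  have "d \<in> (\<lambda>c. F.lag x c x) ` Per L1 x" if "d \<in> Per L2 (h x)" for d
    using round[OF that] Per[OF that] by (metis imageI)
  then show "(\<lambda>c. F.lag x c x) ` Per L1 x = Per L2 (h x)"
    using F.lag_Per_subset by blast
  have "d \<in> (\<lambda>c. F.lag x c x) ` IP L1 x" if "d \<in> IP L2 (h x)" for d
    using round[of d] IP[OF that] that F.B.IP_subset_Per by (metis imageI subsetD)
  then show "(\<lambda>c. F.lag x c x) ` IP L1 x = IP L2 (h x)"
    using F.lag_IP_subset[OF x] by blast
qed

end


section \<open>The family of cocycles of a groupoid isomorphism\<close>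

lemma inverse_functor:
  assumes C: "small_category C" and D: "small_category D"
    and F: "cat_functor C D F" and bij: "bij_betw F (Arr C) (Arr D)"
  shows "cat_functor D C (inv_into (Arr C) F)"
proof -
  let ?G = "inv_into (Arr C) F"
  have G: "?G b \<in> Arr C" "F (?G b) = b" if "b \<in> Arr D" for b
    using that bij by (auto simp: bij_betw_def inv_into_into f_inv_into_f)
  have GF: "?G (F a) = a" if "a \<in> Arr C" for a
    using that bij by (simp add: bij_betw_def)
  have cl: "Rng C a \<in> Arr C" "Src C a \<in> Arr C" if "a \<in> Arr C" for a
    using that C by (simp_all add: small_category_def)
  have Fa: "F (Rng C a) = Rng D (F a)" "F (Src C a) = Src D (F a)" if "a \<in> Arr C" for a
    using that F by (simp_all add: cat_functor_def)
  have ends: "?G (Rng D b) = Rng C (?G b)" "?G (Src D b) = Src C (?G b)" if "b \<in> Arr D" for b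
    using G[OF that] Fa[of "?G b"] GF[OF cl(1)] GF[OF cl(2)] by metis+
  have "?G (Comp D b c) = Comp C (?G b) (?G c)"
    if b: "b \<in> Arr D" "c \<in> Arr D" "Src D b = Rng D c" for b c
  proof -
    have s: "Src C (?G b) = Rng C (?G c)" using ends b by metis
    then have "Comp C (?G b) (?G c) \<in> Arr C" using C G(1) b by (simp add: small_category_def)
    moreover have "F (Comp C (?G b) (?G c)) = Comp D b c"
      using F G b s by (simp add: cat_functor_def)
    ultimately show ?thesis using GF by metis
  qed
  then show ?thesis unfolding cat_functor_def using G(1) ends by blast
qed

context two_graphs
begin

text \<open>
  A homomorphism over \<open>h\<close> sends \<open>(x, m, \<sigma>\<^sup>m(x))\<close> to an arrow from \<open>h (\<sigma>\<^sup>m(x))\<close> to \<open>h x\<close>. Composing with a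
  continuous choice of witnesses on the target groupoid gives \<open>(g m x, f m x)\<close>. Functoriality yields the
  cocycle identity and shows that the family recovers the homomorphism.
\<close>

lemma family_of_homomorphism:
  assumes \<Gamma>: "group \<Gamma>" and \<eta>1: "cat_functor L1 (group_category \<Gamma>) \<eta>1"
    and \<eta>2: "cat_functor L2 (group_category \<Gamma>) \<eta>2"
    and \<phi>: "cat_functor (bp_groupoid L1) (bp_groupoid L2) \<phi>"
    and cont: "continuous_map (bp_groupoid_topology L1) (bp_groupoid_topology L2) \<phi>"
    and unit: "\<And>x. x \<in> boundary_paths L1 \<Longrightarrow> \<phi> (x, 0, x) = (h x, 0, h x)"
    and grading: "\<And>t. t \<in> arrows L1 \<Longrightarrow>
      grading_cocycle \<Gamma> L2 \<eta>2 (\<phi> t) = grading_cocycle \<Gamma> L1 \<eta>1 t"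
  obtains f g where "half_cocycle_family L1 L2 h f g" "half_graded \<Gamma> L1 L2 \<eta>1 \<eta>2 h f g"
    "\<And>m x n y. shifts_eq L1 m x n y \<Longrightarrow> \<phi> (x, int_vec m - int_vec n, y) =
      (h x, (int_vec (g m x) - int_vec (f m x)) - (int_vec (g n y) - int_vec (f n y)), h y)"
proof -
  interpret group \<Gamma> by fact
  let ?Y = "\<lambda>m. subtopology (boundary_topology L1) (boundary_paths_ge L1 m)"
  define D where "D t = fst (snd (\<phi> t))" for t
  have \<phi>D: "\<phi> (x, c, y) = (h x, D (x, c, y), h y)" if t: "(x, c, y) \<in> arrows L1" for x c y
  proof -
    obtain u d v where uv: "\<phi> (x, c, y) = (u, d, v)" by (metis prod.exhaust)
    have "\<phi> (Rng (bp_groupoid L1) (x, c, y)) = Rng (bp_groupoid L2) (u, d, v)"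
      "\<phi> (Src (bp_groupoid L1) (x, c, y)) = Src (bp_groupoid L2) (u, d, v)"
      using \<phi> t uv unfolding cat_functor_def by metis+
    then have "\<phi> (x, 0, x) = (u, 0, u)" "\<phi> (y, 0, y) = (v, 0, v)"
      by (simp_all add: bp_groupoid_def)
    then show ?thesis
      using unit A.groupoid_ends[OF t] uv by (simp add: D_def)
  qed
  have D_add: "D (x, c + d, z) = D (x, c, y) + D (y, d, z)"
    if t: "(x, c, y) \<in> arrows L1" "(y, d, z) \<in> arrows L1" for x c y d z
  proof -
    have "Src (bp_groupoid L1) (x, c, y) = Rng (bp_groupoid L1) (y, d, z)"
      by (simp add: bp_groupoid_def)
    then have "\<phi> (Comp (bp_groupoid L1) (x, c, y) (y, d, z)) = Comp (bp_groupoid L2) (\<phi> (x, c, y)) (\<phi> (y, d, z))"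
      using \<phi> t unfolding cat_functor_def by blast
    then show ?thesis
      using \<phi>D[OF t(1)] \<phi>D[OF t(2)] \<phi>D[OF A.groupoid_comp[OF t]] by (simp add: bp_groupoid_def)
  qed
  have D_zero: "D (x, 0, x) = 0" if "x \<in> boundary_paths L1" for x
    using unit[OF that] by (simp add: D_def)
  have D_minus: "D (y, - c, x) = - D (x, c, y)" if t: "(x, c, y) \<in> arrows L1" for x c y
  proof -
    have "D (x, c, y) + D (y, - c, x) = 0"
      using D_add[OF t A.groupoid_inverse[OF t]] D_zero A.groupoid_ends[OF t] by simp
    then show ?thesis by (simp add: minus_unique)
  qed
  obtain P Q where
    P: "continuous_map (bp_groupoid_topology L2) (discrete_topology UNIV) P" and
    Q: "continuous_map (bp_groupoid_topology L2) (discrete_topology UNIV) Q" and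
    PQ: "\<And>x c y. (x, c, y) \<in> arrows L2 \<Longrightarrow>
      shifts_eq L2 (P (x, c, y)) x (Q (x, c, y)) y \<and> c = int_vec (P (x, c, y)) - int_vec (Q (x, c, y))"
    using B.continuous_lag by blast
  \<comment> \<open>The canonical arrow from \<open>\<sigma>\<^sup>m(x)\<close> to \<open>x\<close>; the family reads off the chosen witnesses of its image.\<close>
  define \<xi> where "\<xi> m x = (x, int_vec m, shift m x)" for m and x :: "('a, 'k1) path"
  define f where "f m x = Q (\<phi> (\<xi> m x))" for m x
  define g where "g m x = P (\<phi> (\<xi> m x))" for m x
  have \<xi>e: "shifts_eq L1 m x 0 (shift m x)" if "x \<in> boundary_paths_ge L1 m" for m x
    using that A.shift_boundary[OF that] by (simp add: shifts_eq_def)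
  have \<xi>A: "\<xi> m x \<in> arrows L1" if "x \<in> boundary_paths_ge L1 m" for m x
    using \<xi>e[OF that] unfolding \<xi>_def A.groupoid_arr_iff by (metis diff_zero int_vec_zero)
  have \<phi>\<xi>: "shifts_eq L2 (g m x) (h x) (f m x) (h (shift m x))"
    "D (\<xi> m x) = int_vec (g m x) - int_vec (f m x)" if x: "x \<in> boundary_paths_ge L1 m" for m x
  proof -
    have eq: "\<phi> (\<xi> m x) = (h x, D (\<xi> m x), h (shift m x))"
      using \<phi>D \<xi>A[OF x] by (simp add: \<xi>_def)
    have "\<phi> (\<xi> m x) \<in> arrows L2"
      using \<phi> \<xi>A[OF x] by (simp add: cat_functor_def)
    then have "shifts_eq L2 (P (\<phi> (\<xi> m x))) (h x) (Q (\<phi> (\<xi> m x))) (h (shift m x)) \<and>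
        D (\<xi> m x) = int_vec (P (\<phi> (\<xi> m x))) - int_vec (Q (\<phi> (\<xi> m x)))"
      using PQ unfolding eq by blast
    then show "shifts_eq L2 (g m x) (h x) (f m x) (h (shift m x))"
      "D (\<xi> m x) = int_vec (g m x) - int_vec (f m x)"
      by (simp_all add: f_def g_def)
  qed
  have \<xi>_cont: "continuous_map (?Y m)
      (bp_groupoid_topology L1) (\<xi> m)" for m
  proof -
    have Y: "topspace (?Y m) = boundary_paths_ge L1 m"
      by (auto simp: A.boundary_paths_ge_iff)
    have "open_paths L1 {x \<in> boundary_paths_ge L1 m. \<xi> m x \<in> W}"
      if W: "open_arrows L1 W" for W
    proof (subst openin_subopen, intro ballI)
      fix x assume x: "x \<in> {x \<in> boundary_paths_ge L1 m. \<xi> m x \<in> W}"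
      then have "(x, int_vec m - int_vec 0, shift m x) \<in> W" "shifts_eq L1 m x 0 (shift m x)"
        using \<xi>e by (simp_all add: \<xi>_def)
      then obtain U V where UV: "open_paths L1 U" "x \<in> U" "open_paths L1 V"
        "shift m x \<in> V" "A.tail_nbhd m 0 U V \<subseteq> W"
        using A.tail_nbhd_base[OF W] by metis
      let ?O = "U \<inter> {x \<in> boundary_paths_ge L1 m. shift m x \<in> V}"
      have "open_paths L1 ?O"
        by (intro openin_Int UV A.openin_preimage_shift)
      moreover have "x \<in> ?O" using UV x by simp
      moreover have "?O \<subseteq> {x \<in> boundary_paths_ge L1 m. \<xi> m x \<in> W}"
      proof
        fix z assume z: "z \<in> ?O"
        then have "\<xi> m z \<in> A.tail_nbhd m 0 U V"
          using \<xi>e by (simp add: A.tail_nbhd_iff \<xi>_def)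
        then show "z \<in> {x \<in> boundary_paths_ge L1 m. \<xi> m x \<in> W}" using UV(5) z by blast
      qed
      ultimately show "\<exists>T. open_paths L1 T \<and> x \<in> T \<and> T \<subseteq> {x \<in> boundary_paths_ge L1 m. \<xi> m x \<in> W}"
        by blast
    qed
    then show ?thesis
      unfolding continuous_map_def Y A.topspace_groupoid openin_open_subtopology[OF A.openin_boundary_paths_ge]
      using \<xi>A by auto
  qed
  have "half_cocycle_family L1 L2 h f g"
    unfolding half_cocycle_family_def
  proof (intro conjI allI ballI)
    fix m
    have c: "continuous_map (?Y m)
        (bp_groupoid_topology L2) (\<phi> \<circ> \<xi> m)"
      using \<xi>_cont cont by (rule continuous_map_compose)
    show "continuous_map (?Y m) (discrete_topology UNIV) (f m)"
      using continuous_map_compose[OF c Q] by (simp add: f_def[abs_def] comp_def)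
    show "continuous_map (?Y m) (discrete_topology UNIV) (g m)"
      using continuous_map_compose[OF c P] by (simp add: g_def[abs_def] comp_def)
    show "shifts_eq L2 (f m x) (h (shift m x)) (g m x) (h x)" if "x \<in> boundary_paths_ge L1 m" for x
      using \<phi>\<xi>(1)[OF that] by (rule B.shifts_eq_sym)
    fix n x assume x: "x \<in> boundary_paths_ge L1 (m + n)"
    then have x': "x \<in> boundary_paths_ge L1 m" "shift m x \<in> boundary_paths_ge L1 n"
      by (simp_all add: A.boundary_paths_ge_add)
    have "D (\<xi> (m + n) x) = D (\<xi> m x) + D (\<xi> n (shift m x))"
      using D_add[OF \<xi>A[OF x'(1), unfolded \<xi>_def] \<xi>A[OF x'(2), unfolded \<xi>_def]] A.shift_shift[OF x]
      by (simp add: \<xi>_def)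
    then show "int_vec (g (m + n) x) - int_vec (f (m + n) x) =
        (int_vec (g m x) - int_vec (f m x)) + (int_vec (g n (shift m x)) - int_vec (f n (shift m x)))"
      using \<phi>\<xi>(2) x x' by simp
  qed
  moreover have "half_graded \<Gamma> L1 L2 \<eta>1 \<eta>2 h f g"
    unfolding half_graded_def
  proof (intro allI ballI)
    fix m x assume x: "x \<in> boundary_paths_ge L1 m"
    have v: "path_map (shift m x) (0, 0) \<in> Arr L1" "Rng L1 (path_map (shift m x) (0, 0)) = path_map (shift m x) (0, 0)"
      using A.path_range_arr[OF A.shift_boundary[OF x]] by (simp_all add: path_range_def)
    then have one: "\<eta>1 (path_map (shift m x) (0, 0)) = \<one>\<^bsub>\<Gamma>\<^esub>"
      using \<eta>1 unfolding cat_functor_def group_category_def by (metis category.select_convs(2))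
    have "\<phi> (\<xi> m x) = (h x, int_vec (g m x) - int_vec (f m x), h (shift m x))"
      using \<phi>D \<xi>A[OF x] \<phi>\<xi>(2)[OF x] by (simp add: \<xi>_def)
    then have "grading_cocycle \<Gamma> L2 \<eta>2 (\<phi> (\<xi> m x)) =
        \<eta>2 (path_map (h x) (0, g m x)) \<otimes>\<^bsub>\<Gamma>\<^esub> inv\<^bsub>\<Gamma>\<^esub> \<eta>2 (path_map (h (shift m x)) (0, f m x))"
      using B.grading_cocycle_eq[OF \<Gamma> \<eta>2 \<phi>\<xi>(1)[OF x]] by simp
    moreover have "grading_cocycle \<Gamma> L1 \<eta>1 (\<xi> m x) = \<eta>1 (path_map x (0, m))"
      using A.grading_cocycle_eq[OF \<Gamma> \<eta>1 \<xi>e[OF x]] one A.functor_group(1)[OF \<eta>1] A.path_initial(1)[OF x]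
      by (simp add: \<xi>_def)
    ultimately show "\<eta>1 (path_map x (0, m)) =
        \<eta>2 (path_map (h x) (0, g m x)) \<otimes>\<^bsub>\<Gamma>\<^esub> inv\<^bsub>\<Gamma>\<^esub> \<eta>2 (path_map (h (shift m x)) (0, f m x))"
      using grading[OF \<xi>A[OF x]] by simp
  qed
  moreover have "\<phi> (x, int_vec m - int_vec n, y) =
      (h x, (int_vec (g m x) - int_vec (f m x)) - (int_vec (g n y) - int_vec (f n y)), h y)"
    if e: "shifts_eq L1 m x n y" for m x n y
  proof -
    have x: "\<xi> m x \<in> arrows L1" and y: "\<xi> n y \<in> arrows L1" and "shift m x = shift n y"
      using \<xi>A A.shifts_eq_ge[OF e] by simp_all
    then have y': "(y, int_vec n, shift m x) \<in> arrows L1" "(x, int_vec m, shift m x) \<in> arrows L1"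
      by (simp_all add: \<xi>_def)
    have "D (x, int_vec m + - int_vec n, y) = D (\<xi> m x) - D (\<xi> n y)"
      using D_add[OF y'(2) A.groupoid_inverse[OF y'(1)]] D_minus[OF y'(1)] \<open>shift m x = shift n y\<close>
      by (simp add: \<xi>_def)
    then show ?thesis
      using \<phi>D[OF A.groupoid_comp[OF y'(2) A.groupoid_inverse[OF y'(1)]]] \<phi>\<xi>(2) A.shifts_eq_ge[OF e] by simp
  qed
  ultimately show ?thesis using that by blast
qed

end

section \<open>Groupoid isomorphisms and graded orbit equivalences\<close>

context two_graphs
begin

lemma family_pairI:
  assumes "half_cocycle_family L1 L2 h f g" "half_cocycle_family L2 L1 h_inv i j"
  shows "family_pair L1 L2 h h_inv f g i j"
  using assms homeo_inv by unfold_locales simp_all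

lemma isomorphism_of_family:
  assumes \<Gamma>: "group \<Gamma>" and \<eta>1: "cat_functor L1 (group_category \<Gamma>) \<eta>1"
    and \<eta>2: "cat_functor L2 (group_category \<Gamma>) \<eta>2"
    and family: "cocycle_family L1 L2 h f g i j"
    and graded: "graded_family \<Gamma> L1 L2 \<eta>1 \<eta>2 h f g i j"
    and periods: "period_preserving_family L1 L2 h f g i j \<or> IP_preserving_family L1 L2 h f g i j"
  shows "\<exists>\<phi>. topological_groupoid_iso (bp_groupoid L1) (bp_groupoid_topology L1)
               (bp_groupoid L2) (bp_groupoid_topology L2) \<phi> \<and>
             (\<forall>t\<in>arrows L1. grading_cocycle \<Gamma> L2 \<eta>2 (\<phi> t) = grading_cocycle \<Gamma> L1 \<eta>1 t) \<and>
             (\<forall>x\<in>boundary_paths L1. \<phi> (x, 0, x) = (h x, 0, h x))"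
proof -
  interpret pair: family_pair L1 L2 h h_inv f g i j
    using family by (intro family_pairI) (simp_all add: cocycle_family_def)
  have "bij_betw pair.F.\<Phi> (arrows L1) (arrows L2)"
  proof (cases "period_preserving_family L1 L2 h f g i j")
    case True
    then show ?thesis
      using A.Per_subgroup A.IP_subset_Per B.IP_subset_Per pair.F.half_period_preserving_iff
        pair.R.half_period_preserving_iff
      by (intro pair.\<Phi>_bijective[of "Per L1" "Per L2"]) (auto simp: period_preserving_family_def)
  next
    case False
    then show ?thesis
      using A.IP_subgroup A.IP_subset_Per B.IP_subset_Per pair.F.half_IP_preserving_iff
        pair.R.half_IP_preserving_iff periods
      by (intro pair.\<Phi>_bijective[of "IP L1" "IP L2"]) (auto simp: IP_preserving_family_def)
  qed
  then show ?thesis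
    using pair.F.\<Phi>_isomorphism pair.F.\<Phi>_graded[OF \<Gamma> \<eta>1 \<eta>2] graded pair.F.lag_zero
    by (intro exI[of _ pair.F.\<Phi>]) (auto simp: graded_family_def pair.F.\<Phi>_def)
qed

lemma family_of_isomorphism:
  assumes \<Gamma>: "group \<Gamma>" and \<eta>1: "cat_functor L1 (group_category \<Gamma>) \<eta>1"
    and \<eta>2: "cat_functor L2 (group_category \<Gamma>) \<eta>2"
    and iso: "topological_groupoid_iso (bp_groupoid L1) (bp_groupoid_topology L1)
               (bp_groupoid L2) (bp_groupoid_topology L2) \<phi>"
    and grading: "\<forall>t\<in>arrows L1. grading_cocycle \<Gamma> L2 \<eta>2 (\<phi> t) = grading_cocycle \<Gamma> L1 \<eta>1 t"
    and unit: "\<forall>x\<in>boundary_paths L1. \<phi> (x, 0, x) = (h x, 0, h x)"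
  shows "orbit_equivalence L1 L2 h \<and>
    (\<exists>f g i j. cocycle_family L1 L2 h f g i j \<and> graded_family \<Gamma> L1 L2 \<eta>1 \<eta>2 h f g i j \<and>
      period_preserving_family L1 L2 h f g i j \<and> IP_preserving_family L1 L2 h f g i j)"
proof -
  interpret inverse: two_graphs L2 L1 h_inv
    by unfold_locales (rule homeo_inv)
  let ?G1 = "bp_groupoid L1" and ?G2 = "bp_groupoid L2"
  let ?\<psi> = "inv_into (Arr ?G1) \<phi>"
  have bij: "bij_betw \<phi> (Arr ?G1) (Arr ?G2)" and func: "cat_functor ?G1 ?G2 \<phi>"
    and homeo\<phi>: "homeomorphic_map (bp_groupoid_topology L1) (bp_groupoid_topology L2) \<phi>"
    using iso by (simp_all add: topological_groupoid_iso_def)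
  have \<psi>: "?\<psi> t \<in> Arr ?G1" "\<phi> (?\<psi> t) = t" if "t \<in> Arr ?G2" for t
    using that bij by (auto simp: bij_betw_def inv_into_into f_inv_into_f)
  have \<psi>\<phi>: "?\<psi> (\<phi> t) = t" if "t \<in> Arr ?G1" for t
    using that bij by (simp add: bij_betw_def)
  have func': "cat_functor ?G2 ?G1 ?\<psi>"
    using A.groupoid_category B.groupoid_category func bij by (rule inverse_functor)
  have cont: "continuous_map (bp_groupoid_topology L1) (bp_groupoid_topology L2) \<phi>"
    using homeo\<phi> by (rule homeomorphic_imp_continuous_map)
  have cont': "continuous_map (bp_groupoid_topology L2) (bp_groupoid_topology L1) ?\<psi>"
  proof -
    obtain \<psi>' where \<psi>': "homeomorphic_maps (bp_groupoid_topology L1) (bp_groupoid_topology L2) \<phi> \<psi>'"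
      using homeo\<phi> homeomorphic_map_maps by blast
    have "\<psi>' t = ?\<psi> t" if "t \<in> topspace (bp_groupoid_topology L2)" for t
      using \<psi>[of t] \<psi>' that unfolding homeomorphic_maps_def by (metis A.topspace_groupoid B.topspace_groupoid)
    then show ?thesis
      using \<psi>' continuous_map_eq unfolding homeomorphic_maps_def by blast
  qed
  have unit': "?\<psi> (y, 0, y) = (h_inv y, 0, h_inv y)" if y: "y \<in> boundary_paths L2" for y
    using \<psi>\<phi>[OF A.groupoid_unit[OF h_inv_boundary[OF y]]] unit h_inv_boundary[OF y] y by simp
  have grading': "grading_cocycle \<Gamma> L1 \<eta>1 (?\<psi> t) = grading_cocycle \<Gamma> L2 \<eta>2 t" if "t \<in> Arr ?G2" for t
    using grading \<psi>[OF that] by metis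
  obtain f g where fg: "half_cocycle_family L1 L2 h f g" "half_graded \<Gamma> L1 L2 \<eta>1 \<eta>2 h f g"
    "\<And>m x n y. shifts_eq L1 m x n y \<Longrightarrow> \<phi> (x, int_vec m - int_vec n, y) =
      (h x, (int_vec (g m x) - int_vec (f m x)) - (int_vec (g n y) - int_vec (f n y)), h y)"
    using family_of_homomorphism[OF \<Gamma> \<eta>1 \<eta>2 func cont] unit grading by blast
  obtain i j where ij: "half_cocycle_family L2 L1 h_inv i j" "half_graded \<Gamma> L2 L1 \<eta>2 \<eta>1 h_inv i j"
    "\<And>m x n y. shifts_eq L2 m x n y \<Longrightarrow> ?\<psi> (x, int_vec m - int_vec n, y) =
      (h_inv x, (int_vec (j m x) - int_vec (i m x)) - (int_vec (j n y) - int_vec (i n y)), h_inv y)"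
    using inverse.family_of_homomorphism[OF \<Gamma> \<eta>2 \<eta>1 func' cont'] unit' grading' by blast
  interpret pair: family_pair L1 L2 h h_inv f g i j
    using fg(1) ij(1) by (rule family_pairI)
  interpret swap: family_pair L2 L1 h_inv h i j f g
    by (rule pair.swap)
  have \<Phi>: "pair.F.\<Phi> t = \<phi> t" if t: "t \<in> Arr ?G1" for t
  proof -
    obtain x y m n where "t = (x, int_vec m - int_vec n, y)" and e: "shifts_eq L1 m x n y"
    using t by (blast elim: A.groupoid_arrE)
    then show ?thesis
      using fg(3)[OF e] pair.F.lag_eq[OF e] by (simp add: pair.F.\<Phi>_def pair.F.\<kappa>_def)
  qed
  have \<Psi>: "pair.R.\<Phi> t = ?\<psi> t" if t: "t \<in> Arr ?G2" for t
  proof -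
    obtain x y m n where "t = (x, int_vec m - int_vec n, y)" and e: "shifts_eq L2 m x n y"
    using t by (blast elim: B.groupoid_arrE)
    then show ?thesis
      using ij(3)[OF e] pair.R.lag_eq[OF e] by (simp add: pair.R.\<Phi>_def pair.R.\<kappa>_def)
  qed
  have 1: "pair.F.\<Phi> (pair.R.\<Phi> t) = t" if "t \<in> Arr ?G2" for t
    using \<Phi> \<Psi> \<psi> that by simp
  have 2: "pair.R.\<Phi> (pair.F.\<Phi> t) = t" if "t \<in> Arr ?G1" for t
    using \<Phi> \<Psi> \<psi>\<phi> that pair.F.\<Phi>_arr[OF that] by simp
  have "period_preserving_family L1 L2 h f g i j" "IP_preserving_family L1 L2 h f g i j"
    using pair.lag_surjective_if_inverse[OF 1] swap.lag_surjective_if_inverse[OF 2]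
    by (simp_all add: period_preserving_family_def IP_preserving_family_def
      pair.F.half_period_preserving_iff pair.R.half_period_preserving_iff
      pair.F.half_IP_preserving_iff pair.R.half_IP_preserving_iff)
  then show ?thesis
    using pair.orbit_equivalence fg ij unfolding cocycle_family_def graded_family_def by blast
qed

end

theorem proposition3p8:
  fixes \<Gamma> :: "('g, 'c) monoid_scheme"
    and L1 :: "('a, 'k1::finite) kgraph" and L2 :: "('b, 'k2::finite) kgraph"
    and \<eta>1 :: "'a \<Rightarrow> 'g" and \<eta>2 :: "'b \<Rightarrow> 'g"
    and h :: "('a, 'k1) path \<Rightarrow> ('b, 'k2) path"
  assumes "group \<Gamma>"
    and "is_kgraph L1" and "finitely_aligned L1"
    and "is_kgraph L2" and "finitely_aligned L2"
    and "cat_functor L1 (group_category \<Gamma>) \<eta>1"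
    and "cat_functor L2 (group_category \<Gamma>) \<eta>2"
    and "homeomorphic_map (boundary_topology L1) (boundary_topology L2) h"
  shows
    "((\<exists>\<phi>. topological_groupoid_iso (bp_groupoid L1) (bp_groupoid_topology L1)
               (bp_groupoid L2) (bp_groupoid_topology L2) \<phi> \<and>
             (\<forall>t\<in>Arr (bp_groupoid L1).
                grading_cocycle \<Gamma> L2 \<eta>2 (\<phi> t) = grading_cocycle \<Gamma> L1 \<eta>1 t) \<and>
             (\<forall>x\<in>boundary_paths L1. \<phi> (x, 0, x) = (h x, 0, h x)))
       \<longleftrightarrow> graded_period_preserving_coe \<Gamma> L1 L2 \<eta>1 \<eta>2 h)
     \<and>
     (graded_period_preserving_coe \<Gamma> L1 L2 \<eta>1 \<eta>2 h
       \<longleftrightarrow> orbit_equivalence L1 L2 h \<and>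
           (\<exists>f g i j. cocycle_family L1 L2 h f g i j \<and>
              graded_family \<Gamma> L1 L2 \<eta>1 \<eta>2 h f g i j \<and>
              IP_preserving_family L1 L2 h f g i j))"
  (is "(?iso \<longleftrightarrow> ?coe) \<and> (?coe \<longleftrightarrow> ?orbit \<and> ?IP)")
proof -
  interpret two_graphs L1 L2 h
    using assms(2-5,8) by unfold_locales
  note backward = isomorphism_of_family[OF assms(1,6,7)]
    and forward = family_of_isomorphism[OF assms(1,6,7)]
  have "?iso" if "?coe"
    using that backward unfolding graded_period_preserving_coe_def by blast
  moreover have "?iso" if "?IP"
    using that backward by blast
  moreover have "?coe \<and> ?orbit \<and> ?IP" if "?iso"
    using that forward unfolding graded_period_preserving_coe_def by blast
  ultimately show ?thesis by blast
qed

end
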